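(* Let $K \geq 3$, $N \geq 1$ and $d \geq 1$ be integers, and suppose $d_i = d$ and $M_i = N_i = N$ for all $1 \leq i \leq K$. Let $\mathcal H = \prod_{1 \leq i \neq j \leq K} \mathbb{C}^{N \times N}$ be the space of tuples $h = (H_{ij})_{i \neq j}$ of cross-channel matrices. Then for generic $h \in \mathcal H$: if $Kd(2N - (K+1)d) \geq 0$, the variety $\mathcal F(h)$ of feasible strategies is non-empty and has dimension $Kd(2N - (K+1)d)$; and if $Kd(2N-(K+1)d) < 0$, then $\mathcal F(h)$ is empty.
   Context: For $h = (H_{ij})_{i\neq j}$ with $H_{ij} \in \mathbb{C}^{N \times N}$, a feasible strategy is a tuple $(U_1, \ldots, U_K, V_1, \ldots, V_K)$ of $d$-dimensional linear subspaces of $\mathbb{C}^N$ such that $v^T H_{ij} u = 0$ for all $v \in V_i$, $u \in U_j$ and all $i \neq j$. The variety $\mathcal F(h)$ of feasible strategies is the set of such tuples, a closed subvariety of $G(d,N)^{2K}$, where $G(d,N)$ is the Grassmannian of $d$-dimensional subspaces of $\mathbb{C}^N$; its dimension is the maximum dimension of its irreducible components. A statement holds "for generic $h$" if it holds for all $h$ in some nonempty Zariski-open (hence dense) subset of $\mathcal H$. *)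

theory Defs
  imports Complex_Main
begin

inductive_set poly_fun :: "(('i \<Rightarrow> complex) \<Rightarrow> complex) set" where
  pconst: "(\<lambda>x. c) \<in> poly_fun"
| pvar: "(\<lambda>x. x i) \<in> poly_fun"
| padd: "p \<in> poly_fun \<Longrightarrow> q \<in> poly_fun \<Longrightarrow> (\<lambda>x. p x + q x) \<in> poly_fun"
| pmult: "p \<in> poly_fun \<Longrightarrow> q \<in> poly_fun \<Longrightarrow> (\<lambda>x. p x * q x) \<in> poly_fun"

definition zero_set :: "(('i \<Rightarrow> complex) \<Rightarrow> complex) set \<Rightarrow> ('i \<Rightarrow> complex) set" where
  "zero_set P = {x. \<forall>p\<in>P. p x = 0}"

definition zariski_closed_in :: "('i \<Rightarrow> complex) set \<Rightarrow> ('i \<Rightarrow> complex) set \<Rightarrow> bool" where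
  "zariski_closed_in S C \<longleftrightarrow> C \<subseteq> S \<and> (\<exists>P \<subseteq> poly_fun. C = S \<inter> zero_set P)"

definition zariski_open_in :: "('i \<Rightarrow> complex) set \<Rightarrow> ('i \<Rightarrow> complex) set \<Rightarrow> bool" where
  "zariski_open_in S W \<longleftrightarrow> W \<subseteq> S \<and> zariski_closed_in S (S - W)"

text \<open>h (i,j,a,b) is the (a,b) entry of H_ij; indices i,j < K with i \<noteq> j, a,b < N.
  Coordinates outside this range are fixed to 0, so Hspace is a copy of the affine space
  of all tuples (H_ij)_{i\<noteq>j} of N\<times>N complex matrices.\<close>
definition Hspace :: "nat \<Rightarrow> nat \<Rightarrow> (nat \<times> nat \<times> nat \<times> nat \<Rightarrow> complex) set" where
  "Hspace K N = {h. \<forall>i j a b. h (i,j,a,b) \<noteq> 0 \<longrightarrow> i < K \<and> j < K \<and> i \<noteq> j \<and> a < N \<and> b < N}"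

definition generic :: "nat \<Rightarrow> nat \<Rightarrow> ((nat \<times> nat \<times> nat \<times> nat \<Rightarrow> complex) \<Rightarrow> bool) \<Rightarrow> bool" where
  "generic K N Q \<longleftrightarrow> (\<exists>W. zariski_open_in (Hspace K N) W \<and> W \<noteq> {} \<and> (\<forall>h\<in>W. Q h))"

text \<open>Vectors of C^N are functions nat \<Rightarrow> complex vanishing from index N on.
  An N\<times>d matrix A is given by its entries A k l (k < N, l < d).\<close>
definition colspace :: "nat \<Rightarrow> nat \<Rightarrow> (nat \<Rightarrow> nat \<Rightarrow> complex) \<Rightarrow> (nat \<Rightarrow> complex) set" where
  "colspace N d A = {v. \<exists>c. v = (\<lambda>k. if k < N then (\<Sum>l<d. A k l * c l) else 0)}"

definition full_rank :: "nat \<Rightarrow> nat \<Rightarrow> (nat \<Rightarrow> nat \<Rightarrow> complex) \<Rightarrow> bool" where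
  "full_rank N d A \<longleftrightarrow> (\<forall>c. (\<forall>k<N. (\<Sum>l<d. A k l * c l) = 0) \<longrightarrow> (\<forall>l<d. c l = 0))"

definition grassmannian :: "nat \<Rightarrow> nat \<Rightarrow> (nat \<Rightarrow> complex) set set" where
  "grassmannian d N = {colspace N d A | A. full_rank N d A}"

type_synonym strategy = "(nat \<Rightarrow> (nat \<Rightarrow> complex) set) \<times> (nat \<Rightarrow> (nat \<Rightarrow> complex) set)"

text \<open>Points of G(d,N)^{2K}: (U_1..U_K, V_1..V_K), indexed 0..K-1 (extensional outside).\<close>
definition strategies :: "nat \<Rightarrow> nat \<Rightarrow> nat \<Rightarrow> strategy set" where
  "strategies K d N = {(U, V). (\<forall>i<K. U i \<in> grassmannian d N \<and> V i \<in> grassmannian d N)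
                               \<and> (\<forall>i\<ge>K. U i = {} \<and> V i = {})}"

definition feasible :: "nat \<Rightarrow> nat \<Rightarrow> (nat \<times> nat \<times> nat \<times> nat \<Rightarrow> complex) \<Rightarrow> strategy \<Rightarrow> bool" where
  "feasible K N h s \<longleftrightarrow> (\<forall>i<K. \<forall>j<K. i \<noteq> j \<longrightarrow>
      (\<forall>v\<in>snd s i. \<forall>u\<in>fst s j. (\<Sum>a<N. \<Sum>b<N. v a * h (i,j,a,b) * u b) = 0))"

definition feasible_set :: "nat \<Rightarrow> nat \<Rightarrow> nat \<Rightarrow> (nat \<times> nat \<times> nat \<times> nat \<Rightarrow> complex) \<Rightarrow> strategy set" where
  "feasible_set K d N h = {s \<in> strategies K d N. feasible K N h s}"

text \<open>A tuple of 2K matrices of size N\<times>d: x (s,i,k,l) is entry (k,l) of the i-th matrix,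
  s = False for the U-part, s = True for the V-part. The Zariski topology on G(d,N)^{2K} is the
  quotient topology from the (open) Stiefel set of tuples of full rank matrices.\<close>
definition stiefel_tuples :: "nat \<Rightarrow> nat \<Rightarrow> nat \<Rightarrow> (bool \<times> nat \<times> nat \<times> nat \<Rightarrow> complex) set" where
  "stiefel_tuples K d N = {x. (\<forall>s i k l. x (s,i,k,l) \<noteq> 0 \<longrightarrow> i < K \<and> k < N \<and> l < d)
       \<and> (\<forall>s. \<forall>i<K. full_rank N d (\<lambda>k l. x (s,i,k,l)))}"

definition strat_of :: "nat \<Rightarrow> nat \<Rightarrow> nat \<Rightarrow> (bool \<times> nat \<times> nat \<times> nat \<Rightarrow> complex) \<Rightarrow> strategy" where
  "strat_of K d N x = ((\<lambda>i. if i < K then colspace N d (\<lambda>k l. x (False,i,k,l)) else {}),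
                      (\<lambda>i. if i < K then colspace N d (\<lambda>k l. x (True,i,k,l)) else {}))"

definition grass_closed :: "nat \<Rightarrow> nat \<Rightarrow> nat \<Rightarrow> strategy set \<Rightarrow> bool" where
  "grass_closed K d N C \<longleftrightarrow> C \<subseteq> strategies K d N \<and>
     zariski_closed_in (stiefel_tuples K d N) {x \<in> stiefel_tuples K d N. strat_of K d N x \<in> C}"

definition closed_in_sub :: "nat \<Rightarrow> nat \<Rightarrow> nat \<Rightarrow> strategy set \<Rightarrow> strategy set \<Rightarrow> bool" where
  "closed_in_sub K d N S C \<longleftrightarrow> C \<subseteq> S \<and> (\<exists>C'. grass_closed K d N C' \<and> C = S \<inter> C')"

definition irreducible_in :: "nat \<Rightarrow> nat \<Rightarrow> nat \<Rightarrow> strategy set \<Rightarrow> strategy set \<Rightarrow> bool" where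
  "irreducible_in K d N S C \<longleftrightarrow> closed_in_sub K d N S C \<and> C \<noteq> {} \<and>
     (\<forall>C1 C2. closed_in_sub K d N S C1 \<longrightarrow> closed_in_sub K d N S C2 \<longrightarrow> C = C1 \<union> C2
        \<longrightarrow> C1 = C \<or> C2 = C)"

definition irred_chain :: "nat \<Rightarrow> nat \<Rightarrow> nat \<Rightarrow> strategy set \<Rightarrow> nat \<Rightarrow> bool" where
  "irred_chain K d N S n \<longleftrightarrow> (\<exists>Cs :: nat \<Rightarrow> strategy set.
      (\<forall>k\<le>n. irreducible_in K d N S (Cs k)) \<and> (\<forall>k<n. Cs k \<subset> Cs (Suc k)))"

definition has_dim :: "nat \<Rightarrow> nat \<Rightarrow> nat \<Rightarrow> strategy set \<Rightarrow> nat \<Rightarrow> bool" where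
  "has_dim K d N S D \<longleftrightarrow> irred_chain K d N S D \<and> \<not> irred_chain K d N S (Suc D)"

end

theory Submission
  imports Defs "HOL-Library.Function_Algebras" "HOL-Computational_Algebra.Fundamental_Theorem_Algebra"
    "Jordan_Normal_Form.Determinant"
begin

text \<open>Cover the product of Grassmannians by affine charts on which prescribed rows of the matrices form
  identity matrices. Over a chart each alignment equation contains one entry of \<open>H\<close> with coefficient 1, so
  the incidence variety of pairs \<open>(h, s)\<close> is the graph of a polynomial map on an affine space whose
  dimension exceeds that of \<open>\<H>\<close> by \<open>D = K d (2 N - (K + 1) d)\<close>. Any \<open>D + 1\<close> chart coordinates
  together with the entries of \<open>h\<close> are therefore algebraically dependent, so that on a generic fibre any
  \<open>D + 1\<close> coordinates are dependent (for \<open>D < 0\<close> this says that the fibre is empty), and a chain of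
  irreducible closed sets of length \<open>n\<close> in the fibre would produce \<open>n\<close> independent coordinates.
  Conversely, for \<open>D \<ge> 0\<close> the linearisation of the alignment equations at a well chosen sparse tuple \<open>h\<close>
  is onto, so \<open>D\<close> coordinates and \<open>h\<close> are independent. Hence the generic fibre projects onto a nonempty
  open set of those \<open>D\<close> coordinates, and cutting it by hyperplanes gives a chain of length \<open>D\<close>. Working
  with prime ideals and Zorn's lemma avoids Hilbert's basis theorem.\<close>

section \<open>Algebraic elements modulo a prime ideal\<close>

text \<open>Rings of polynomials are sets of functions inside one function ring, an integral domain
  because the complex field is infinite; hence subrings and primes are predicates on sets. No
  dimension theory is presupposed. Both bounds go back to \<open>eliminate_algebraic\<close>, which
  yields the lifting of points from coordinate subspaces (and so a Nullstellensatz for primes) as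
  well as the bound on the length of chains of primes. The obstacle is that a fibre need be neither
  irreducible nor contained in one chart. For the upper bound a chain is examined in a chart that
  meets its smallest member, and \<open>h\<close> is made generic for all the finitely many pairs of
  a chart and a coordinate set at once; for the lower bound one chart and one prime above the ideal
  of the fibre suffice. The number \<open>D\<close> is \<open>2 K (N - d) d\<close> chart
  coordinates minus \<open>K (K - 1) d^2\<close> equations, and \<open>D \<ge> 0\<close> amounts to
  \<open>(K - 1) d \<le> 2 (N - d)\<close>, exactly the room that the 0/1 design needs. Splitting
  the \<open>K - 1\<close> offsets evenly fails for even \<open>K\<close>, which causes the long
  case there.\<close>

definition is_subring :: "'a::comm_ring_1 set \<Rightarrow> bool" where
  "is_subring S \<longleftrightarrow> 0 \<in> S \<and> 1 \<in> S \<and> (\<forall>a\<in>S. \<forall>b\<in>S. a + b \<in> S \<and> a * b \<in> S) \<and> (\<forall>a\<in>S. - a \<in> S)"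

lemma is_subringD:
  assumes "is_subring S"
  shows "0 \<in> S" "1 \<in> S" "a \<in> S \<Longrightarrow> b \<in> S \<Longrightarrow> a + b \<in> S" "a \<in> S \<Longrightarrow> b \<in> S \<Longrightarrow> a * b \<in> S"
    "a \<in> S \<Longrightarrow> - a \<in> S" "a \<in> S \<Longrightarrow> b \<in> S \<Longrightarrow> a - b \<in> S" "a \<in> S \<Longrightarrow> a ^ n \<in> S"
proof -
  note S = assms[unfolded is_subring_def]
  show "0 \<in> S" "1 \<in> S" using S by blast+
  show add: "a + b \<in> S" if "a \<in> S" "b \<in> S" for a b using S that by blast
  show mult: "a * b \<in> S" if "a \<in> S" "b \<in> S" for a b using S that by blast
  show minus: "- a \<in> S" if "a \<in> S" for a using S that by blast
  show "a \<in> S \<Longrightarrow> b \<in> S \<Longrightarrow> a - b \<in> S" using add[of a "- b"] minus[of b] by simp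
  show "a \<in> S \<Longrightarrow> a ^ n \<in> S" by (induction n) (use S mult in auto)
qed

lemma is_subring_sum: "is_subring S \<Longrightarrow> (\<And>i. i \<in> A \<Longrightarrow> f i \<in> S) \<Longrightarrow> sum f A \<in> S"
  by (induction A rule: infinite_finite_induct) (auto intro: is_subringD)

definition polys_over :: "'a::comm_ring_1 set \<Rightarrow> 'a poly set" where
  "polys_over S = {p. \<forall>n. coeff p n \<in> S}"

lemma polys_over_closed:
  assumes "is_subring S"
  shows "p \<in> polys_over S \<Longrightarrow> q \<in> polys_over S \<Longrightarrow> p + q \<in> polys_over S"
    "p \<in> polys_over S \<Longrightarrow> q \<in> polys_over S \<Longrightarrow> p - q \<in> polys_over S"
    "p \<in> polys_over S \<Longrightarrow> q \<in> polys_over S \<Longrightarrow> p * q \<in> polys_over S"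
    "c \<in> S \<Longrightarrow> p \<in> polys_over S \<Longrightarrow> Polynomial.smult c p \<in> polys_over S"
    "c \<in> S \<Longrightarrow> monom c n \<in> polys_over S"
    "0 \<in> polys_over S"
  using is_subringD[OF assms]
  by (auto simp: polys_over_def coeff_mult intro!: is_subring_sum[OF assms])

definition adjoin :: "'a::comm_ring_1 set \<Rightarrow> 'a \<Rightarrow> 'a set" where
  "adjoin S X = (\<lambda>p. poly p X) ` polys_over S"

definition prime_in :: "'a::comm_ring_1 set \<Rightarrow> 'a set \<Rightarrow> bool" where
  "prime_in R J \<longleftrightarrow> J \<subseteq> R \<and> 0 \<in> J \<and> 1 \<notin> J \<and> (\<forall>a\<in>J. \<forall>b\<in>J. a + b \<in> J) \<and> (\<forall>a\<in>R. \<forall>b\<in>J. a * b \<in> J)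
     \<and> (\<forall>a\<in>R. \<forall>b\<in>R. a * b \<in> J \<longrightarrow> a \<in> J \<or> b \<in> J)"

lemma prime_inD:
  assumes "prime_in R J" "is_subring R"
  shows "a \<in> J \<Longrightarrow> a \<in> R" "0 \<in> J" "1 \<notin> J" "a \<in> J \<Longrightarrow> b \<in> J \<Longrightarrow> a + b \<in> J"
    "a \<in> R \<Longrightarrow> b \<in> J \<Longrightarrow> a * b \<in> J" "a \<in> J \<Longrightarrow> b \<in> R \<Longrightarrow> a * b \<in> J"
    "a \<in> R \<Longrightarrow> b \<in> R \<Longrightarrow> a * b \<in> J \<Longrightarrow> a \<notin> J \<Longrightarrow> b \<in> J"
    "a \<in> J \<Longrightarrow> b \<in> J \<Longrightarrow> a - b \<in> J" "a \<in> R \<Longrightarrow> a \<notin> J \<Longrightarrow> a ^ n \<notin> J"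
proof -
  note J = assms(1)[unfolded prime_in_def]
  show sub: "a \<in> R" if "a \<in> J" for a using J that by blast
  show "0 \<in> J" "1 \<notin> J" using J by blast+
  show add: "a + b \<in> J" if "a \<in> J" "b \<in> J" for a b using J that by blast
  show mult: "a * b \<in> J" if "a \<in> R" "b \<in> J" for a b using J that by blast
  show "a \<in> J \<Longrightarrow> b \<in> R \<Longrightarrow> a * b \<in> J" using mult[of b a] by (simp add: mult.commute)
  show prime: "b \<in> J" if "a \<in> R" "b \<in> R" "a * b \<in> J" "a \<notin> J" for a b using J that by blast
  have "- 1 \<in> R" using is_subringD[OF assms(2)] by blast
  from mult[OF this] have "b \<in> J \<Longrightarrow> - b \<in> J" for b by simp
  then show "a \<in> J \<Longrightarrow> b \<in> J \<Longrightarrow> a - b \<in> J" using add[of a "-b"] by simp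
  show "a ^ n \<notin> J" if "a \<in> R" "a \<notin> J"
  proof (induction n)
    case 0
    then show ?case using J by simp
  next
    case (Suc n)
    then show ?case using prime[OF that(1) is_subringD(7)[OF assms(2) that(1)] _ that(2), of n] by auto
  qed
qed

lemma prime_in_sum: "prime_in R J \<Longrightarrow> is_subring R \<Longrightarrow> (\<And>i. i \<in> A \<Longrightarrow> f i \<in> J) \<Longrightarrow> sum f A \<in> J"
  by (induction A rule: infinite_finite_induct) (auto intro: prime_inD)

text \<open>Algebraicity of the class of \<open>X\<close> over the fraction field of
  \<open>S\<close> modulo \<open>J\<close>; a coefficient outside \<open>J\<close> excludes
  relations that become trivial modulo \<open>J\<close>.\<close>

definition algebraic_mod :: "'a::comm_ring_1 set \<Rightarrow> 'a \<Rightarrow> 'a set \<Rightarrow> bool" where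
  "algebraic_mod S X J \<longleftrightarrow> (\<exists>p\<in>polys_over S. poly p X \<in> J \<and> (\<exists>n. coeff p n \<notin> J))"

text \<open>The leading coefficient of \<open>g\<close> need not be a unit, so every cancellation of
  a top term costs one factor of it. The bound on \<open>degree q\<close> serves
  \<open>eliminate_algebraic\<close>, where the quotient must have smaller degree than the minimal
  relation.\<close>

lemma pseudo_division:
  fixes g :: "'a::comm_ring_1 poly"
  assumes S: "is_subring S" and g: "g \<in> polys_over S" "degree g > 0" and p: "p \<in> polys_over S"
  shows "\<exists>n q r. q \<in> polys_over S \<and> r \<in> polys_over S \<and> Polynomial.smult (lead_coeff g ^ n) p = g * q + r
           \<and> degree r < degree g \<and> degree q \<le> degree p - degree g"
  using p
proof (induction "degree p" arbitrary: p rule: less_induct)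
  case less
  let ?c = "lead_coeff g" let ?e = "degree g"
  note cl = polys_over_closed[OF S]
  have c: "?c \<in> S" "lead_coeff p \<in> S" using g(1) less.prems by (auto simp: polys_over_def)
  show ?case
  proof (cases "degree p < ?e")
    case True
    have "0 \<in> polys_over S \<and> p \<in> polys_over S \<and> Polynomial.smult (?c ^ 0) p = g * 0 + p \<and> degree p < ?e
      \<and> degree (0::'a poly) \<le> degree p - ?e" using True less.prems cl by simp
    then show ?thesis by blast
  next
    case False
    define h where "h = monom (lead_coeff p) (degree p - ?e)"
    define p1 where "p1 = Polynomial.smult ?c p - g * h"
    have h: "h \<in> polys_over S" "degree h \<le> degree p - ?e" unfolding h_def
      using cl(5) c by (auto simp: degree_monom_le)
    have p1: "p1 \<in> polys_over S" unfolding p1_def by (intro cl(2) cl(3) cl(4) c(1) g(1) h(1) less.prems)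
    have "degree (g * h) \<le> degree p" using degree_mult_le[of g h] h(2) False by linarith
    then have "degree p1 \<le> degree p" unfolding p1_def
      by (intro degree_diff_le) (auto intro: order_trans[OF degree_smult_le])
    moreover have "coeff p1 (degree p) = 0"
    proof -
      have "coeff (g * h) (degree p) = coeff (monom (lead_coeff p) (degree p - ?e) * g) (degree p)"
        by (simp add: h_def mult.commute)
      also have "\<dots> = lead_coeff p * ?c" using False by (subst coeff_monom_mult) auto
      finally show ?thesis by (simp add: p1_def mult.commute)
    qed
    ultimately have d: "degree p1 < degree p"
      using eq_zero_or_degree_less[of p1 "degree p"] False g(2) by auto
    from less.hyps[OF d p1] obtain n q r where q: "q \<in> polys_over S" "r \<in> polys_over S"
      "Polynomial.smult (?c ^ n) p1 = g * q + r" "degree r < ?e" "degree q \<le> degree p1 - ?e" by blast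
    have "Polynomial.smult (?c ^ Suc n) p = Polynomial.smult (?c ^ n) (p1 + g * h)" by (simp add: p1_def mult.commute)
    also have "\<dots> = g * (q + Polynomial.smult (?c ^ n) h) + r" using q(3) by (simp add: smult_add_right algebra_simps)
    finally have "Polynomial.smult (?c ^ Suc n) p = g * (q + Polynomial.smult (?c ^ n) h) + r" .
    moreover have "q + Polynomial.smult (?c ^ n) h \<in> polys_over S" by (intro cl(1) cl(4) q h(1) is_subringD(7)[OF S] c)
    moreover have "degree (q + Polynomial.smult (?c ^ n) h) \<le> degree p - ?e"
      using q(5) h(2) d by (intro degree_add_le) (auto intro: order_trans[OF degree_smult_le])
    ultimately show ?thesis using q by blast
  qed
qed

context
  fixes S J :: "'a::comm_ring_1 set" and X :: 'a
  assumes S: "is_subring S" and R: "is_subring (adjoin S X)" and J: "prime_in (adjoin S X) J"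
begin

lemma poly_in_adjoin: "p \<in> polys_over S \<Longrightarrow> poly p X \<in> adjoin S X"
  by (auto simp: adjoin_def)

lemma const_in_adjoin: "c \<in> S \<Longrightarrow> c \<in> adjoin S X"
  using poly_in_adjoin[OF polys_over_closed(5)[OF S, of c 0]] by (simp add: poly_monom)

lemma gen_in_adjoin: "X \<in> adjoin S X"
  using poly_in_adjoin[OF polys_over_closed(5)[OF S, of 1 1]] is_subringD(2)[OF S] by (simp add: poly_monom)

lemma poly_in_ideal:
  assumes "p \<in> polys_over S" "\<And>n. coeff p n \<in> J"
  shows "poly p X \<in> J"
  unfolding poly_altdef
  by (intro prime_in_sum[OF J R] prime_inD(6)[OF J R] assms is_subringD(7)[OF R] gen_in_adjoin)

text \<open>Replaces computing in the quotient by \<open>J\<close>: a representative whose leading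
  coefficient is zero modulo \<open>J\<close> can be shortened without losing the coefficients
  outside \<open>J\<close>.\<close>

lemma drop_lead_coeff:
  assumes p: "p \<in> polys_over S" and l: "lead_coeff p \<in> J"
  obtains p' where "p' \<in> polys_over S" "poly p X - poly p' X \<in> J" "p' = 0 \<or> degree p' < degree p"
    "\<And>n. coeff p n \<notin> J \<Longrightarrow> coeff p' n = coeff p n"
proof
  let ?m = "monom (lead_coeff p) (degree p)"
  show "p - ?m \<in> polys_over S"
    using polys_over_closed[OF S] p by (auto simp: polys_over_def)
  show "poly p X - poly (p - ?m) X \<in> J"
    by (simp add: poly_monom) (intro prime_inD(6)[OF J R] l is_subringD(7)[OF R] gen_in_adjoin)
  show "p - ?m = 0 \<or> degree (p - ?m) < degree p"
    by (rule eq_zero_or_degree_less) (auto intro!: degree_diff_le simp: degree_monom_le)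
  show "\<And>n. coeff p n \<notin> J \<Longrightarrow> coeff (p - ?m) n = coeff p n" using l by auto
qed

text \<open>A nontrivial relation of least degree acts as minimal polynomial of \<open>X\<close>
  modulo \<open>J\<close>. By \<open>drop_lead_coeff\<close> a leading coefficient in
  \<open>J\<close> would contradict minimality, and so would a nontrivial relation of smaller
  degree.\<close>

lemma minimal_relation:
  assumes alg: "algebraic_mod S X J"
  obtains P where "P \<in> polys_over S" "poly P X \<in> J" "degree P > 0" "lead_coeff P \<notin> J"
    "\<And>q n. q \<in> polys_over S \<Longrightarrow> poly q X \<in> J \<Longrightarrow> degree q < degree P \<Longrightarrow> coeff q n \<in> J"
proof -
  let ?Q = "\<lambda>p. p \<in> polys_over S \<and> poly p X \<in> J \<and> (\<exists>n. coeff p n \<notin> J)"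
  from alg obtain p where "?Q p" by (auto simp: algebraic_mod_def)
  then obtain P where P: "?Q P" and min: "\<And>q. ?Q q \<Longrightarrow> degree P \<le> degree q"
    using ex_has_least_nat[of ?Q p degree] by blast
  have lc: "lead_coeff P \<notin> J"
  proof
    assume "lead_coeff P \<in> J"
    with P obtain p' where p': "p' \<in> polys_over S" "poly P X - poly p' X \<in> J" "p' = 0 \<or> degree p' < degree P"
      "\<And>n. coeff P n \<notin> J \<Longrightarrow> coeff p' n = coeff P n" using drop_lead_coeff by blast
    from P obtain n where n: "coeff P n \<notin> J" by blast
    with p'(4) have n': "coeff p' n \<notin> J" by simp
    moreover have "poly p' X \<in> J" using prime_inD(8)[OF J R, of "poly P X" "poly P X - poly p' X"] P p'(2) by simp
    ultimately have "degree P \<le> degree p'" using p' min by blast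
    then show False using p'(3) n' prime_inD(2)[OF J R] by auto
  qed
  moreover have "degree P > 0"
  proof (rule ccontr)
    assume "\<not> degree P > 0"
    then obtain a where "P = [:a:]" using degree_eq_zeroE by blast
    with P lc show False by simp
  qed
  ultimately show thesis using that[of P] P min by (meson not_le)
qed

text \<open>A Euclidean descent: among the multiples of \<open>f\<close> modulo \<open>J\<close> outside \<open>J\<close>, one of least degree in \<open>X\<close>
  is constant, since otherwise dividing the minimal relation of \<open>X\<close> by it would contradict minimality.\<close>
lemma eliminate_algebraic:
  assumes alg: "algebraic_mod S X J" and f: "f \<in> adjoin S X" "f \<notin> J"
  shows "\<exists>b\<in>S. b \<notin> J \<and> (\<exists>u\<in>adjoin S X. b - u * f \<in> J)"
proof -
  note cl = polys_over_closed[OF S]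
  obtain P where P: "P \<in> polys_over S" "poly P X \<in> J" "degree P > 0" "lead_coeff P \<notin> J"
    and min: "\<And>q n. q \<in> polys_over S \<Longrightarrow> poly q X \<in> J \<Longrightarrow> degree q < degree P \<Longrightarrow> coeff q n \<in> J"
    using minimal_relation[OF alg] by blast
  let ?Q = "\<lambda>r. r \<in> polys_over S \<and> poly r X \<notin> J \<and> (\<exists>u\<in>adjoin S X. poly r X - u * f \<in> J)"
  from f(1) obtain p where p: "p \<in> polys_over S" "f = poly p X" by (auto simp: adjoin_def)
  then have "?Q p" using f(2) prime_inD(2)[OF J R] is_subringD(2)[OF R] by (auto intro!: bexI[of _ 1])
  then obtain r where r: "?Q r" and rmin: "\<And>q. ?Q q \<Longrightarrow> degree r \<le> degree q"
    using ex_has_least_nat[of ?Q p degree] by blast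
  then obtain u where u: "u \<in> adjoin S X" "poly r X - u * f \<in> J" by blast
  have lS: "lead_coeff r \<in> S" "lead_coeff P \<in> S" using r P by (auto simp: polys_over_def)
  have lc: "lead_coeff r \<notin> J"
  proof
    assume "lead_coeff r \<in> J"
    with r obtain r' where r': "r' \<in> polys_over S" "poly r X - poly r' X \<in> J" "r' = 0 \<or> degree r' < degree r"
      using drop_lead_coeff by blast
    have "poly r' X \<notin> J" using prime_inD(4)[OF J R r'(2), of "poly r' X"] r by auto
    moreover have "poly r' X - u * f \<in> J" using prime_inD(8)[OF J R u(2) r'(2)] by simp
    ultimately have "degree r \<le> degree r'" using r' u rmin by blast
    with r'(3) \<open>poly r' X \<notin> J\<close> prime_inD(2)[OF J R] show False by auto
  qed
  show ?thesis
  proof (cases "degree r = 0")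
    case True
    then obtain b where "r = [:b:]" using degree_eq_zeroE by blast
    with r lS show ?thesis by auto
  next
    case False
    \<comment> \<open>Reducing \<open>r\<close> by \<open>P\<close> keeps it a multiple of
      \<open>f\<close> outside \<open>J\<close>, since a power of the leading coefficient of
      \<open>P\<close> stays outside the prime \<open>J\<close>. Minimality of \<open>r\<close> then
      forces \<open>degree r < degree P\<close>.\<close>
    obtain n s r' where s: "s \<in> polys_over S" "r' \<in> polys_over S"
      "Polynomial.smult (lead_coeff P ^ n) r = P * s + r'" "degree r' < degree P"
      using pseudo_division[OF S P(1,3), of r] r by blast
    have eq: "poly r' X = lead_coeff P ^ n * poly r X - poly P X * poly s X"
      using arg_cong[OF s(3), of "\<lambda>p. poly p X"] by simp
    have PsJ: "poly P X * poly s X \<in> J" using prime_inD(6)[OF J R] P s poly_in_adjoin by blast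
    have lP: "lead_coeff P ^ n \<in> adjoin S X" using lS const_in_adjoin is_subringD(7)[OF R] by blast
    have "poly r' X \<notin> J"
    proof
      assume "poly r' X \<in> J"
      from prime_inD(4)[OF J R this PsJ] eq have "lead_coeff P ^ n * poly r X \<in> J" by simp
      moreover have "lead_coeff P ^ n \<notin> J" using prime_inD(9)[OF J R const_in_adjoin P(4)] lS by blast
      ultimately show False using prime_inD(7)[OF J R lP] r poly_in_adjoin by blast
    qed
    moreover have "poly r' X - (lead_coeff P ^ n * u) * f \<in> J"
    proof -
      have "poly r' X - (lead_coeff P ^ n * u) * f
        = lead_coeff P ^ n * (poly r X - u * f) - poly P X * poly s X" by (simp add: eq algebra_simps)
      then show ?thesis using prime_inD(8)[OF J R prime_inD(5)[OF J R lP u(2)] PsJ] by simp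
    qed
    ultimately have "degree r \<le> degree r'" using rmin[of r'] s(2) is_subringD(4)[OF R lP u(1)] by blast
    with s(4) have rP: "degree r < degree P" by simp
    \<comment> \<open>Now \<open>P\<close> is divided by \<open>r\<close>. The remainder is a
      multiple of \<open>f\<close> modulo \<open>J\<close> of degree below \<open>r\<close>, so it
      lies in \<open>J\<close>, and all its coefficients do too because its degree is below that of
      \<open>P\<close>.\<close>
    obtain n s r' where s: "s \<in> polys_over S" "r' \<in> polys_over S"
      "Polynomial.smult (lead_coeff r ^ n) P = r * s + r'" "degree r' < degree r" "degree s \<le> degree P - degree r"
      using pseudo_division[OF S _ _ P(1), of r] r False by auto
    have sX: "poly s X \<in> adjoin S X" and rX: "poly r X \<in> adjoin S X" using s r poly_in_adjoin by blast+
    have lr: "lead_coeff r ^ n \<in> adjoin S X" using lS const_in_adjoin is_subringD(7)[OF R] by blast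
    have eq: "poly r' X = lead_coeff r ^ n * poly P X - poly r X * poly s X"
      using arg_cong[OF s(3), of "\<lambda>p. poly p X"] by simp
    have lPJ: "lead_coeff r ^ n * poly P X \<in> J" using prime_inD(5)[OF J R lr P(2)] .
    have "poly r' X - (- poly s X * u) * f = lead_coeff r ^ n * poly P X - poly s X * (poly r X - u * f)"
      by (simp add: eq algebra_simps)
    then have "poly r' X - (- poly s X * u) * f \<in> J"
      using prime_inD(8)[OF J R lPJ prime_inD(5)[OF J R sX u(2)]] by simp
    moreover have "- poly s X * u \<in> adjoin S X" using is_subringD(4)[OF R is_subringD(5)[OF R sX] u(1)] .
    ultimately have r'J: "poly r' X \<in> J" using rmin[of r'] s(2,4) by (meson not_le)
    then have cr': "coeff r' k \<in> J" for k using min[OF s(2)] s(4) rP by simp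
    \<comment> \<open>The quotient \<open>s\<close> is a relation of degree below \<open>P\<close>,
      as \<open>r\<close> is not constant, so its coefficients lie in \<open>J\<close>. Comparing
      coefficients in degree \<open>degree P\<close> then puts a product of elements outside
      \<open>J\<close> into \<open>J\<close>.\<close>
    from prime_inD(8)[OF J R lPJ r'J] eq have "poly r X * poly s X \<in> J" by simp
    then have "poly s X \<in> J" using prime_inD(7)[OF J R rX sX] r by blast
    then have cs: "coeff s k \<in> J" for k using min[OF s(1)] s(5) False rP by simp
    have "coeff (r * s) (degree P) \<in> J" unfolding coeff_mult
      using r by (intro prime_in_sum[OF J R] prime_inD(5)[OF J R] cs const_in_adjoin) (auto simp: polys_over_def)
    from prime_inD(4)[OF J R this cr'] arg_cong[OF s(3), of "\<lambda>p. coeff p (degree P)"]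
    have "lead_coeff r ^ n * lead_coeff P \<in> J" by simp
    then show ?thesis
      using prime_inD(7)[OF J R lr const_in_adjoin[OF lS(2)]] prime_inD(9)[OF J R const_in_adjoin[OF lS(1)] lc] P(4)
      by blast
  qed
qed

end

section \<open>Polynomial functions in finitely many variables\<close>

lemma poly_fun_plus [intro]: "p \<in> poly_fun \<Longrightarrow> q \<in> poly_fun \<Longrightarrow> p + q \<in> poly_fun"
  unfolding plus_fun_def by (rule padd)

lemma poly_fun_times [intro]: "p \<in> poly_fun \<Longrightarrow> q \<in> poly_fun \<Longrightarrow> p * q \<in> poly_fun"
  unfolding times_fun_def by (rule pmult)

lemma poly_fun_uminus: "p \<in> poly_fun \<Longrightarrow> (\<lambda>x. - p x) \<in> poly_fun"
  using pmult[OF pconst[of "-1"]] by fastforce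

lemma poly_fun_diff: "p \<in> poly_fun \<Longrightarrow> q \<in> poly_fun \<Longrightarrow> (\<lambda>x. p x - q x) \<in> poly_fun"
  using padd[OF _ poly_fun_uminus] by fastforce

lemma poly_fun_sum: "(\<And>i. i \<in> A \<Longrightarrow> f i \<in> poly_fun) \<Longrightarrow> (\<lambda>x. \<Sum>i\<in>A. f i x) \<in> poly_fun"
  by (induction A rule: infinite_finite_induct) (auto intro: pconst padd)

lemma poly_fun_prod: "(\<And>i. i \<in> A \<Longrightarrow> f i \<in> poly_fun) \<Longrightarrow> (\<lambda>x. \<Prod>i\<in>A. f i x) \<in> poly_fun"
  by (induction A rule: infinite_finite_induct) (auto intro: pconst pmult)

lemma poly_fun_subst:
  assumes "p \<in> poly_fun" "\<And>i. (\<lambda>x. g x i) \<in> poly_fun"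
  shows "(\<lambda>x. p (g x)) \<in> poly_fun"
  using assms(1) by induction (auto intro: pconst padd pmult assms(2))

lemma poly_fun_curve:
  assumes "p \<in> poly_fun" "\<And>i. \<exists>q. \<forall>s. g s i = poly q s"
  shows "\<exists>q. \<forall>s. p (g s) = poly q s"
  using assms(1)
proof induction
  case (pconst c)
  show ?case by (rule exI[of _ "[:c:]"]) simp
next
  case (padd p q)
  then obtain a b where "\<forall>s. p (g s) = poly a s" "\<forall>s. q (g s) = poly b s" by blast
  then show ?case by (intro exI[of _ "a + b"]) simp
next
  case (pmult p q)
  then obtain a b where "\<forall>s. p (g s) = poly a s" "\<forall>s. q (g s) = poly b s" by blast
  then show ?case by (intro exI[of _ "a * b"]) simp
qed (rule assms(2))

text \<open>On the line through \<open>x\<close> and \<open>y\<close> both functions become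
  one-variable polynomials that are nonzero, at parameter 0 and 1 respectively, and their product
  has only finitely many roots.\<close>

lemma poly_fun_mult_nonzero:
  assumes p: "p \<in> poly_fun" "p x \<noteq> 0" and q: "q \<in> poly_fun" "q y \<noteq> 0"
    and "x \<in> A" "y \<in> A" and line: "\<And>s. (\<lambda>i. x i + s * (y i - x i)) \<in> A"
  shows "\<exists>z\<in>A. p z \<noteq> 0 \<and> q z \<noteq> 0"
proof -
  let ?g = "\<lambda>s i. x i + s * (y i - x i)"
  have g: "\<exists>r. \<forall>s. ?g s i = poly r s" for i
    by (rule exI[of _ "[:x i, y i - x i:]"]) (simp add: algebra_simps)
  obtain a where a: "\<And>s. p (?g s) = poly a s" using poly_fun_curve[of p ?g, OF p(1) g] by blast
  obtain b where b: "\<And>s. q (?g s) = poly b s" using poly_fun_curve[of q ?g, OF q(1) g] by blast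
  have "a \<noteq> 0" using a[of 0] p(2) by auto
  moreover have "b \<noteq> 0" using b[of 1] q(2) by auto
  ultimately have "finite {s. poly (a * b) s = 0}" by (intro poly_roots_finite) simp
  then obtain s where "poly (a * b) s \<noteq> 0"
    using ex_new_if_finite[OF infinite_UNIV_char_0[where 'a=complex]] by blast
  then show ?thesis using a b line[of s] by (intro bexI[of _ "?g s"]) auto
qed

lemma poly_fun_mult_eq_0:
  assumes "p \<in> poly_fun" "q \<in> poly_fun" "p * q = 0"
  shows "p = 0 \<or> q = 0"
proof (rule ccontr)
  assume "\<not> (p = 0 \<or> q = 0)"
  then obtain x y where "p x \<noteq> 0" "q y \<noteq> 0" by (auto simp: fun_eq_iff)
  then obtain z where "p z \<noteq> 0" "q z \<noteq> 0"
    using poly_fun_mult_nonzero[OF assms(1) _ assms(2), of x y UNIV] by blast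
  then show False using assms(3) by (auto simp: fun_eq_iff)
qed

text \<open>The polynomial ring in the variables \<open>V\<close>, kept as functions on the whole
  space so that these rings are nested for growing \<open>V\<close> without embeddings. Dependence
  on \<open>V\<close> is semantic; composing with \<open>restr V\<close> removes the other variables
  from an expression.\<close>

definition poly_in :: "'i set \<Rightarrow> (('i \<Rightarrow> complex) \<Rightarrow> complex) set" where
  "poly_in V = {p \<in> poly_fun. \<forall>x y. (\<forall>i\<in>V. x i = y i) \<longrightarrow> p x = p y}"

definition coord :: "'i \<Rightarrow> ('i \<Rightarrow> complex) \<Rightarrow> complex" where
  "coord i = (\<lambda>x. x i)"

definition restr :: "'i set \<Rightarrow> ('i \<Rightarrow> complex) \<Rightarrow> 'i \<Rightarrow> complex" where
  "restr V x = (\<lambda>i. if i \<in> V then x i else 0)"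

lemma poly_inI: "p \<in> poly_fun \<Longrightarrow> (\<And>x y. (\<And>i. i \<in> V \<Longrightarrow> x i = y i) \<Longrightarrow> p x = p y) \<Longrightarrow> p \<in> poly_in V"
  unfolding poly_in_def by blast

lemma poly_inD: "p \<in> poly_in V \<Longrightarrow> p \<in> poly_fun"
  "p \<in> poly_in V \<Longrightarrow> (\<And>i. i \<in> V \<Longrightarrow> x i = y i) \<Longrightarrow> p x = p y"
  unfolding poly_in_def by blast+

lemma poly_in_mono: "V \<subseteq> W \<Longrightarrow> poly_in V \<subseteq> poly_in W"
  unfolding poly_in_def by blast

lemma poly_in_const: "(\<lambda>x. c) \<in> poly_in V"
  by (rule poly_inI) (auto intro: pconst)

lemma poly_in_coord: "i \<in> V \<Longrightarrow> coord i \<in> poly_in V"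
  unfolding coord_def by (rule poly_inI) (auto intro: pvar)

lemma is_subring_poly_in: "is_subring (poly_in V)"
  unfolding is_subring_def
proof (intro conjI ballI)
  show "0 \<in> poly_in V" "1 \<in> poly_in V" unfolding zero_fun_def one_fun_def by (rule poly_in_const)+
  fix a b :: "('a \<Rightarrow> complex) \<Rightarrow> complex" assume a: "a \<in> poly_in V"
  from a show "- a \<in> poly_in V" unfolding fun_Compl_def
    by (intro poly_inI poly_fun_uminus) (auto dest: poly_inD)
  assume b: "b \<in> poly_in V"
  have eq: "a x = a y" "b x = b y" if "\<And>i. i \<in> V \<Longrightarrow> x i = y i" for x y
    by (rule poly_inD(2)[OF a], rule that, assumption) (rule poly_inD(2)[OF b], rule that, assumption)
  show "a + b \<in> poly_in V"
    by (rule poly_inI[OF poly_fun_plus[OF poly_inD(1)[OF a] poly_inD(1)[OF b]]])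
       (simp only: plus_fun_apply, rule arg_cong2[OF eq(1) eq(2)], assumption+)
  show "a * b \<in> poly_in V"
    by (rule poly_inI[OF poly_fun_times[OF poly_inD(1)[OF a] poly_inD(1)[OF b]]])
       (simp only: times_fun_apply, rule arg_cong2[OF eq(1) eq(2)], assumption+)
qed

lemma restr_subst: "p \<in> poly_fun \<Longrightarrow> (\<lambda>x. p (restr V x)) \<in> poly_in V"
proof (rule poly_inI)
  assume "p \<in> poly_fun"
  then show "(\<lambda>x. p (restr V x)) \<in> poly_fun"
  proof (rule poly_fun_subst)
    fix i show "(\<lambda>x. restr V x i) \<in> poly_fun" unfolding restr_def
      by (cases "i \<in> V") (auto intro: pvar pconst)
  qed
next
  fix x y :: "'a \<Rightarrow> complex" assume "\<And>i. i \<in> V \<Longrightarrow> x i = y i"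
  then have "restr V x = restr V y" by (auto simp: restr_def)
  then show "p (restr V x) = p (restr V y)" by simp
qed

lemma poly_in_restr: "p \<in> poly_in V \<Longrightarrow> p (restr V x) = p x"
  by (rule poly_inD(2)[of p V]) (auto simp: restr_def)

lemma polys_over_apply:
  fixes q :: "(('i \<Rightarrow> complex) \<Rightarrow> complex) poly"
  shows "poly q X x = poly (map_poly (\<lambda>c. c x) q) (X x)"
by (induction q) (auto simp: map_poly_pCons)

lemma adjoin_poly_in: "adjoin (poly_in B) (coord t) = poly_in (insert t B)"
proof (intro equalityI subsetI)
  fix f assume "f \<in> adjoin (poly_in B) (coord t)"
  then obtain p where p: "p \<in> polys_over (poly_in B)" "f = poly p (coord t)" by (auto simp: adjoin_def)
  have "poly p (coord t) \<in> poly_in (insert t B)" unfolding poly_altdef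
    using p(1) poly_in_mono[of B "insert t B"]
    by (intro is_subring_sum[OF is_subring_poly_in] is_subringD(4,7)[OF is_subring_poly_in] poly_in_coord)
       (auto simp: polys_over_def)
  then show "f \<in> poly_in (insert t B)" using p by simp
next
  fix f assume f: "f \<in> poly_in (insert t B)"
  note cl = polys_over_closed[OF is_subring_poly_in[of B]]
  \<comment> \<open>An expression for \<open>f\<close> may contain subterms in foreign variables, so
    the induction runs over all polynomial functions, composed with the map that sets those
    variables to 0.\<close>
  have "\<exists>p\<in>polys_over (poly_in B). \<forall>x. q (restr (insert t B) x) = poly p (coord t) x" if "q \<in> poly_fun" for q
    using that
  proof induction
    case (pconst c)
    show ?case by (rule bexI[OF _ cl(5)[OF poly_in_const[of c], of 0]]) (simp add: poly_monom)
  next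
    case (pvar i)
    show ?case
    proof (cases "i = t")
      case True
      have "(1::('a \<Rightarrow> complex) \<Rightarrow> complex) \<in> poly_in B" using is_subringD(2)[OF is_subring_poly_in] .
      from cl(5)[OF this, of 1] True show ?thesis
        by (intro bexI[of _ "monom 1 1"]) (auto simp: poly_monom coord_def restr_def)
    next
      case False
      have "(\<lambda>x. restr B x i) \<in> poly_in B" using restr_subst[OF poly_fun.pvar] .
      from cl(5)[OF this, of 0] False show ?thesis
        by (intro bexI[of _ "monom (\<lambda>x. restr B x i) 0"]) (auto simp: poly_monom restr_def)
    qed
  next
    case (padd p q)
    then obtain a b where "a \<in> polys_over (poly_in B)" "\<forall>x. p (restr (insert t B) x) = poly a (coord t) x"
      "b \<in> polys_over (poly_in B)" "\<forall>x. q (restr (insert t B) x) = poly b (coord t) x" by blast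
    then show ?case using cl(1) by (intro bexI[of _ "a + b"]) auto
  next
    case (pmult p q)
    then obtain a b where "a \<in> polys_over (poly_in B)" "\<forall>x. p (restr (insert t B) x) = poly a (coord t) x"
      "b \<in> polys_over (poly_in B)" "\<forall>x. q (restr (insert t B) x) = poly b (coord t) x" by blast
    then show ?case using cl(3) by (intro bexI[of _ "a * b"]) auto
  qed
  from this[OF poly_inD(1)[OF f]] obtain p where "p \<in> polys_over (poly_in B)" "f = poly p (coord t)"
    using poly_in_restr[OF f] by (metis ext)
  then show "f \<in> adjoin (poly_in B) (coord t)" by (auto simp: adjoin_def)
qed

section \<open>Prime ideals of polynomial functions: extension of zeros and chains\<close>

lemma prime_in_restrict:
  assumes "prime_in R J" "R' \<subseteq> R" "is_subring R'"
  shows "prime_in R' (J \<inter> R')"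
  using assms unfolding prime_in_def is_subring_def by blast

definition eval_coeffs :: "('a \<Rightarrow> complex) poly \<Rightarrow> 'a \<Rightarrow> complex poly" where
  "eval_coeffs p y = map_poly (\<lambda>a. a y) p"

lemma coeff_eval_coeffs: "coeff (eval_coeffs p y) n = coeff p n y"
  by (simp add: eval_coeffs_def coeff_map_poly)

lemma poly_coord_upd:
  assumes "p \<in> polys_over (poly_in B)" "t \<notin> B"
  shows "poly p (coord t) (y(t := c)) = poly (eval_coeffs p y) c"
proof -
  have "eval_coeffs p (y(t := c)) = eval_coeffs p y"
  proof (rule poly_eqI)
    fix n
    have "coeff p n \<in> poly_in B" using assms(1) by (auto simp: polys_over_def)
    then show "coeff (eval_coeffs p (y(t := c))) n = coeff (eval_coeffs p y) n"
      unfolding coeff_eval_coeffs by (rule poly_inD(2)) (use assms(2) in auto)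
  qed
  then show ?thesis by (simp add: polys_over_apply eval_coeffs_def coord_def)
qed

text \<open>The extension step of elimination theory. If \<open>coord t\<close> is transcendental
  modulo \<open>J\<close>, every element of \<open>J\<close> has all coefficients in
  \<open>J\<close>, so it vanishes identically on the fibre over \<open>y\<close>, and any
  \<open>c\<close> that is not a root of \<open>f\<close> there will do. If it is algebraic,
  \<open>c\<close> is a root of the minimal relation specialised at \<open>y\<close>.\<close>

lemma extend_one_coordinate:
  assumes t: "t \<notin> B" and J: "prime_in (poly_in (insert t B)) J"
    and f: "f \<in> poly_in (insert t B)" "f \<notin> J"
  shows "\<exists>b\<in>poly_in B. b \<notin> J \<and> (\<forall>y. b y \<noteq> 0 \<longrightarrow> (\<forall>p\<in>J \<inter> poly_in B. p y = 0) \<longrightarrow>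
           (\<exists>c. (\<forall>p\<in>J. p (y(t := c)) = 0) \<and> f (y(t := c)) \<noteq> 0))"
proof -
  let ?S = "poly_in B" let ?X = "coord t :: ('a \<Rightarrow> complex) \<Rightarrow> complex"
  note S = is_subring_poly_in[of B]
  note R = is_subring_poly_in[of "insert t B", folded adjoin_poly_in]
  note J' = J[folded adjoin_poly_in]
  note cl = poly_in_adjoin[OF S R J']
  have lift: "\<exists>p\<in>polys_over ?S. q = poly p ?X" if "q \<in> poly_in (insert t B)" for q
    using that unfolding adjoin_poly_in[symmetric] by (auto simp: adjoin_def)
  have JR: "q \<in> poly_in (insert t B)" if "q \<in> J" for q using J that by (auto simp: prime_in_def)
  have co: "coeff p n \<in> ?S" if "p \<in> polys_over ?S" for p n using that by (auto simp: polys_over_def)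
  show ?thesis
  proof (cases "algebraic_mod ?S ?X J")
    case False
    obtain pf where pf: "pf \<in> polys_over ?S" "f = poly pf ?X" using lift f(1) by blast
    then obtain k where k: "coeff pf k \<notin> J" using poly_in_ideal[OF S R J'] f(2) by blast
    show ?thesis
    proof (intro bexI[of _ "coeff pf k"] conjI allI impI)
      fix y assume y: "coeff pf k y \<noteq> 0" "\<forall>p\<in>J \<inter> ?S. p y = 0"
      then have "eval_coeffs pf y \<noteq> 0" using coeff_eval_coeffs[of pf y k] by auto
      then have "finite {c. poly (eval_coeffs pf y) c = 0}" by (rule poly_roots_finite)
      then obtain c where c: "poly (eval_coeffs pf y) c \<noteq> 0"
        using ex_new_if_finite[OF infinite_UNIV_char_0[where 'a=complex]] by blast
      show "\<exists>c. (\<forall>p\<in>J. p (y(t := c)) = 0) \<and> f (y(t := c)) \<noteq> 0"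
      proof (intro exI conjI ballI)
        show "f (y(t := c)) \<noteq> 0" using c poly_coord_upd[OF pf(1) t] pf(2) by simp
        fix p assume p: "p \<in> J"
        with lift JR obtain q where q: "q \<in> polys_over ?S" "p = poly q ?X" by blast
        with False p have "coeff q n \<in> J" for n unfolding algebraic_mod_def by blast
        with y(2) co[OF q(1)] have "eval_coeffs q y = 0" by (intro poly_eqI) (simp add: coeff_eval_coeffs)
        then show "p (y(t := c)) = 0" using q poly_coord_upd[OF q(1) t] by simp
      qed
    qed (use k co pf in auto)
  next
    case True
    obtain P where P: "P \<in> polys_over ?S" "poly P ?X \<in> J" "degree P > 0" "lead_coeff P \<notin> J"
      and min: "\<And>q n. q \<in> polys_over ?S \<Longrightarrow> poly q ?X \<in> J \<Longrightarrow> degree q < degree P \<Longrightarrow> coeff q n \<in> J"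
      using minimal_relation[OF S R J' True] by blast
    obtain b u where b: "b \<in> ?S" "b \<notin> J" "u \<in> adjoin ?S ?X" "b - u * f \<in> J"
      using eliminate_algebraic[OF S R J' True] f adjoin_poly_in[of B t] by metis
    let ?l = "lead_coeff P"
    have l: "?l \<in> ?S" using co P by blast
    have emb: "a \<in> adjoin ?S ?X" if "a \<in> ?S" for a using const_in_adjoin[OF S R J' that] .
    show ?thesis
    \<comment> \<open>The factor \<open>?l\<close> preserves the degree of \<open>P\<close> at
      \<open>y\<close>, so that a root exists and pseudo-division by \<open>P\<close> can be undone
      there. The factor \<open>b\<close> makes \<open>f\<close> nonzero at the lifted point, because
      \<open>b - u * f\<close> vanishes there.\<close>
    proof (intro bexI[of _ "?l * b"] conjI allI impI)
      show "?l * b \<notin> J" using prime_inD(7)[OF J' R emb[OF l] emb[OF b(1)]] P(4) b(2) by blast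
      show "?l * b \<in> ?S" using is_subringD(4)[OF S l b(1)] .
      fix y assume y: "(?l * b) y \<noteq> 0" "\<forall>p\<in>J \<inter> ?S. p y = 0"
      have d: "degree (eval_coeffs P y) = degree P"
      proof (rule antisym)
        show "degree (eval_coeffs P y) \<le> degree P"
          by (rule degree_le) (auto simp: coeff_eval_coeffs coeff_eq_0)
        show "degree P \<le> degree (eval_coeffs P y)"
          by (rule le_degree) (use y(1) in \<open>auto simp: coeff_eval_coeffs\<close>)
      qed
      then have "\<not> constant (poly (eval_coeffs P y))" using P(3) by (simp add: constant_degree)
      then obtain c where c: "poly (eval_coeffs P y) c = 0" using fundamental_theorem_of_algebra by blast
      have Pc: "poly P ?X (y(t := c)) = 0" using c poly_coord_upd[OF P(1) t] by simp
      have van: "q (y(t := c)) = 0" if q: "q \<in> J" for q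
      proof -
        from lift JR q obtain p where p: "p \<in> polys_over ?S" "q = poly p ?X" by blast
        obtain n s r where s: "s \<in> polys_over ?S" "r \<in> polys_over ?S"
          "Polynomial.smult (?l ^ n) p = P * s + r" "degree r < degree P"
          using pseudo_division[OF S P(1,3) p(1)] by blast
        have eq: "poly r ?X = ?l ^ n * q - poly P ?X * poly s ?X"
          using arg_cong[OF s(3), of "\<lambda>p. poly p ?X"] p(2) by simp
        have "poly r ?X \<in> J" unfolding eq
          by (intro prime_inD(8)[OF J' R] prime_inD(5)[OF J' R] prime_inD(6)[OF J' R] q P(2)
              is_subringD(7)[OF R] emb l cl s)
        then have "coeff r k \<in> J" for k using min s by blast
        with y(2) co[OF s(2)] have "eval_coeffs r y = 0" by (intro poly_eqI) (simp add: coeff_eval_coeffs)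
        then have "poly r ?X (y(t := c)) = 0" using poly_coord_upd[OF s(2) t] by simp
        moreover have "?l (y(t := c)) = ?l y" by (rule poly_inD(2)[OF l]) (use t in auto)
        moreover have "(?l ^ n) z = (?l z) ^ n" for z by (induction n) auto
        ultimately have "(?l y) ^ n * q (y(t := c)) = 0"
          using fun_cong[OF eq, of "y(t := c)"] Pc by simp
        then show ?thesis using y(1) by auto
      qed
      have "b (y(t := c)) = b y" by (rule poly_inD(2)[OF b(1)]) (use t in auto)
      then have "f (y(t := c)) \<noteq> 0" using van[OF b(4)] y(1) by auto
      with van show "\<exists>c. (\<forall>p\<in>J. p (y(t := c)) = 0) \<and> f (y(t := c)) \<noteq> 0" by blast
    qed
  qed
qed

lemma extend_coordinates:
  assumes "finite T" "T \<inter> B = {}" "prime_in (poly_in (B \<union> T)) J" "f \<in> poly_in (B \<union> T)" "f \<notin> J"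
  shows "\<exists>b\<in>poly_in B. b \<notin> J \<and> (\<forall>y. b y \<noteq> 0 \<longrightarrow> (\<forall>p\<in>J \<inter> poly_in B. p y = 0) \<longrightarrow>
           (\<exists>z. (\<forall>i\<in>B. z i = y i) \<and> (\<forall>p\<in>J. p z = 0) \<and> f z \<noteq> 0))"
  using assms
proof (induction T arbitrary: J f rule: finite_induct)
  case empty
  then have "J \<subseteq> poly_in B" by (simp add: prime_in_def)
  with empty show ?case by (intro bexI[of _ f]) (auto intro!: exI)
next
  case (insert t T)
  let ?B = "B \<union> T"
  have t: "t \<notin> ?B" using insert by auto
  have J: "prime_in (poly_in (insert t ?B)) J" using insert.prems by simp
  obtain b1 where b1: "b1 \<in> poly_in ?B" "b1 \<notin> J" and e1: "\<And>y. b1 y \<noteq> 0 \<Longrightarrow> (\<forall>p\<in>J \<inter> poly_in ?B. p y = 0) \<Longrightarrow>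
           \<exists>c. (\<forall>p\<in>J. p (y(t := c)) = 0) \<and> f (y(t := c)) \<noteq> 0"
    using extend_one_coordinate[OF t J, of f] insert.prems(3,4) by (simp, blast)
  have "prime_in (poly_in ?B) (J \<inter> poly_in ?B)"
    by (rule prime_in_restrict[OF J poly_in_mono is_subring_poly_in]) auto
  \<comment> \<open>The exceptional polynomial \<open>b1\<close> of the coordinate \<open>t\<close>
    takes over the role of \<open>f\<close> for the remaining coordinates.\<close>
  from insert.IH[OF _ this b1(1)] b1 insert.prems obtain b where b: "b \<in> poly_in B" "b \<notin> J \<inter> poly_in ?B"
    and e2: "\<And>y. b y \<noteq> 0 \<Longrightarrow> (\<forall>p\<in>J \<inter> poly_in ?B \<inter> poly_in B. p y = 0) \<Longrightarrow>
       \<exists>z. (\<forall>i\<in>B. z i = y i) \<and> (\<forall>p\<in>J \<inter> poly_in ?B. p z = 0) \<and> b1 z \<noteq> 0" by auto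
  have "b \<notin> J" using b poly_in_mono[of B ?B] by auto
  moreover have "\<exists>z. (\<forall>i\<in>B. z i = y i) \<and> (\<forall>p\<in>J. p z = 0) \<and> f z \<noteq> 0"
    if y: "b y \<noteq> 0" "\<forall>p\<in>J \<inter> poly_in B. p y = 0" for y
  proof -
    from e2[OF y(1)] y(2) obtain z where z: "\<forall>i\<in>B. z i = y i" "\<forall>p\<in>J \<inter> poly_in ?B. p z = 0" "b1 z \<noteq> 0"
      by blast
    from e1[OF z(3,2)] obtain c where c: "\<forall>p\<in>J. p (z(t := c)) = 0" "f (z(t := c)) \<noteq> 0" by blast
    show ?thesis by (rule exI[of _ "z(t := c)"]) (use z c t in auto)
  qed
  ultimately show ?case using b(1) by blast
qed

lemma extend_point:
  assumes "finite V" "B \<subseteq> V" "prime_in (poly_in V) J" "f \<in> poly_in V" "f \<notin> J"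
  obtains b where "b \<in> poly_in B" "b \<notin> J"
    "\<And>y. b y \<noteq> 0 \<Longrightarrow> (\<forall>p\<in>J \<inter> poly_in B. p y = 0) \<Longrightarrow>
           \<exists>z. (\<forall>i\<in>B. z i = y i) \<and> (\<forall>p\<in>J. p z = 0) \<and> f z \<noteq> 0"
proof -
  have eq: "B \<union> (V - B) = V" using assms by auto
  have "finite (V - B)" "(V - B) \<inter> B = {}" using assms(1) by auto
  from extend_coordinates[OF this, unfolded eq, OF assms(3-5)] that show thesis by blast
qed

lemma poly_in_empty:
  assumes "p \<in> poly_in {}"
  shows "\<exists>c. p = (\<lambda>x. c)"
proof -
  have "p x = p undefined" for x by (rule poly_inD(2)[OF assms]) simp
  then show ?thesis by blast
qed

lemma prime_in_const:
  assumes "prime_in (poly_in V) J" "p \<in> J" "p \<in> poly_in {}"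
  shows "p = 0"
proof (rule ccontr)
  assume n: "p \<noteq> 0"
  from poly_in_empty assms obtain c where c: "p = (\<lambda>x. c)" by blast
  with n have "c \<noteq> 0" by (auto simp: zero_fun_def)
  then have "(\<lambda>x. 1 / c) * p = 1" using c by (auto simp: fun_eq_iff)
  moreover have "(\<lambda>x. 1 / c) * p \<in> J"
    by (rule prime_inD(5)[OF assms(1) is_subring_poly_in poly_in_const assms(2)])
  ultimately show False using prime_inD(3)[OF assms(1) is_subring_poly_in] by simp
qed

text \<open>The case \<open>B = {}\<close> of \<open>extend_point\<close>: there \<open>b\<close> is
  a nonzero constant and the contraction of \<open>J\<close> is zero, so every starting point is
  admissible.\<close>

lemma nullstellensatz_prime:
  assumes "finite V" "prime_in (poly_in V) J" "f \<in> poly_in V" "f \<notin> J"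
  shows "\<exists>z. (\<forall>p\<in>J. p z = 0) \<and> f z \<noteq> 0"
proof -
  obtain b where b: "b \<in> poly_in {}" "b \<notin> J" and e: "\<And>y. b y \<noteq> 0 \<Longrightarrow> (\<forall>p\<in>J \<inter> poly_in {}. p y = 0) \<Longrightarrow>
           \<exists>z. (\<forall>i\<in>{}. z i = y i) \<and> (\<forall>p\<in>J. p z = 0) \<and> f z \<noteq> 0"
    using extend_point[OF assms(1) _ assms(2-4), of "{}"] by auto
  from b prime_inD(2)[OF assms(2) is_subring_poly_in] have "b \<noteq> 0" by auto
  with poly_in_empty[OF b(1)] have "b undefined \<noteq> 0" by (auto simp: fun_eq_iff)
  moreover have "\<forall>p\<in>J \<inter> poly_in {}. p undefined = 0" using prime_in_const[OF assms(2)] by (metis IntE zero_fun_apply)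
  ultimately show ?thesis using e[of undefined] by blast
qed

section \<open>Prime avoidance and chains of prime ideals\<close>

definition ideal_in :: "'a::comm_ring_1 set \<Rightarrow> 'a set \<Rightarrow> bool" where
  "ideal_in R I \<longleftrightarrow> I \<subseteq> R \<and> 0 \<in> I \<and> (\<forall>a\<in>I. \<forall>b\<in>I. a + b \<in> I) \<and> (\<forall>a\<in>R. \<forall>b\<in>I. a * b \<in> I)"

lemma ideal_in_extend:
  assumes R: "is_subring R" and I: "ideal_in R I" and a: "a \<in> R"
  shows "ideal_in R {j + r * a | j r. j \<in> I \<and> r \<in> R}" (is "ideal_in R ?I")
proof -
  note I' = I[unfolded ideal_in_def]
  have sub: "?I \<subseteq> R" using I' a is_subringD(3,4)[OF R] by blast
  have "0 = 0 + 0 * a" by simp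
  then have zero: "0 \<in> ?I" using I' is_subringD(1)[OF R] by blast
  have add: "x + y \<in> ?I" if xy: "x \<in> ?I" "y \<in> ?I" for x y
  proof -
    from xy obtain j r j' r' where *: "x = j + r * a" "y = j' + r' * a" "j \<in> I" "j' \<in> I" "r \<in> R" "r' \<in> R" by blast
    then have "x + y = (j + j') + (r + r') * a" by (simp add: algebra_simps)
    moreover have "j + j' \<in> I" "r + r' \<in> R" using * I' is_subringD(3)[OF R] by blast+
    ultimately show ?thesis by blast
  qed
  have mult: "s * x \<in> ?I" if xy: "s \<in> R" "x \<in> ?I" for s x
  proof -
    from xy obtain j r where *: "x = j + r * a" "j \<in> I" "r \<in> R" by blast
    then have "s * x = s * j + (s * r) * a" by (simp add: algebra_simps)
    moreover have "s * j \<in> I" "s * r \<in> R" using * I' xy is_subringD(4)[OF R] by blast+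
    ultimately show ?thesis by blast
  qed
  show ?thesis unfolding ideal_in_def using sub zero add mult by blast
qed

text \<open>An ideal maximal among those that contain \<open>I\<close> and miss \<open>M\<close> is
  prime: if \<open>a\<close> and \<open>b\<close> lie outside it, each of the two enlarged ideals
  meets \<open>M\<close>, and for \<open>a * b\<close> in the ideal the product of the two meeting
  elements would be in the ideal as well as in \<open>M\<close>.\<close>

lemma prime_avoidance:
  assumes R: "is_subring R" and I: "ideal_in R I"
    and M: "M \<subseteq> R" "1 \<in> M" "\<And>a b. a \<in> M \<Longrightarrow> b \<in> M \<Longrightarrow> a * b \<in> M" and IM: "I \<inter> M = {}"
  obtains J where "I \<subseteq> J" "prime_in R J" "J \<inter> M = {}"
proof -
  define A where "A = {J. ideal_in R J \<and> I \<subseteq> J \<and> J \<inter> M = {}}"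
  have "I \<in> A" using I IM by (auto simp: A_def)
  have "\<exists>J\<in>A. \<forall>X\<in>A. J \<subseteq> X \<longrightarrow> X = J"
  proof (rule subset_Zorn_nonempty)
    show "A \<noteq> {}" using \<open>I \<in> A\<close> by blast
    fix C assume C: "C \<noteq> {}" "subset.chain A C"
    then have CA: "C \<subseteq> A" and tot: "\<And>X Y. X \<in> C \<Longrightarrow> Y \<in> C \<Longrightarrow> X \<subseteq> Y \<or> Y \<subseteq> X"
      by (auto simp: subset.chain_def)
    have id: "ideal_in R X" "I \<subseteq> X" "X \<inter> M = {}" if "X \<in> C" for X using CA that by (auto simp: A_def)
    have "x + y \<in> \<Union>C" if xy: "x \<in> \<Union>C" "y \<in> \<Union>C" for x y
    proof -
      from xy obtain X Y where "x \<in> X" "y \<in> Y" "X \<in> C" "Y \<in> C" by blast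
      then obtain Z where "x \<in> Z" "y \<in> Z" "Z \<in> C" using tot by blast
      with id(1)[of Z] show ?thesis unfolding ideal_in_def by blast
    qed
    moreover have "r * x \<in> \<Union>C" if "r \<in> R" "x \<in> \<Union>C" for r x
      using that id(1) unfolding ideal_in_def by blast
    moreover have "\<Union>C \<subseteq> R" "0 \<in> \<Union>C" using id(1) C(1) unfolding ideal_in_def by blast+
    ultimately show "\<Union>C \<in> A" using id(2,3) C(1) unfolding A_def ideal_in_def by blast
  qed
  then obtain J where JA: "J \<in> A" and maxA: "\<And>X. X \<in> A \<Longrightarrow> J \<subseteq> X \<Longrightarrow> X = J" by meson
  from JA have J: "ideal_in R J" "I \<subseteq> J" "J \<inter> M = {}" by (simp_all add: A_def)
  have max: "X = J" if "ideal_in R X" "I \<subseteq> X" "X \<inter> M = {}" "J \<subseteq> X" for X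
    using maxA[of X] that by (simp add: A_def)
  note J' = J(1)[unfolded ideal_in_def]
  have meet: "\<exists>j\<in>J. \<exists>r\<in>R. j + r * a \<in> M" if a: "a \<in> R" "a \<notin> J" for a
  proof (rule ccontr)
    assume no: "\<not> ?thesis"
    let ?I = "{j + r * a | j r. j \<in> J \<and> r \<in> R}"
    have sub: "J \<subseteq> ?I"
    proof
      fix j assume "j \<in> J"
      moreover have "j = j + 0 * a" by simp
      ultimately show "j \<in> ?I" using is_subringD(1)[OF R] by blast
    qed
    have "?I = J" by (rule max[OF ideal_in_extend[OF R J(1) a(1)] _ _ sub]) (use no sub J in blast)+
    moreover have "a = 0 + 1 * a" by simp
    then have "a \<in> ?I" using J' is_subringD(2)[OF R] by blast
    ultimately show False using a by blast
  qed
  have "prime_in R J" unfolding prime_in_def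
  proof (intro conjI)
    show "\<forall>a\<in>R. \<forall>b\<in>R. a * b \<in> J \<longrightarrow> a \<in> J \<or> b \<in> J"
    proof (intro ballI impI, rule ccontr)
      fix a b assume ab: "a \<in> R" "b \<in> R" "a * b \<in> J" "\<not> (a \<in> J \<or> b \<in> J)"
      obtain j r where 1: "j \<in> J" "r \<in> R" "j + r * a \<in> M" using meet ab by blast
      obtain k s where 2: "k \<in> J" "s \<in> R" "k + s * b \<in> M" using meet ab by blast
      have eq: "(j + r * a) * (k + s * b) = (k + s * b) * j + ((r * a) * k + (r * s) * (a * b))"
        by (simp add: algebra_simps)
      have RR: "k + s * b \<in> R" "r * a \<in> R" "r * s \<in> R"
        using 1 2 ab M(1) is_subringD(4)[OF R] by blast+
      have "(k + s * b) * j \<in> J" "(r * a) * k \<in> J" "(r * s) * (a * b) \<in> J"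
        using J' RR 1(1) 2(1) ab(3) by blast+
      then have "(j + r * a) * (k + s * b) \<in> J" unfolding eq using J' by blast
      with M(3)[OF 1(3) 2(3)] J(3) show False by blast
    qed
  qed (use J' J(3) M(2) in blast)+
  with J that show thesis by blast
qed

text \<open>Hyperplane section: \<open>J + (x\<^sub>t - c)\<close> meets no nonzero polynomial in the coordinates \<open>S\<close> because
  a dense set of points of the hyperplane lifts to zeros of \<open>J\<close>.\<close>
lemma cut_prime:
  assumes V: "finite V" "insert t S \<subseteq> V" and t: "t \<notin> S" and J: "prime_in (poly_in V) J"
    and ind: "J \<inter> poly_in (insert t S) \<subseteq> {0}"
  obtains J' where "prime_in (poly_in V) J'" "J \<subset> J'" "J' \<inter> poly_in S \<subseteq> {0}"
proof -
  note R = is_subring_poly_in[of V]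
  have one: "1 \<in> poly_in V" "1 \<notin> J" using is_subringD(2)[OF R] prime_inD(3)[OF J R] .
  obtain b where b: "b \<in> poly_in (insert t S)" "b \<notin> J"
    and e: "\<And>y. b y \<noteq> 0 \<Longrightarrow> (\<forall>p\<in>J \<inter> poly_in (insert t S). p y = 0) \<Longrightarrow>
           \<exists>z. (\<forall>i\<in>insert t S. z i = y i) \<and> (\<forall>p\<in>J. p z = 0) \<and> 1 z \<noteq> (0::complex)"
    by (rule extend_point[OF V J one]) blast
  from b prime_inD(2)[OF J R] have "b \<noteq> 0" by auto
  then obtain y0 where y0: "b y0 \<noteq> 0" by (auto simp: fun_eq_iff)
  \<comment> \<open>The point \<open>y0\<close> lies on the hyperplane where coordinate
    \<open>t\<close> equals \<open>c\<close>, so \<open>b\<close> does not vanish identically on it,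
    and points of the hyperplane off the zeros of \<open>b\<close> lift to zeros of
    \<open>J\<close>.\<close>
  define c where "c = y0 t"
  define a where "a = coord t - (\<lambda>x. c)"
  have tV: "coord t \<in> poly_in V" using V by (intro poly_in_coord) auto
  have aV: "a \<in> poly_in V" unfolding a_def by (intro is_subringD(6)[OF R] tV poly_in_const)
  have id: "ideal_in (poly_in V) J" using J by (auto simp: prime_in_def ideal_in_def)
  let ?I = "{j + r * a | j r. j \<in> J \<and> r \<in> poly_in V}"
  let ?M = "poly_in S - {0}"
  have IM: "?I \<inter> ?M = {}"
  proof (rule ccontr)
    assume "\<not> ?thesis"
    then obtain j r where j: "j \<in> J" and m: "j + r * a \<in> poly_in S" "j + r * a \<noteq> 0" by blast
    let ?m = "j + r * a"
    have upd: "(\<lambda>x. b (x(t := c))) \<in> poly_fun"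
    proof (rule poly_fun_subst[OF poly_inD(1)[OF b(1)]])
      show "(\<lambda>x. (x(t := c)) i) \<in> poly_fun" for i by (cases "i = t") (auto intro: pvar pconst)
    qed
    from m(2) obtain w0 where w0: "?m w0 \<noteq> 0" by (metis ext zero_fun_apply)
    obtain w where w: "b (w(t := c)) \<noteq> 0" "?m w \<noteq> 0"
      using poly_fun_mult_nonzero[OF upd _ poly_inD(1)[OF m(1)], of y0 w0 UNIV] y0 w0 by (auto simp: c_def)
    obtain z where z: "\<forall>i\<in>insert t S. z i = (w(t := c)) i" "\<forall>p\<in>J. p z = 0"
      using e[OF w(1)] ind by fastforce
    have "?m z = ?m w" using z(1) t by (intro poly_inD(2)[OF m(1)]) auto
    moreover have "?m z = 0" using z j by (simp add: a_def coord_def)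
    ultimately show False using w(2) by simp
  qed
  have mult: "x * y \<in> ?M" if "x \<in> ?M" "y \<in> ?M" for x y
    using that poly_fun_mult_eq_0[of x y] is_subringD(4)[OF is_subring_poly_in[of S], of x y]
    by (auto dest: poly_inD(1))
  have M: "?M \<subseteq> poly_in V" "1 \<in> ?M"
    using is_subringD(2)[OF is_subring_poly_in[of S]] poly_in_mono[of S V] V by auto
  obtain J' where J': "?I \<subseteq> J'" "prime_in (poly_in V) J'" "J' \<inter> ?M = {}"
    by (rule prime_avoidance[OF R ideal_in_extend[OF R id aV] M mult IM])
  have "J \<subseteq> ?I"
  proof
    fix j assume "j \<in> J"
    moreover have "j = j + 0 * a" by simp
    ultimately show "j \<in> ?I" using is_subringD(1)[OF R] by blast
  qed
  have "a = 0 + 1 * a" by simp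
  then have "a \<in> ?I" using is_subringD(2)[OF R] prime_inD(2)[OF J R] by blast
  moreover have "a \<notin> J"
  proof
    assume "a \<in> J"
    moreover have "a \<in> poly_in (insert t S)" unfolding a_def
      by (intro is_subringD(6)[OF is_subring_poly_in] poly_in_coord poly_in_const) simp
    ultimately have "a = 0" using ind by blast
    then have "a (\<lambda>i. c + 1) = 0" by simp
    then show False by (simp add: a_def coord_def)
  qed
  ultimately show thesis using that[of J'] J' \<open>J \<subseteq> ?I\<close> by blast
qed

text \<open>One application of \<open>cut_prime\<close> per element of \<open>S\<close>. The
  numbering is decreasing, with \<open>J\<close> at the last index, so that zero sets increase with
  the index as in \<open>irred_chain\<close>.\<close>

lemma prime_chain_above:
  assumes V: "finite V" and "finite S" "S \<subseteq> V" "prime_in (poly_in V) J" "J \<inter> poly_in S \<subseteq> {0}"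
  shows "\<exists>Js. Js (card S) = J \<and> (\<forall>k\<le>card S. prime_in (poly_in V) (Js k)) \<and> (\<forall>k<card S. Js (Suc k) \<subset> Js k)"
  using assms(2-)
proof (induction S arbitrary: J rule: finite_induct)
  case empty
  then show ?case by (intro exI[of _ "\<lambda>_. J"]) simp
next
  case (insert t S)
  obtain J' where J': "prime_in (poly_in V) J'" "J \<subset> J'" "J' \<inter> poly_in S \<subseteq> {0}"
    using cut_prime[OF V insert.prems(1) insert.hyps(2) insert.prems(2,3)] by blast
  from insert.prems(1) have "S \<subseteq> V" by blast
  from insert.IH[OF this J'(1,3)] obtain Js where Js: "Js (card S) = J'" "\<forall>k\<le>card S. prime_in (poly_in V) (Js k)"
    "\<forall>k<card S. Js (Suc k) \<subset> Js k" by blast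
  have c: "card (insert t S) = Suc (card S)" using insert by simp
  let ?J = "Js(Suc (card S) := J)"
  have "?J (card (insert t S)) = J" using c by simp
  moreover have "\<forall>k\<le>card (insert t S). prime_in (poly_in V) (?J k)"
    using Js insert.prems(2) unfolding c by (auto simp: le_Suc_eq)
  moreover have "\<forall>k<card (insert t S). ?J (Suc k) \<subset> ?J k"
  proof (intro allI impI)
    fix k assume "k < card (insert t S)"
    with c consider "k = card S" | "k < card S" by linarith
    then show "?J (Suc k) \<subset> ?J k" using Js J' by cases auto
  qed
  ultimately show ?case by blast
qed

text \<open>Iterates \<open>eliminate_algebraic\<close>: a multiple \<open>b1\<close> of
  \<open>f\<close> modulo \<open>J\<close> without the variable \<open>t\<close> replaces
  \<open>f\<close>, and \<open>J\<close> is replaced by its contraction, under which the other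
  relations survive because they only involve \<open>B\<close> and one variable of
  \<open>T\<close>.\<close>

lemma eliminate_all:
  assumes "finite T" "T \<inter> B = {}" "prime_in (poly_in (B \<union> T)) J" "f \<in> poly_in (B \<union> T)" "f \<notin> J"
    "\<forall>t\<in>T. algebraic_mod (poly_in B) (coord t) J"
  shows "\<exists>b\<in>poly_in B. b \<notin> J \<and> (\<exists>u\<in>poly_in (B \<union> T). b - u * f \<in> J)"
  using assms
proof (induction T arbitrary: J f rule: finite_induct)
  case empty
  have "1 \<in> poly_in (B \<union> {})" "f - 1 * f \<in> J"
    using is_subringD(2)[OF is_subring_poly_in] prime_inD(2)[OF empty(2) is_subring_poly_in] by auto
  with empty show ?case by (metis Un_empty_right)
next
  case (insert t T)
  let ?B = "B \<union> T" let ?R = "poly_in (insert t ?B)"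
  note R = is_subring_poly_in[of "insert t ?B"]
  have J: "prime_in ?R J" using insert.prems by simp
  note adj = adjoin_poly_in[of ?B t]
  obtain p n where p: "p \<in> polys_over (poly_in B)" "poly p (coord t) \<in> J" "coeff p n \<notin> J"
    using insert.prems(5) unfolding algebraic_mod_def by blast
  have "p \<in> polys_over (poly_in ?B)" using p(1) poly_in_mono[of B ?B] by (auto simp: polys_over_def)
  with p have "algebraic_mod (poly_in ?B) (coord t) J" unfolding algebraic_mod_def by blast
  from eliminate_algebraic[OF is_subring_poly_in _ _ this, unfolded adj, OF R J, of f] insert.prems
  obtain b1 u1 where b1: "b1 \<in> poly_in ?B" "b1 \<notin> J" "u1 \<in> ?R" "b1 - u1 * f \<in> J" by auto
  have sub: "poly_in ?B \<subseteq> ?R" by (rule poly_in_mono) auto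
  have J': "prime_in (poly_in ?B) (J \<inter> poly_in ?B)"
    by (rule prime_in_restrict[OF J sub is_subring_poly_in])
  have alg: "\<forall>s\<in>T. algebraic_mod (poly_in B) (coord s) (J \<inter> poly_in ?B)"
  proof
    fix s assume s: "s \<in> T"
    with insert.prems(5) obtain p n where p: "p \<in> polys_over (poly_in B)" "poly p (coord s) \<in> J" "coeff p n \<notin> J"
      unfolding algebraic_mod_def by blast
    have "poly p (coord s) \<in> poly_in (insert s B)"
      using p(1) unfolding adjoin_poly_in[symmetric] by (auto simp: adjoin_def)
    then have "poly p (coord s) \<in> poly_in ?B" using poly_in_mono[of "insert s B" ?B] s by auto
    with p show "algebraic_mod (poly_in B) (coord s) (J \<inter> poly_in ?B)" unfolding algebraic_mod_def by blast
  qed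
  have "T \<inter> B = {}" "b1 \<notin> J \<inter> poly_in ?B" using insert.prems(1) b1(2) by auto
  from insert.IH[OF this(1) J' b1(1) this(2) alg] obtain b u where
    b: "b \<in> poly_in B" "b \<notin> J \<inter> poly_in ?B" "u \<in> poly_in ?B" "b - u * b1 \<in> J" by blast
  have bJ: "b \<notin> J" using b poly_in_mono[of B ?B] by auto
  have uR: "u \<in> ?R" using b(3) sub by blast
  have eq: "b - (u * u1) * f = (b - u * b1) + u * (b1 - u1 * f)" by (simp add: algebra_simps)
  have "b - (u * u1) * f \<in> J" unfolding eq
    by (rule prime_inD(4)[OF J R b(4) prime_inD(5)[OF J R uR b1(4)]])
  moreover have "u * u1 \<in> ?R" using is_subringD(4)[OF R uR b1(3)] .
  ultimately show ?case using b(1) bJ unfolding Un_insert_right by blast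
qed

text \<open>Each strict step gains an independent coordinate. Otherwise all coordinates are
  algebraic over \<open>S\<close> modulo the smaller prime, and an element of the difference of the
  two primes has a multiple in \<open>poly_in S\<close> outside the smaller prime. That multiple
  lies in the larger prime, which contains no nonzero polynomial in \<open>S\<close>.\<close>

lemma prime_chain_independent:
  assumes T: "finite T" and "\<forall>k\<le>n. prime_in (poly_in T) (Js k)" "\<forall>k<n. Js (Suc k) \<subset> Js k"
  shows "\<exists>S\<subseteq>T. card S = n \<and> Js n \<inter> poly_in S \<subseteq> {0}"
  using assms(2-)
proof (induction n)
  case 0
  then have "Js 0 \<inter> poly_in {} \<subseteq> {0}" using prime_in_const[of T "Js 0"] by blast
  then show ?case by (intro exI[of _ "{}"] conjI empty_subsetI card.empty)
next
  case (Suc n)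
  then have "\<forall>k\<le>n. prime_in (poly_in T) (Js k)" "\<forall>k<n. Js (Suc k) \<subset> Js k" by auto
  from Suc.IH[OF this] obtain S where S: "S \<subseteq> T" "card S = n" "Js n \<inter> poly_in S \<subseteq> {0}" by blast
  let ?J = "Js (Suc n)"
  have J: "prime_in (poly_in T) ?J" and Jn: "prime_in (poly_in T) (Js n)" using Suc.prems by auto
  note R = is_subring_poly_in[of T]
  have sub: "?J \<subset> Js n" using Suc.prems by blast
  have ind: "?J \<inter> poly_in S \<subseteq> {0}" using S sub by blast
  have "\<exists>t\<in>T - S. ?J \<inter> poly_in (insert t S) \<subseteq> {0}"
  proof (rule ccontr)
    assume no: "\<not> ?thesis"
    have alg: "\<forall>t\<in>T - S. algebraic_mod (poly_in S) (coord t) ?J"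
    proof
      fix t assume "t \<in> T - S"
      with no obtain p where p: "p \<in> ?J" "p \<in> poly_in (insert t S)" "p \<noteq> 0" by blast
      then obtain q where q: "q \<in> polys_over (poly_in S)" "p = poly q (coord t)"
        unfolding adjoin_poly_in[symmetric] by (auto simp: adjoin_def)
      with p(3) have "q \<noteq> 0" by auto
      then have "lead_coeff q \<noteq> 0" by simp
      with q(1) ind have "lead_coeff q \<notin> ?J" by (auto simp: polys_over_def)
      with p q show "algebraic_mod (poly_in S) (coord t) ?J" unfolding algebraic_mod_def by blast
    qed
    from sub obtain f where f: "f \<in> Js n" "f \<notin> ?J" by blast
    have fT: "f \<in> poly_in T" using f prime_inD(1)[OF Jn R] by blast
    have ST: "S \<union> (T - S) = T" using S(1) by auto
    have "\<exists>b\<in>poly_in S. b \<notin> ?J \<and> (\<exists>u\<in>poly_in (S \<union> (T - S)). b - u * f \<in> ?J)"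
      by (rule eliminate_all) (use T J fT f alg ST in auto)
    then obtain b u where b: "b \<in> poly_in S" "b \<notin> ?J" "u \<in> poly_in T" "b - u * f \<in> ?J"
      using ST by auto
    have "b - u * f \<in> Js n" using b(4) sub by blast
    from prime_inD(4)[OF Jn R this prime_inD(5)[OF Jn R b(3) f(1)]] have "b \<in> Js n" by simp
    with b(1) S(3) have "b = 0" by blast
    then show False using b(2) prime_inD(2)[OF J R] by simp
  qed
  then obtain t where t: "t \<in> T - S" and "?J \<inter> poly_in (insert t S) \<subseteq> {0}" by blast
  moreover have "card (insert t S) = Suc n" using S t finite_subset[OF S(1) T] by simp
  ultimately show ?case using S(1) by blast
qed

text \<open>Pulling back along a polynomial map lands in an integral domain. This gives primes of
  graphs without naming generators.\<close>

lemma prime_in_vanishing: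
  assumes \<theta>: "\<And>i. (\<lambda>x. \<theta> x i) \<in> poly_fun"
  shows "prime_in (poly_in V) {p \<in> poly_in V. \<forall>x. p (\<theta> x) = 0}" (is "prime_in _ ?J")
  unfolding prime_in_def
proof (intro conjI ballI impI)
  fix a b assume ab: "a \<in> poly_in V" "b \<in> poly_in V" "a * b \<in> ?J"
  then have "(\<lambda>x. a (\<theta> x)) * (\<lambda>x. b (\<theta> x)) = 0" by (auto simp: fun_eq_iff)
  with poly_fun_mult_eq_0[OF poly_fun_subst[OF poly_inD(1)[OF ab(1)] \<theta>] poly_fun_subst[OF poly_inD(1)[OF ab(2)] \<theta>]]
  show "a \<in> ?J \<or> b \<in> ?J" using ab by (auto simp: fun_eq_iff)
qed (use is_subringD[OF is_subring_poly_in[of V]] in auto)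

text \<open>If the \<open>g b\<close> were independent, the graph ideal would lie below a chain of \<open>card B + 1\<close> primes, which
  restricts to a chain of primes in the variables \<open>A\<close>.\<close>
lemma algebraic_dependence:
  fixes A :: "'a set" and B :: "'b set"
  assumes A: "finite A" and B: "finite B" and card: "card A < card B" and g: "\<And>b. b \<in> B \<Longrightarrow> g b \<in> poly_in A"
  shows "\<exists>P\<in>poly_in B. P \<noteq> 0 \<and> (\<forall>x. P (\<lambda>b. g b x) = 0)"
proof (rule ccontr)
  assume no: "\<not> ?thesis"
  let ?A = "Inl ` A :: ('a + 'b) set" let ?B = "Inr ` B :: ('a + 'b) set"
  let ?V = "?A \<union> ?B"
  \<comment> \<open>Parametrises the graph, sending \<open>x\<close> to the pair of \<open>x\<close>
    and the values \<open>g b x\<close>.\<close>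
  define \<theta> :: "('a \<Rightarrow> complex) \<Rightarrow> 'a + 'b \<Rightarrow> complex" where
    "\<theta> = (\<lambda>x. case_sum x (\<lambda>b. if b \<in> B then g b x else 0))"
  have \<theta>_poly: "(\<lambda>x. \<theta> x i) \<in> poly_fun" for i
  proof (cases i)
    case (Inr b)
    then show ?thesis by (cases "b \<in> B") (auto simp: \<theta>_def intro: pconst poly_inD(1)[OF g])
  qed (simp add: \<theta>_def pvar)
  have sub\<theta>: "(\<lambda>x. p (\<theta> x)) \<in> poly_in A" if p: "p \<in> poly_in ?V" for p
  proof (rule poly_inI[OF poly_fun_subst[OF poly_inD(1)[OF p] \<theta>_poly]])
    fix x y :: "'a \<Rightarrow> complex" assume xy: "\<And>i. i \<in> A \<Longrightarrow> x i = y i"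
    show "p (\<theta> x) = p (\<theta> y)"
      by (rule poly_inD(2)[OF p]) (auto simp: \<theta>_def xy intro: poly_inD(2)[OF g xy])
  qed
  have up: "(\<lambda>z. q (\<lambda>a. z (Inl a))) \<in> poly_in ?V" if q: "q \<in> poly_in A" for q
    by (rule poly_inI[OF poly_fun_subst[OF poly_inD(1)[OF q] pvar]]) (auto intro: poly_inD(2)[OF q])
  define J where "J = {p \<in> poly_in ?V. \<forall>x. p (\<theta> x) = 0}"
  note R = is_subring_poly_in[of ?V]
  have J: "prime_in (poly_in ?V) J" unfolding J_def by (rule prime_in_vanishing[OF \<theta>_poly])
  have "J \<inter> poly_in ?B \<subseteq> {0}"
  proof
    fix p assume p: "p \<in> J \<inter> poly_in ?B"
    define P where "P = (\<lambda>y. p (case_sum (\<lambda>_. 0) y))"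
    have pP: "p z = P (\<lambda>b. z (Inr b))" for z unfolding P_def
      by (rule poly_inD(2)[of p ?B]) (use p in auto)
    have "P \<in> poly_in B"
    proof (rule poly_inI)
      show "P \<in> poly_fun" unfolding P_def
      proof (rule poly_fun_subst[of p "case_sum (\<lambda>_. 0)"])
        show "(\<lambda>x. case_sum (\<lambda>_. 0) x i) \<in> poly_fun" for i :: "'a + 'b"
          by (cases i) (auto intro: pvar pconst)
      qed (use p in \<open>auto dest: poly_inD(1)\<close>)
      show "P x = P y" if "\<And>i. i \<in> B \<Longrightarrow> x i = y i" for x y unfolding P_def
        by (rule poly_inD(2)[of p ?B]) (use p that in auto)
    qed
    moreover have "P (\<lambda>b. g b x) = 0" for x
    proof -
      have "P (\<lambda>b. g b x) = P (\<lambda>b. \<theta> x (Inr b))"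
        by (rule poly_inD(2)[OF \<open>P \<in> poly_in B\<close>]) (simp add: \<theta>_def)
      then show ?thesis using p pP[of "\<theta> x"] by (simp add: J_def)
    qed
    ultimately have "P = 0" using no by blast
    then show "p \<in> {0}" using pP by (auto simp: fun_eq_iff)
  qed
  then obtain Js where Js: "Js (card ?B) = J" "\<forall>k\<le>card ?B. prime_in (poly_in ?V) (Js k)"
    "\<forall>k<card ?B. Js (Suc k) \<subset> Js k"
    using prime_chain_above[of ?V ?B J] A B J by auto
  have cB: "card ?B = card B" by (simp add: card_image)
  note Js = Js[unfolded cB]
  define up' :: "(('a \<Rightarrow> complex) \<Rightarrow> complex) \<Rightarrow> ('a + 'b \<Rightarrow> complex) \<Rightarrow> complex"
    where "up' q = (\<lambda>z. q (\<lambda>a. z (Inl a)))" for q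
  define Ks where "Ks k = {q \<in> poly_in A. up' q \<in> Js k}" for k
  have JJs: "J \<subseteq> Js k" if "k \<le> card B" for k
    using that
  proof (induction rule: inc_induct)
    case base
    then show ?case using Js by simp
  next
    case (step n)
    then show ?case using Js(3) by blast
  qed
  have "prime_in (poly_in A) (Ks k)" if k: "k \<le> card B" for k
  proof -
    have pk: "prime_in (poly_in ?V) (Js k)" using Js(2) k by blast
    have hom: "up' (p + q) = up' p + up' q" "up' (p * q) = up' p * up' q" "up' 0 = 0" "up' 1 = 1" for p q
      by (auto simp: up'_def fun_eq_iff)
    note up'' = up[folded up'_def]
    show ?thesis unfolding prime_in_def
    proof (intro conjI ballI impI)
      show "0 \<in> Ks k" "1 \<notin> Ks k"
        using prime_inD(2,3)[OF pk R] is_subringD(1)[OF is_subring_poly_in[of A]] by (auto simp: Ks_def hom)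
      show "a + b \<in> Ks k" if "a \<in> Ks k" "b \<in> Ks k" for a b
        using that prime_inD(4)[OF pk R] is_subringD(3)[OF is_subring_poly_in[of A]] by (auto simp: Ks_def hom)
      show "a * b \<in> Ks k" if "a \<in> poly_in A" "b \<in> Ks k" for a b
        using that prime_inD(5)[OF pk R up''] is_subringD(4)[OF is_subring_poly_in[of A]] by (auto simp: Ks_def hom)
      show "a \<in> Ks k \<or> b \<in> Ks k" if "a \<in> poly_in A" "b \<in> poly_in A" "a * b \<in> Ks k" for a b
        using that prime_inD(7)[OF pk R up'' up''] by (auto simp: Ks_def hom)
    qed (auto simp: Ks_def)
  qed
  moreover have "Ks (Suc k) \<subset> Ks k" if k: "k < card B" for k
  proof -
    have "Js (Suc k) \<subset> Js k" using Js k by blast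
    then obtain q where q: "q \<in> Js k" "q \<notin> Js (Suc k)" by blast
    have pk: "prime_in (poly_in ?V) (Js k)" "prime_in (poly_in ?V) (Js (Suc k))" using Js(2) k by auto
    have qV: "q \<in> poly_in ?V" using prime_inD(1)[OF pk(1) R q(1)] .
    \<comment> \<open>Modulo the graph ideal \<open>J\<close>, contained in all members of the
      chain, \<open>q\<close> equals a polynomial in the variables \<open>A\<close> alone, so strict
      inclusions survive contraction to these variables.\<close>
    define q' where "q' = (\<lambda>x. q (\<theta> x))"
    have q': "q' \<in> poly_in A" unfolding q'_def by (rule sub\<theta>[OF qV])
    have \<theta>_Inl: "(\<lambda>a. \<theta> x (Inl a)) = x" for x by (simp add: \<theta>_def)
    have "q - up' q' \<in> J" unfolding J_def
      using is_subringD(6)[OF R qV up[OF q']] by (simp add: up'_def q'_def \<theta>_Inl)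
    then have d: "q - up' q' \<in> Js k" "q - up' q' \<in> Js (Suc k)" using JJs k by (meson Suc_leI less_imp_le subsetD)+
    have "up' q' \<in> Js k" using prime_inD(8)[OF pk(1) R q(1) d(1)] by simp
    moreover have "up' q' \<notin> Js (Suc k)" using prime_inD(4)[OF pk(2) R d(2)] q(2) by fastforce
    ultimately show ?thesis using \<open>Js (Suc k) \<subset> Js k\<close> q' by (auto simp: Ks_def)
  qed
  ultimately obtain S where "S \<subseteq> A" "card S = card B" using prime_chain_independent[OF A, of "card B" Ks] by blast
  then show False using card card_mono[OF A, of S] by simp
qed

section \<open>Linear systems and initial forms\<close>

lemma underdetermined_system:
  fixes a :: "'i \<Rightarrow> 't \<Rightarrow> 'f::field"
  assumes "finite I" "finite T" "card I < card T"
  shows "\<exists>v. (\<exists>t\<in>T. v t \<noteq> 0) \<and> (\<forall>i\<in>I. (\<Sum>t\<in>T. a i t * v t) = 0)"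
  using assms
proof (induction I arbitrary: T a rule: finite_induct)
  case empty
  then have "T \<noteq> {}" by auto
  then show ?case by (intro exI[of _ "\<lambda>_. 1"]) auto
next
  case (insert i I)
  show ?case
  proof (cases "\<forall>t\<in>T. a i t = 0")
    case True
    have "card I < card T" using insert by simp
    from insert.IH[OF insert.prems(1) this, of a] True show ?thesis by auto
  next
    case False
    then obtain t0 where t0: "t0 \<in> T" "a i t0 \<noteq> 0" by blast
    define a' where "a' j t = a j t - a j t0 * a i t / a i t0" for j t
    have "card I < card (T - {t0})" using insert t0 by simp
    from insert.IH[OF _ this, of a'] insert.prems(1) obtain v t1 where
      v: "t1 \<in> T - {t0}" "v t1 \<noteq> 0" "\<forall>j\<in>I. (\<Sum>t\<in>T - {t0}. a' j t * v t) = 0" by auto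
    define x where "x = - (\<Sum>t\<in>T - {t0}. a i t * v t) / a i t0"
    have split: "(\<Sum>t\<in>T. a j t * (v(t0 := x)) t) = a j t0 * x + (\<Sum>t\<in>T - {t0}. a j t * v t)" for j
      using t0(1) insert.prems(1) by (subst sum.remove[of T t0]) auto
    have "(\<Sum>t\<in>T. a j t * (v(t0 := x)) t) = 0" if "j \<in> insert i I" for j
    proof (cases "j = i")
      case True
      then show ?thesis using t0(2) unfolding split by (simp add: x_def)
    next
      case False
      with that v(3) have "(\<Sum>t\<in>T - {t0}. a' j t * v t) = 0" by auto
      moreover have "(\<Sum>t\<in>T - {t0}. a' j t * v t)
        = (\<Sum>t\<in>T - {t0}. a j t * v t) - a j t0 / a i t0 * (\<Sum>t\<in>T - {t0}. a i t * v t)"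
        by (simp add: a'_def sum_subtractf sum_distrib_left algebra_simps)
      ultimately show ?thesis unfolding split by (simp add: x_def)
    qed
    moreover have "t1 \<in> T" "(v(t0 := x)) t1 \<noteq> 0" using v by auto
    ultimately show ?thesis by blast
  qed
qed

text \<open>Linear independence of the rows \<open>R\<close>, in the form in which it is used:
  arbitrary right-hand sides are attained.\<close>

definition solvable_rows :: "('i \<Rightarrow> 't \<Rightarrow> 'f::field) \<Rightarrow> 't set \<Rightarrow> 'i set \<Rightarrow> bool" where
  "solvable_rows a T R \<longleftrightarrow> (\<forall>z. \<exists>v. \<forall>i\<in>R. (\<Sum>t\<in>T. a i t * v t) = z i)"

text \<open>Steinitz extension. With fewer rows than unknowns some nonzero \<open>v\<close> is
  killed by \<open>R\<close>; injectivity on \<open>I\<close> supplies a row that does not kill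
  \<open>v\<close>, and moving along \<open>v\<close> adjusts the value of this row without
  disturbing the others.\<close>

lemma extend_solvable_rows:
  fixes a :: "'i \<Rightarrow> 't \<Rightarrow> 'f::field"
  assumes T: "finite T" and inj: "\<And>v. (\<forall>i\<in>I. (\<Sum>t\<in>T. a i t * v t) = 0) \<Longrightarrow> \<forall>t\<in>T. v t = 0"
    and R0: "finite R0" "R0 \<subseteq> I" "solvable_rows a T R0" and m: "card R0 \<le> m" "m \<le> card T"
  shows "\<exists>R. R0 \<subseteq> R \<and> R \<subseteq> I \<and> finite R \<and> card R = m \<and> solvable_rows a T R"
  using m
proof (induction m rule: dec_induct)
  case base
  then show ?case using R0 by blast
next
  case (step m)
  then obtain R where R: "R0 \<subseteq> R" "R \<subseteq> I" "finite R" "card R = m" "solvable_rows a T R" by auto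
  obtain v where v: "\<exists>t\<in>T. v t \<noteq> 0" "\<forall>i\<in>R. (\<Sum>t\<in>T. a i t * v t) = 0"
    using underdetermined_system[OF R(3) T, of a] R(4) step by auto
  then obtain i where i: "i \<in> I" "(\<Sum>t\<in>T. a i t * v t) \<noteq> 0" using inj by blast
  then have iR: "i \<notin> R" using v by blast
  have "solvable_rows a T (insert i R)" unfolding solvable_rows_def
  proof
    fix z
    obtain w where w: "\<forall>i\<in>R. (\<Sum>t\<in>T. a i t * w t) = z i" using R(5) by (auto simp: solvable_rows_def)
    define c where "c = (z i - (\<Sum>t\<in>T. a i t * w t)) / (\<Sum>t\<in>T. a i t * v t)"
    have "(\<Sum>t\<in>T. a j t * (w t + c * v t)) = (\<Sum>t\<in>T. a j t * w t) + c * (\<Sum>t\<in>T. a j t * v t)" for j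
      by (simp add: algebra_simps sum.distrib sum_distrib_left)
    then have "\<forall>j\<in>insert i R. (\<Sum>t\<in>T. a j t * (w t + c * v t)) = z j" using w v(2) i(2) by (simp add: c_def)
    then show "\<exists>v. \<forall>j\<in>insert i R. (\<Sum>t\<in>T. a j t * v t) = z j" by (rule exI[of _ "\<lambda>t. w t + c * v t"])
  qed
  then show ?case using R i iR by (intro exI[of _ "insert i R"]) auto
qed

lemma polys_over_curve:
  assumes "q \<in> polys_over poly_fun" "\<And>i. \<exists>r. \<forall>s. g s i = poly r s"
  shows "\<exists>u. \<forall>s. poly q (\<lambda>_. s) (g s) = poly u s"
  using assms(1)
proof (induction q)
  case 0
  then show ?case by (intro exI[of _ 0]) simp
next
  case (pCons a q)
  have "a \<in> poly_fun" "q \<in> polys_over poly_fun"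
    using pCons.prems unfolding polys_over_def by (auto, metis coeff_pCons_0, metis coeff_pCons_Suc)
  with pCons.IH poly_fun_curve[of a g, OF _ assms(2)] obtain b u
    where "\<forall>s. a (g s) = poly b s" "\<forall>s. poly q (\<lambda>_. s) (g s) = poly u s" by metis
  then show ?case by (intro exI[of _ "b + [:0, 1:] * u"]) simp
qed

lemma poly_fun_ring: "is_subring poly_fun"
  using is_subring_poly_in[of UNIV] by (simp add: poly_in_def fun_eq_iff[symmetric])

text \<open>Taylor expansion at \<open>p\<close> in direction \<open>w\<close>. The parameter
  \<open>s\<close> enters as a constant function, so that the coefficients of \<open>q\<close> are
  polynomial functions of \<open>w\<close>.\<close>

lemma expand_at_point:
  assumes "P \<in> poly_fun"
  shows "\<exists>q\<in>polys_over poly_fun. \<forall>s w. P (\<lambda>i. p i + s * w i) = poly q (\<lambda>_. s) w"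
  using assms
proof induction
  case (pconst c)
  show ?case
    by (intro bexI[of _ "monom (\<lambda>_. c) 0"] polys_over_closed(5)[OF poly_fun_ring] poly_fun.pconst)
       (simp add: poly_monom)
next
  case (pvar i)
  note cl = polys_over_closed[OF poly_fun_ring]
  show ?case
    by (intro bexI[of _ "monom (\<lambda>_. p i) 0 + monom (coord i) 1"] cl(1) cl(5) poly_fun.pconst
        poly_inD(1)[OF poly_in_coord[OF UNIV_I]]) (simp add: poly_monom coord_def)
next
  case (padd P Q)
  then obtain a b where "a \<in> polys_over poly_fun" "\<forall>s w. P (\<lambda>i. p i + s * w i) = poly a (\<lambda>_. s) w"
    "b \<in> polys_over poly_fun" "\<forall>s w. Q (\<lambda>i. p i + s * w i) = poly b (\<lambda>_. s) w" by blast
  then show ?case using polys_over_closed(1)[OF poly_fun_ring] by (intro bexI[of _ "a + b"]) auto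
next
  case (pmult P Q)
  then obtain a b where "a \<in> polys_over poly_fun" "\<forall>s w. P (\<lambda>i. p i + s * w i) = poly a (\<lambda>_. s) w"
    "b \<in> polys_over poly_fun" "\<forall>s w. Q (\<lambda>i. p i + s * w i) = poly b (\<lambda>_. s) w" by blast
  then show ?case using polys_over_closed(3)[OF poly_fun_ring] by (intro bexI[of _ "a * b"]) auto
qed

text \<open>The lowest order coefficient of \<open>P\<close> at \<open>p\<close> only sees the directions of the curves.\<close>
lemma zero_on_curves_in_all_directions:
  assumes P: "P \<in> poly_fun"
    and curve: "\<And>v. \<exists>R. \<forall>s. P (\<lambda>i. p i + s * (v i + s * poly (R i) s)) = 0"
  shows "P = 0"
proof (rule ccontr)
  assume "P \<noteq> 0"
  obtain q where q: "q \<in> polys_over poly_fun" and ex: "\<And>s w. P (\<lambda>i. p i + s * w i) = poly q (\<lambda>_. s) w"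
    using expand_at_point[OF P, of p] by blast
  have "q \<noteq> 0"
  proof
    assume "q = 0"
    then have "P x = 0" for x using ex[of 1 "\<lambda>i. x i - p i"] by simp
    with \<open>P \<noteq> 0\<close> show False by (auto simp: fun_eq_iff)
  qed
  then obtain k where "coeff q k \<noteq> 0" using leading_coeff_0_iff by blast
  define r where "r = (LEAST k. coeff q k \<noteq> 0)"
  have r: "coeff q r \<noteq> 0" unfolding r_def by (rule LeastI) fact
  have below: "coeff q k = 0" if "k < r" for k using not_less_Least that unfolding r_def by blast
  define q' where "q' = poly_shift r q"
  have qq': "q = monom 1 r * q'"
    by (rule poly_eqI) (auto simp: coeff_monom_mult q'_def coeff_poly_shift below)
  have q'_over: "q' \<in> polys_over poly_fun"
    using q by (auto simp: polys_over_def q'_def coeff_poly_shift)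
  have "coeff q r v = 0" for v
  proof -
    obtain R where R: "\<And>s. P (\<lambda>i. p i + s * (v i + s * poly (R i) s)) = 0" using curve[of v] by blast
    let ?g = "\<lambda>s i. v i + s * poly (R i) s"
    have "\<exists>r. \<forall>s. ?g s i = poly r s" for i by (rule exI[of _ "[:v i:] + [:0, 1:] * R i"]) simp
    from polys_over_curve[of q' ?g, OF q'_over this] obtain u
      where u: "\<And>s. poly q' (\<lambda>_. s) (?g s) = poly u s" by blast
    have pw: "((\<lambda>_. s) ^ n) x = (s::complex) ^ n" for s n and x :: "'a \<Rightarrow> complex" by (induction n) auto
    \<comment> \<open>Along the curve the order \<open>r\<close> splits off as a power of
      \<open>s\<close>. Cancelling it as a polynomial in \<open>s\<close> and setting
      \<open>s = 0\<close>, where the direction of the curve is \<open>v\<close>, leaves the lowest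
      coefficient at \<open>v\<close>.\<close>
    have "s ^ r * poly u s = 0" for s
      using R[of s] unfolding ex by (simp add: qq' poly_monom pw u)
    then have "poly (monom 1 r * u) s = 0" for s by (simp add: poly_monom)
    then have "monom 1 r * u = 0" using poly_all_0_iff_0[of "monom 1 r * u"] by blast
    then have "u = 0" by (simp add: monom_eq_0_iff)
    then have "poly q' (\<lambda>_. 0) v = 0" using u[of 0] by simp
    moreover have "(\<lambda>_::'a \<Rightarrow> complex. 0::complex) = 0" by (simp add: zero_fun_def)
    ultimately have "coeff q' 0 v = 0" by (simp add: poly_0_coeff_0)
    then show ?thesis by (simp add: q'_def coeff_poly_shift)
  qed
  then show False using r by (auto simp: fun_eq_iff)
qed

text \<open>Surjectivity of the linearised equations \<open>Z\<^sub>i\<^sub>j = Y\<^sub>i C\<^sub>i\<^sub>j + B\<^sub>i\<^sub>j X\<^sub>j\<close>, \<open>j = i + \<delta> mod K\<close>, for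
  0/1-matrices: column \<open>b\<close> of \<open>C\<^sub>i\<^sub>j\<close> is the unit vector \<open>\<gamma> \<delta> b\<close> and row \<open>a\<close> of \<open>B\<^sub>i\<^sub>j\<close> the unit vector
  \<open>\<beta> \<delta> a\<close>, where an index \<open>\<ge> r\<close> stands for the zero vector. For odd \<open>K\<close>, half of the offsets \<open>\<delta>\<close> are served
  by \<open>Y\<close> and half by \<open>X\<close>. For even \<open>K\<close> the offsets 1, 2, 3 are treated jointly: offsets 2 and 3 share
  the columns \<open>d..<d + f\<close> of \<open>Y\<close> and the rows \<open>2 f..<2 f + e\<close> of \<open>X\<close>, and the system is triangular when
  solved for the shared rows \<open>Xs\<close> of \<open>X\<close>, then \<open>Y\<close>, then the rest of \<open>X\<close>.\<close>
lemma alignment_design: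
  assumes K: "K \<ge> 3" and d: "d \<ge> 1" and r: "(K - 1) * d \<le> 2 * r"
  shows "\<exists>\<gamma> \<beta>. \<forall>Z :: nat \<Rightarrow> nat \<Rightarrow> nat \<Rightarrow> nat \<Rightarrow> complex. \<exists>Y X. \<forall>i<K. \<forall>\<delta>. 1 \<le> \<delta> \<longrightarrow> \<delta> < K \<longrightarrow> (\<forall>a<d. \<forall>b<d.
    (if \<gamma> \<delta> b < r then Y i a (\<gamma> \<delta> b) else 0) + (if \<beta> \<delta> a < r then X ((i + \<delta>) mod K) (\<beta> \<delta> a) b else 0)
      = Z i \<delta> a b)"
proof -
  \<comment> \<open>Recovers \<open>i\<close> from \<open>j = i + \<delta>\<close> modulo
    \<open>K\<close>, so that an unknown of \<open>X j\<close> can be defined by the equation of the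
    pair \<open>(i, j)\<close>.\<close>
  define prd where "prd j \<delta> = (j + K - \<delta>) mod K" for j \<delta>
  have prd: "prd ((i + \<delta>) mod K) \<delta> = i" if "i < K" "1 \<le> \<delta>" "\<delta> < K" for i \<delta>
  proof (cases "i + \<delta> < K")
    case True
    then show ?thesis using that by (simp add: prd_def)
  next
    case False
    then have "(i + \<delta>) mod K = i + \<delta> - K" using that by (simp add: mod_if)
    then show ?thesis using that False by (simp add: prd_def)
  qed
  have dm: "(n * d + b) div d = n" "(n * d + b) mod d = b" if "b < d" for n b using that by auto
  have bnd: "n * d + b < m * d" if "n < m" "b < d" for n m b
  proof -
    have "(n + 1) * d \<le> m * d" using that(1) by (intro mult_right_mono) auto
    then show ?thesis using that(2) by (simp add: algebra_simps)
  qed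
  show ?thesis
  proof (cases "odd K")
    case True
    then obtain m where m: "K = 2 * m + 1" by (elim oddE)
    with r have mr: "m * d \<le> r" by simp
    \<comment> \<open>Each offset gets its own block of \<open>d\<close> columns of \<open>Y\<close>
      or \<open>d\<close> rows of \<open>X\<close>, and \<open>r\<close> stands for no unknown. Thus
      every equation has one unknown, shared with no other equation.\<close>
    let ?g = "\<lambda>\<delta> b. if \<delta> \<le> m then (\<delta> - 1) * d + b else r"
    let ?b = "\<lambda>\<delta> a. if \<delta> \<le> m then r else (\<delta> - m - 1) * d + a"
    show ?thesis
    proof (rule exI[of _ ?g], rule exI[of _ ?b], rule allI)
      fix Z :: "nat \<Rightarrow> nat \<Rightarrow> nat \<Rightarrow> nat \<Rightarrow> complex"
      let ?Y = "\<lambda>i a k. Z i (k div d + 1) a (k mod d)"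
      let ?X = "\<lambda>j k b. Z (prd j (k div d + m + 1)) (k div d + m + 1) (k mod d) b"
      show "\<exists>Y X. \<forall>i<K. \<forall>\<delta>. 1 \<le> \<delta> \<longrightarrow> \<delta> < K \<longrightarrow> (\<forall>a<d. \<forall>b<d.
        (if ?g \<delta> b < r then Y i a (?g \<delta> b) else 0) + (if ?b \<delta> a < r then X ((i + \<delta>) mod K) (?b \<delta> a) b else 0)
          = Z i \<delta> a b)"
      proof (rule exI[of _ ?Y], rule exI[of _ ?X], intro allI impI)
        fix i \<delta> a b assume *: "i < K" "1 \<le> \<delta>" "\<delta> < K" "a < d" "b < d"
        show "(if ?g \<delta> b < r then ?Y i a (?g \<delta> b) else 0) + (if ?b \<delta> a < r then ?X ((i + \<delta>) mod K) (?b \<delta> a) b else 0)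
          = Z i \<delta> a b"
        proof (cases "\<delta> \<le> m")
          case True
          have "(\<delta> - 1) * d + b < r" using bnd[of "\<delta> - 1" m b] True * mr by linarith
          moreover have "\<delta> - 1 + 1 = \<delta>" using * by simp
          ultimately show ?thesis using True * by (simp add: dm)
        next
          case False
          have "(\<delta> - m - 1) * d + a < r" using bnd[of "\<delta> - m - 1" m a] False * mr m by linarith
          moreover have "\<delta> - m - 1 + m + 1 = \<delta>" using False by simp
          ultimately show ?thesis using False * prd[of i \<delta>] by (simp add: dm)
        qed
      qed
    qed
  next
    case False
    define m where "m = (K - 4) div 2"
    have m: "K = 2 * m + 4" using False K unfolding m_def by presburger
    define e where "e = d div 2"
    define f where "f = d - e"
    \<comment> \<open>\<open>w\<close> is \<open>3 d / 2\<close> rounded up, the number of columns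
      of \<open>Y\<close> and of rows of \<open>X\<close> used by offsets 1, 2, 3. As
      \<open>r\<close> is an integer, the hypothesis leaves room for \<open>m * d\<close> more on
      each side, enough for the other \<open>2 m\<close> offsets.\<close>
    define w where "w = d + f"
    have ef: "e \<le> f" "f \<le> e + 1" "e + f = d" "2 * f + e = w" "1 \<le> f" using d by (auto simp: e_def f_def w_def)
    have "2 * (m * d) + 3 * d \<le> 2 * r" using r m by (simp add: algebra_simps)
    then have mr: "w + m * d \<le> r" using ef unfolding w_def by linarith
    define g where "g \<delta> b = (if \<delta> = 1 then b else if \<delta> = 2 then (if b < f then d + b else r)
      else if \<delta> = 3 then (if e \<le> b then d + (b - e) else r) else if \<delta> \<le> 3 + m then w + ((\<delta> - 4) * d + b) else r)"
      for \<delta> b :: nat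
    define h where "h \<delta> a = (if \<delta> = 1 then r else if \<delta> = 2 then (if a < e then 2 * f + a else a - e)
      else if \<delta> = 3 then f + a else if \<delta> \<le> 3 + m then r else w + ((\<delta> - m - 4) * d + a))"
      for \<delta> a :: nat
    show ?thesis
    proof (rule exI[of _ g], rule exI[of _ h], rule allI)
      fix Z :: "nat \<Rightarrow> nat \<Rightarrow> nat \<Rightarrow> nat \<Rightarrow> complex"
      \<comment> \<open>Offset 2 has no \<open>Y\<close> term in columns \<open>b \<ge> f\<close>,
        and offset 3 none in columns \<open>b < e\<close>; these equations determine the shared rows
        and do not collide since \<open>e \<le> f\<close>. The entries in between are free.\<close>
      define Xs where "Xs j c b = (if f \<le> b then Z (prd j 2) 2 c b else if b < e then Z (prd j 3) 3 (f + c) b else 0)"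
        for j c b
      \<comment> \<open>Shared column \<open>k\<close> is column \<open>k - d\<close> of offset 2
        and column \<open>k - d + e\<close> of offset 3. Offset 2 meets shared rows of
        \<open>X\<close> only for \<open>a < e\<close>, offset 3 only for \<open>a \<ge> f\<close>;
        for \<open>e \<le> a < f\<close> both equations have private rows of \<open>X\<close>, so 0
        is allowed.\<close>
      define Y where "Y i a k = (if k < d then Z i 1 a k
         else if k < w then (if a < e then Z i 2 a (k - d) - Xs ((i + 2) mod K) a (k - d)
                             else if f \<le> a then Z i 3 a (k - d + e) - Xs ((i + 3) mod K) (a - f) (k - d + e) else 0)
         else Z i ((k - w) div d + 4) a ((k - w) mod d))" for i a k
      \<comment> \<open>The rows below \<open>2 * f\<close> are private to offset 2 or 3 and absorb
        whatever the already fixed \<open>Y\<close> leaves over.\<close>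
      define X where "X j k b = (if k < f then Z (prd j 2) 2 (k + e) b - (if b < f then Y (prd j 2) (k + e) (d + b) else 0)
         else if k < 2 * f then Z (prd j 3) 3 (k - f) b - (if e \<le> b then Y (prd j 3) (k - f) (d + (b - e)) else 0)
         else if k < w then Xs j (k - 2 * f) b
         else Z (prd j ((k - w) div d + m + 4)) ((k - w) div d + m + 4) ((k - w) mod d) b)" for j k b
      show "\<exists>Y X. \<forall>i<K. \<forall>\<delta>. 1 \<le> \<delta> \<longrightarrow> \<delta> < K \<longrightarrow> (\<forall>a<d. \<forall>b<d.
        (if g \<delta> b < r then Y i a (g \<delta> b) else 0) + (if h \<delta> a < r then X ((i + \<delta>) mod K) (h \<delta> a) b else 0)
          = Z i \<delta> a b)"
      proof (rule exI[of _ Y], rule exI[of _ X], intro allI impI)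
        fix i \<delta> a b assume *: "i < K" "1 \<le> \<delta>" "\<delta> < K" "a < d" "b < d"
        let ?j = "(i + \<delta>) mod K"
        note p = prd[OF *(1-3)]
        consider "\<delta> = 1" | "\<delta> = 2" | "\<delta> = 3" | "4 \<le> \<delta>" "\<delta> \<le> 3 + m" | "3 + m < \<delta>" "4 \<le> \<delta>"
          using * by linarith
        then show "(if g \<delta> b < r then Y i a (g \<delta> b) else 0) + (if h \<delta> a < r then X ?j (h \<delta> a) b else 0) = Z i \<delta> a b"
        proof cases
          case 1
          then show ?thesis using * mr w_def by (simp add: g_def h_def Y_def)
        next
          case 2
          note p = p[unfolded 2]
          have sm: "d + b < r" if "b < f" using that mr w_def by linarith
          have hr: "h \<delta> a < r" using * ef mr 2 by (auto simp: h_def)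
          show ?thesis
          proof (cases "a < e")
            case True
            then have X: "X ?j (h \<delta> a) b = Xs ?j a b" using ef 2 by (simp add: h_def X_def)
            show ?thesis
            proof (cases "b < f")
              case True
              with \<open>a < e\<close> have "g \<delta> b = d + b" "Y i a (d + b) = Z i 2 a b - Xs ((i + 2) mod K) a b"
                using 2 w_def by (simp_all add: g_def Y_def)
              then show ?thesis using sm[OF True] hr X 2 by simp
            next
              case False
              then have "g \<delta> b = r" "Xs ?j a b = Z i 2 a b" using 2 p by (simp_all add: g_def Xs_def)
              then show ?thesis using hr X 2 by simp
            qed
          next
            case False
            then have ha: "h \<delta> a = a - e" "a - e < f" "a - e + e = a" using * ef 2 by (auto simp: h_def)
            then have "X ?j (h \<delta> a) b = Z i 2 a b - (if b < f then Y i a (d + b) else 0)"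
              using 2 p by (simp add: X_def)
            moreover have "g \<delta> b = (if b < f then d + b else r)" using 2 by (simp add: g_def)
            ultimately show ?thesis using hr sm 2 by simp
          qed
        next
          case 3
          note p = p[unfolded 3]
          have sm: "d + (b - e) < r" using * ef mr w_def by linarith
          have ha: "h \<delta> a = f + a" using 3 by (simp add: h_def)
          have hr: "h \<delta> a < r" using * ef mr w_def unfolding ha by linarith
          show ?thesis
          proof (cases "a < f")
            case True
            then have "X ?j (f + a) b = Z i 3 a b - (if e \<le> b then Y i a (d + (b - e)) else 0)"
              using 3 p by (simp add: X_def)
            moreover have "g \<delta> b = (if e \<le> b then d + (b - e) else r)" using 3 by (simp add: g_def)
            ultimately show ?thesis using hr sm 3 ha by (cases "e \<le> b") simp_all
          next
            case False
            have "f + a < w" using * w_def by linarith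
            then have X: "X ?j (h \<delta> a) b = Xs ?j (a - f) b" using False ef unfolding ha by (simp add: X_def)
            show ?thesis
            proof (cases "e \<le> b")
              case True
              then obtain c where c: "b = e + c" by (auto simp: le_iff_add)
              have "\<not> a < e" "d + c < w" using False ef * w_def c by linarith+
              with False have "Y i a (d + c) = Z i 3 a b - Xs ((i + 3) mod K) (a - f) b"
                by (simp add: Y_def c add.commute)
              moreover have "g \<delta> b = d + c" "d + c < r" using 3 sm by (simp_all add: g_def c)
              ultimately show ?thesis using hr X 3 by simp
            next
              case nb: False
              then have "g \<delta> b = r" "Xs ?j (a - f) b = Z i 3 a b" using 3 p ef False by (simp_all add: g_def Xs_def)
              then show ?thesis using hr X 3 by simp
            qed
          qed
        next
          case 4
          have "(\<delta> - 4) * d + b < m * d" by (rule bnd) (use 4 * in auto)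
          then have "w + ((\<delta> - 4) * d + b) < r" using mr by linarith
          moreover have "\<delta> - 4 + 4 = \<delta>" using 4 by simp
          ultimately show ?thesis using 4 * w_def by (simp add: g_def h_def Y_def dm)
        next
          case 5
          have "(\<delta> - m - 4) * d + a < m * d" by (rule bnd) (use 5 * m in auto)
          then have "w + ((\<delta> - m - 4) * d + a) < r" using mr by linarith
          moreover have "\<delta> - m - 4 + m + 4 = \<delta>" using 5 by simp
          moreover have "\<not> w + x < f" "\<not> w + x < 2 * f" for x using ef by auto
          ultimately show ?thesis using 5 * p by (simp add: g_def h_def X_def dm)
        qed
      qed
    qed
  qed
qed

section \<open>Charts of the product of Grassmannians\<close>

type_synonym strat_index = "bool \<times> nat \<times> nat \<times> nat"
type_synonym chan_index = "nat \<times> nat \<times> nat \<times> nat"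

section \<open>Adjugates, column spaces and pivot rows\<close>

lemma poly_fun_det:
  assumes "\<And>a b. F a b \<in> poly_fun"
  shows "(\<lambda>x. det (mat n n (\<lambda>(a, b). F a b x))) \<in> poly_fun"
proof -
  have "det (mat n n (\<lambda>(a, b). F a b x)) =
    (\<Sum>p | p permutes {0..<n}. signof p * (\<Prod>i = 0..<n. F i (p i) x))" for x
    by (auto simp: det_def intro!: sum.cong prod.cong)
  then show ?thesis by (simp only:) (intro poly_fun_sum pmult pconst poly_fun_prod assms)
qed

text \<open>Inverts a matrix of polynomials up to one denominator: \<open>D\<close> is the
  determinant and \<open>G\<close> the adjugate. The last clause detects
  \<open>D x \<noteq> 0\<close> from any right inverse at \<open>x\<close>.\<close>

lemma polynomial_adjugate:
  fixes n :: nat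
  assumes F: "\<And>a b. F a b \<in> poly_fun"
  obtains D G where "D \<in> poly_fun" "\<And>a b. G a b \<in> poly_fun"
    "\<And>x a b. a < n \<Longrightarrow> b < n \<Longrightarrow> (\<Sum>m<n. F a m x * G m b x) = (if a = b then D x else 0)"
    "\<And>x a b. a < n \<Longrightarrow> b < n \<Longrightarrow> (\<Sum>m<n. G a m x * F m b x) = (if a = b then D x else 0)"
    "\<And>x C. (\<And>a b. a < n \<Longrightarrow> b < n \<Longrightarrow> (\<Sum>m<n. F a m x * C m b) = (if a = b then 1 else 0)) \<Longrightarrow> D x \<noteq> 0"
proof -
  define A where "A x = mat n n (\<lambda>(a, b). F a b x)" for x
  have A: "A x \<in> carrier_mat n n" for x by (simp add: A_def)
  have A_index: "A x $$ (a, b) = F a b x" if "a < n" "b < n" for a b x using that by (simp add: A_def)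
  define D where "D x = det (A x)" for x
  \<comment> \<open>The adjugate is the transposed cofactor matrix, so entry \<open>(a, b)\<close>
    deletes row \<open>b\<close> and column \<open>a\<close>; the conditionals skip the deleted
    indices.\<close>
  define G where "G a b x = (- 1) ^ (b + a) * det (mat (n - 1) (n - 1)
    (\<lambda>(i, j). F (if i < b then i else Suc i) (if j < a then j else Suc j) x))" for a b x
  have "D \<in> poly_fun" unfolding D_def A_def by (rule poly_fun_det[OF F])
  moreover have "G a b \<in> poly_fun" for a b unfolding G_def by (intro pmult pconst poly_fun_det F)
  moreover have G: "adj_mat (A x) $$ (a, b) = G a b x" if "a < n" "b < n" for a b x
  proof -
    have "mat_delete (A x) b a = mat (n - 1) (n - 1)
      (\<lambda>(i, j). F (if i < b then i else Suc i) (if j < a then j else Suc j) x)"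
      unfolding mat_delete_def by (rule eq_matI) (auto simp: A_def)
    then show ?thesis using that A[of x] by (simp add: adj_mat_def cofactor_def G_def)
  qed
  moreover have "(\<Sum>m<n. F a m x * G m b x) = (if a = b then D x else 0)"
    and "(\<Sum>m<n. G a m x * F m b x) = (if a = b then D x else 0)" if ab: "a < n" "b < n" for x a b
  proof -
    note adj = adj_mat[OF A[of x]]
    have "(A x * adj_mat (A x)) $$ (a, b) = (\<Sum>m<n. F a m x * G m b x)"
      using ab A[of x] adj(1)
      by (auto simp: scalar_prod_def G A_index lessThan_atLeast0 intro!: sum.cong)
    then show "(\<Sum>m<n. F a m x * G m b x) = (if a = b then D x else 0)" using adj(2) ab by (cases "a = b") (auto simp: D_def)
    have "(adj_mat (A x) * A x) $$ (a, b) = (\<Sum>m<n. G a m x * F m b x)"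
      using ab A[of x] adj(1)
      by (auto simp: scalar_prod_def G A_index lessThan_atLeast0 intro!: sum.cong)
    then show "(\<Sum>m<n. G a m x * F m b x) = (if a = b then D x else 0)" using adj(3) ab by (cases "a = b") (auto simp: D_def)
  qed
  moreover have "D x \<noteq> 0"
    if C: "\<And>a b. a < n \<Longrightarrow> b < n \<Longrightarrow> (\<Sum>m<n. F a m x * C m b) = (if a = b then 1 else 0)" for x C
  proof -
    have "A x * mat n n (\<lambda>(a, b). C a b) = 1\<^sub>m n"
      by (rule eq_matI) (auto simp: A_def scalar_prod_def C lessThan_atLeast0[symmetric])
    then have "det (A x) * det (mat n n (\<lambda>(a, b). C a b)) = 1"
      using det_mult[OF A, of "mat n n (\<lambda>(a, b). C a b)" x] by simp
    then show ?thesis by (auto simp: D_def)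
  qed
  ultimately show thesis using that[of D G] by blast
qed

lemma colspace_subset:
  assumes "\<And>k l. k < N \<Longrightarrow> l < d \<Longrightarrow> A k l = (\<Sum>m<d. B k m * G m l)"
  shows "colspace N d A \<subseteq> colspace N d B"
proof
  fix v assume "v \<in> colspace N d A"
  then obtain c where v: "v = (\<lambda>k. if k < N then (\<Sum>l<d. A k l * c l) else 0)" by (auto simp: colspace_def)
  have "(\<Sum>l<d. A k l * c l) = (\<Sum>m<d. B k m * (\<Sum>l<d. G m l * c l))" if "k < N" for k
  proof -
    have "(\<Sum>l<d. A k l * c l) = (\<Sum>l<d. \<Sum>m<d. B k m * (G m l * c l))"
      by (rule sum.cong[OF refl]) (simp add: assms[OF that] sum_distrib_right mult.assoc)
    also have "\<dots> = (\<Sum>m<d. \<Sum>l<d. B k m * (G m l * c l))" by (rule sum.swap)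
    finally show ?thesis by (simp add: sum_distrib_left)
  qed
  then have "v = (\<lambda>k. if k < N then (\<Sum>m<d. B k m * (\<Sum>l<d. G m l * c l)) else 0)" using v by auto
  then show "v \<in> colspace N d B" unfolding colspace_def
    by (intro CollectI exI[of _ "\<lambda>m. \<Sum>l<d. G m l * c l"])
qed

lemma colspace_column:
  assumes "l < d"
  shows "(\<lambda>k. if k < N then A k l else 0) \<in> colspace N d A"
  unfolding colspace_def using assms
  by (auto intro!: exI[of _ "\<lambda>m. if m = l then 1 else 0"] simp: if_distrib cong: if_cong)

lemma colspace_subset_imp:
  assumes "colspace N d A \<subseteq> colspace N d B"
  obtains G where "\<And>k l. k < N \<Longrightarrow> l < d \<Longrightarrow> A k l = (\<Sum>m<d. B k m * G m l)"
proof -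
  have "\<exists>c. \<forall>k<N. A k l = (\<Sum>m<d. B k m * c m)" if "l < d" for l
  proof -
    have "(\<lambda>k. if k < N then A k l else 0) \<in> colspace N d B" using colspace_column[OF that] assms by blast
    then obtain c where "(\<lambda>k. if k < N then A k l else 0) = (\<lambda>k. if k < N then (\<Sum>m<d. B k m * c m) else 0)"
      by (auto simp: colspace_def)
    then have "\<forall>k<N. A k l = (\<Sum>m<d. B k m * c m)" by (auto simp: fun_eq_iff split: if_splits)
    then show ?thesis by blast
  qed
  then obtain c where "\<And>l. l < d \<Longrightarrow> \<forall>k<N. A k l = (\<Sum>m<d. B k m * c l m)" by metis
  then show thesis using that[of "\<lambda>m l. c l m"] by blast
qed

text \<open>Full rank is injectivity on coefficient vectors, so \<open>extend_solvable_rows\<close>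
  grows the empty set of rows to \<open>d\<close> independent ones. Solving for the unit right-hand
  sides gives the inverse \<open>C\<close> of the pivot block.\<close>

lemma full_rank_pivots:
  assumes "full_rank N d A"
  obtains \<tau> C where "inj_on \<tau> {..<d}" "\<And>l. l < d \<Longrightarrow> \<tau> l < N"
    "\<And>a b. a < d \<Longrightarrow> b < d \<Longrightarrow> (\<Sum>m<d. A (\<tau> a) m * C m b) = (if a = b then 1 else 0)"
proof -
  have "\<exists>R. {} \<subseteq> R \<and> R \<subseteq> {..<N} \<and> finite R \<and> card R = d \<and> solvable_rows A {..<d} R"
  proof (rule extend_solvable_rows)
    show "\<forall>t\<in>{..<d}. v t = 0" if "\<forall>i\<in>{..<N}. (\<Sum>t\<in>{..<d}. A i t * v t) = 0" for v
      using assms that by (auto simp: full_rank_def)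
  qed (auto simp: solvable_rows_def)
  then obtain R where R: "R \<subseteq> {..<N}" "finite R" "card R = d" "solvable_rows A {..<d} R" by blast
  obtain \<tau> where \<tau>: "bij_betw \<tau> {..<d} R"
    using ex_bij_betw_nat_finite[OF R(2)] R(3) by (auto simp: lessThan_atLeast0)
  have inR: "\<tau> l \<in> R" if "l < d" for l using \<tau> that by (auto simp: bij_betw_def)
  have "\<forall>b. \<exists>v. \<forall>i\<in>R. (\<Sum>t<d. A i t * v t) = (if i = \<tau> b then 1 else 0)"
  proof
    fix b
    show "\<exists>v. \<forall>i\<in>R. (\<Sum>t<d. A i t * v t) = (if i = \<tau> b then 1 else 0)"
      using R(4)[unfolded solvable_rows_def, rule_format, of "\<lambda>i. if i = \<tau> b then 1 else 0"] .
  qed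
  then obtain C where C: "\<And>b i. i \<in> R \<Longrightarrow> (\<Sum>t<d. A i t * C b t) = (if i = \<tau> b then 1 else 0)" by metis
  show thesis
  proof (rule that[of \<tau> "\<lambda>m b. C b m"])
    show inj: "inj_on \<tau> {..<d}" using \<tau> by (simp add: bij_betw_def)
    show "\<tau> l < N" if "l < d" for l using inR[OF that] R(1) by auto
    show "(\<Sum>m<d. A (\<tau> a) m * C b m) = (if a = b then 1 else 0)" if "a < d" "b < d" for a b
      using C[OF inR[OF that(1)], of b] inj that by (auto simp: inj_on_eq_iff)
  qed
qed

text \<open>\<open>\<sigma> (s, i, l)\<close> is the row in which the matrix \<open>(s, i)\<close>
  carries the \<open>l\<close>-th unit vector. Extensionality makes the set of charts finite, which
  the simultaneous choice of a generic \<open>h\<close> requires.\<close>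

definition is_chart :: "nat \<Rightarrow> nat \<Rightarrow> nat \<Rightarrow> (bool \<times> nat \<times> nat \<Rightarrow> nat) \<Rightarrow> bool" where
  "is_chart K N d \<sigma> \<longleftrightarrow> \<sigma> \<in> (UNIV \<times> {..<K} \<times> {..<d}) \<rightarrow>\<^sub>E {..<N} \<and> (\<forall>s. \<forall>i<K. inj_on (\<lambda>l. \<sigma> (s, i, l)) {..<d})"

definition chart_free :: "nat \<Rightarrow> nat \<Rightarrow> nat \<Rightarrow> (bool \<times> nat \<times> nat \<Rightarrow> nat) \<Rightarrow> strat_index set" where
  "chart_free K N d \<sigma> = {(s, i, k, l). i < K \<and> k < N \<and> l < d \<and> (\<forall>l'<d. \<sigma> (s, i, l') \<noteq> k)}"

definition chart_point :: "nat \<Rightarrow> nat \<Rightarrow> nat \<Rightarrow> (bool \<times> nat \<times> nat \<Rightarrow> nat) \<Rightarrow>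
    (strat_index \<Rightarrow> complex) \<Rightarrow> strat_index \<Rightarrow> complex" where
  "chart_point K N d \<sigma> w = (\<lambda>(s, i, k, l). if (s, i, k, l) \<in> chart_free K N d \<sigma> then w (s, i, k, l)
     else if i < K \<and> k < N \<and> l < d \<and> \<sigma> (s, i, l) = k then 1 else 0)"

abbreviation chart_strat :: "nat \<Rightarrow> nat \<Rightarrow> nat \<Rightarrow> (bool \<times> nat \<times> nat \<Rightarrow> nat) \<Rightarrow>
    (strat_index \<Rightarrow> complex) \<Rightarrow> strategy" where
  "chart_strat K N d \<sigma> w \<equiv> strat_of K d N (chart_point K N d \<sigma> w)"

lemma finite_charts: "finite {\<sigma>. is_chart K N d \<sigma>}"
  by (rule finite_subset[of _ "(UNIV \<times> {..<K} \<times> {..<d}) \<rightarrow>\<^sub>E {..<N}"])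
     (auto simp: is_chart_def intro: finite_PiE)

lemma finite_chart_free: "finite (chart_free K N d \<sigma>)"
  by (rule finite_subset[of _ "UNIV \<times> {..<K} \<times> {..<N} \<times> {..<d}"]) (auto simp: chart_free_def)

lemma poly_fun_chart_point: "(\<lambda>w. chart_point K N d \<sigma> w j) \<in> poly_fun"
proof (cases "j \<in> chart_free K N d \<sigma>")
  case True
  then have "(\<lambda>w. chart_point K N d \<sigma> w j) = (\<lambda>w. w j)" by (cases j) (simp add: chart_point_def)
  then show ?thesis by (simp add: pvar)
next
  case False
  then obtain c where "(\<lambda>w. chart_point K N d \<sigma> w j) = (\<lambda>_. c)" by (cases j) (auto simp: chart_point_def)
  then show ?thesis by (simp add: pconst)
qed

lemma chart_point_cong:
  "(\<And>j. j \<in> chart_free K N d \<sigma> \<Longrightarrow> w j = w' j) \<Longrightarrow> chart_point K N d \<sigma> w = chart_point K N d \<sigma> w'"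
  by (auto simp: chart_point_def fun_eq_iff)

lemma poly_in_chart_point: "p \<in> poly_fun \<Longrightarrow> (\<lambda>w. p (chart_point K N d \<sigma> w)) \<in> poly_in (chart_free K N d \<sigma>)"
  by (rule poly_inI[OF poly_fun_subst[OF _ poly_fun_chart_point]]) (auto cong: chart_point_cong)

lemma poly_in_free_eval:
  "p \<in> poly_in (chart_free K N d \<sigma>) \<Longrightarrow> p (chart_point K N d \<sigma> w) = p w"
  by (rule poly_inD(2)[of p "chart_free K N d \<sigma>"]) (auto simp: chart_point_def)

lemma strat_of_stiefel:
  assumes "x \<in> stiefel_tuples K d N"
  shows "strat_of K d N x \<in> strategies K d N"
  using assms by (auto simp: strat_of_def strategies_def grassmannian_def stiefel_tuples_def)

lemma strategies_strat_of:
  assumes "s \<in> strategies K d N"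
  obtains x where "x \<in> stiefel_tuples K d N" "s = strat_of K d N x"
proof -
  obtain U V where s: "s = (U, V)" by (cases s)
  have "\<exists>A. \<forall>i<K. full_rank N d (A i) \<and> f i = colspace N d (A i)"
    if "\<forall>i<K. f i \<in> grassmannian d N" for f :: "nat \<Rightarrow> (nat \<Rightarrow> complex) set"
    using that unfolding grassmannian_def by (intro choice) auto
  from this[of U] this[of V] obtain A B where A: "\<forall>i<K. full_rank N d (A i) \<and> U i = colspace N d (A i)"
    and B: "\<forall>i<K. full_rank N d (B i) \<and> V i = colspace N d (B i)"
    using assms s by (auto simp: strategies_def)
  define x where "x = (\<lambda>(s, i, k, l). if i < K \<and> k < N \<and> l < d then (if s then B i k l else A i k l) else (0::complex))"
  have cs: "colspace N d (\<lambda>k l. x (s, i, k, l)) = colspace N d (if s then B i else A i)"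
    and fr: "full_rank N d (\<lambda>k l. x (s, i, k, l)) = full_rank N d (if s then B i else A i)" if "i < K" for s i
  proof -
    have eq: "(\<Sum>l<d. x (s, i, k, l) * c l) = (\<Sum>l<d. (if s then B i else A i) k l * c l)" if "k < N" for k c
      using that \<open>i < K\<close> by (intro sum.cong) (auto simp: x_def)
    show "colspace N d (\<lambda>k l. x (s, i, k, l)) = colspace N d (if s then B i else A i)"
      unfolding colspace_def by (simp add: eq cong: if_cong)
    show "full_rank N d (\<lambda>k l. x (s, i, k, l)) = full_rank N d (if s then B i else A i)"
      unfolding full_rank_def using eq by simp
  qed
  have "x \<in> stiefel_tuples K d N" unfolding stiefel_tuples_def
    using A B fr by (auto simp: x_def split: if_splits)
  moreover have "s = strat_of K d N x"
    using A B assms s by (auto simp: strat_of_def fun_eq_iff cs strategies_def)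
  ultimately show thesis using that by blast
qed

context
  fixes K N d :: nat and \<sigma> :: "bool \<times> nat \<times> nat \<Rightarrow> nat"
  assumes chart: "is_chart K N d \<sigma>"
begin

lemma chart_lt: "i < K \<Longrightarrow> l < d \<Longrightarrow> \<sigma> (s, i, l) < N"
  using chart by (auto simp: is_chart_def PiE_iff)

lemma chart_inj: "i < K \<Longrightarrow> l < d \<Longrightarrow> l' < d \<Longrightarrow> \<sigma> (s, i, l) = \<sigma> (s, i, l') \<longleftrightarrow> l = l'"
  using chart inj_on_eq_iff[of "\<lambda>l. \<sigma> (s, i, l)" "{..<d}" l l'] by (auto simp: is_chart_def)

lemma chart_point_pivot:
  "i < K \<Longrightarrow> a < d \<Longrightarrow> l < d \<Longrightarrow> chart_point K N d \<sigma> w (s, i, \<sigma> (s, i, a), l) = (if a = l then 1 else 0)"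
  using chart_inj[of i l a s] chart_lt by (auto simp: chart_point_def chart_free_def)

lemma chart_point_eqI:
  assumes "\<And>s i a l. i < K \<Longrightarrow> a < d \<Longrightarrow> l < d \<Longrightarrow> y (s, i, \<sigma> (s, i, a), l) = (if a = l then 1 else 0)"
    and "i < K" "k < N" "l < d"
  shows "chart_point K N d \<sigma> y (s, i, k, l) = y (s, i, k, l)"
proof (cases "\<exists>a<d. \<sigma> (s, i, a) = k")
  case True
  then show ?thesis using assms chart_point_pivot by auto
next
  case False
  then show ?thesis using assms by (auto simp: chart_point_def chart_free_def)
qed

lemma chart_point_stiefel: "chart_point K N d \<sigma> w \<in> stiefel_tuples K d N"
proof -
  have "full_rank N d (\<lambda>k l. chart_point K N d \<sigma> w (s, i, k, l))" if i: "i < K" for s i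
    unfolding full_rank_def
  proof (intro allI impI)
    fix c a assume c: "\<forall>k<N. (\<Sum>l<d. chart_point K N d \<sigma> w (s, i, k, l) * c l) = 0" and a: "a < d"
    have "(\<Sum>l<d. chart_point K N d \<sigma> w (s, i, \<sigma> (s, i, a), l) * c l) = (\<Sum>l<d. if l = a then c l else 0)"
      using i a by (intro sum.cong) (auto simp: chart_point_pivot)
    with c chart_lt[OF i a] a show "c a = 0" by simp
  qed
  then show ?thesis by (auto simp: stiefel_tuples_def chart_point_def chart_free_def split: if_splits)
qed

lemma strat_of_eqD:
  assumes "strat_of K d N x = strat_of K d N y" "i < K"
  shows "colspace N d (\<lambda>k l. x (s, i, k, l)) = colspace N d (\<lambda>k l. y (s, i, k, l))"
  using arg_cong[OF assms(1), of "\<lambda>u. fst u i"] arg_cong[OF assms(1), of "\<lambda>u. snd u i"] assms(2)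
  by (cases s) (simp_all add: strat_of_def)

text \<open>Two bases of one space differ by a matrix \<open>G\<close>, and the identity blocks in
  the pivot rows force \<open>G\<close> to be the identity.\<close>

lemma chart_point_unique:
  assumes "chart_strat K N d \<sigma> w = chart_strat K N d \<sigma> w'"
  shows "chart_point K N d \<sigma> w = chart_point K N d \<sigma> w'"
proof (rule ext)
  fix j :: "strat_index"
  obtain s i k l where j: "j = (s, i, k, l)" by (cases j)
  show "chart_point K N d \<sigma> w j = chart_point K N d \<sigma> w' j"
  proof (cases "i < K \<and> k < N \<and> l < d")
    case True
    then have i: "i < K" by simp
    obtain G where G: "\<And>k l. k < N \<Longrightarrow> l < d \<Longrightarrow> chart_point K N d \<sigma> w (s, i, k, l)
        = (\<Sum>m<d. chart_point K N d \<sigma> w' (s, i, k, m) * G m l)"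
      using colspace_subset_imp[OF equalityD1[OF strat_of_eqD[OF assms i, of s]]] by blast
    have "G a l = (if a = l then 1 else 0)" if "a < d" "l < d" for a l
    proof -
      have "(\<Sum>m<d. chart_point K N d \<sigma> w' (s, i, \<sigma> (s, i, a), m) * G m l) = (\<Sum>m<d. if m = a then G m l else 0)"
        using i that by (intro sum.cong) (auto simp: chart_point_pivot)
      then show ?thesis using G[OF chart_lt[OF i that(1)] that(2), of s] i that by (simp add: chart_point_pivot)
    qed
    then have "(\<Sum>m<d. chart_point K N d \<sigma> w' (s, i, k, m) * G m l)
      = (\<Sum>m<d. if m = l then chart_point K N d \<sigma> w' (s, i, k, m) else 0)"
      using True by (intro sum.cong) auto
    then show ?thesis using True G by (simp add: j)
  qed (auto simp: j chart_point_def chart_free_def)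
qed

text \<open>Multiplying each matrix by the inverse of its pivot block keeps the column space and
  produces the chart coordinates as rational functions of \<open>x\<close>. \<open>D\<close> is
  nonzero exactly over the chart, which makes the chart open.\<close>

lemma chart_normalization:
  obtains D num where "D \<in> poly_fun" "\<And>j. num j \<in> poly_fun"
    "\<And>x w. chart_strat K N d \<sigma> w = strat_of K d N x \<Longrightarrow> D x \<noteq> 0"
    "\<And>x C. (\<And>s i a b. i < K \<Longrightarrow> a < d \<Longrightarrow> b < d \<Longrightarrow>
        (\<Sum>m<d. x (s, i, \<sigma> (s, i, a), m) * C s i m b) = (if a = b then 1 else 0)) \<Longrightarrow> D x \<noteq> 0"
    "\<And>x. D x \<noteq> 0 \<Longrightarrow> chart_strat K N d \<sigma> (\<lambda>j. num j x / D x) = strat_of K d N x"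
proof -
  define F where "F s i a b = (\<lambda>x :: strat_index \<Rightarrow> complex. x (s, i, \<sigma> (s, i, a), b))" for s i a b
  have F: "F s i a b \<in> poly_fun" for s i a b unfolding F_def by (rule pvar)
  define Q where "Q s i D G \<longleftrightarrow> D \<in> poly_fun \<and> (\<forall>a b. G a b \<in> poly_fun) \<and>
    (\<forall>x a b. a < d \<longrightarrow> b < d \<longrightarrow> (\<Sum>m<d. F s i a m x * G m b x) = (if a = b then D x else 0)) \<and>
    (\<forall>x a b. a < d \<longrightarrow> b < d \<longrightarrow> (\<Sum>m<d. G a m x * F s i m b x) = (if a = b then D x else 0)) \<and>
    (\<forall>x C. (\<forall>a b. a < d \<longrightarrow> b < d \<longrightarrow> (\<Sum>m<d. F s i a m x * C m b) = (if a = b then 1 else 0)) \<longrightarrow> D x \<noteq> 0)"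
    for s i D G
  have "\<exists>D G. Q s i D G" for s i
    unfolding Q_def by (rule polynomial_adjugate[of "F s i" d, OF F]) blast
  then obtain E G where "\<And>s i. Q s i (E s i) (G s i)" by metis
  then have E: "\<And>s i. E s i \<in> poly_fun" and G: "\<And>s i a b. G s i a b \<in> poly_fun"
    and FG: "\<And>s i x a b. a < d \<Longrightarrow> b < d \<Longrightarrow> (\<Sum>m<d. F s i a m x * G s i m b x) = (if a = b then E s i x else 0)"
    and GF: "\<And>s i x a b. a < d \<Longrightarrow> b < d \<Longrightarrow> (\<Sum>m<d. G s i a m x * F s i m b x) = (if a = b then E s i x else 0)"
    and inv: "\<And>s i x C. (\<forall>a b. a < d \<longrightarrow> b < d \<longrightarrow> (\<Sum>m<d. F s i a m x * C m b) = (if a = b then 1 else 0)) \<Longrightarrow> E s i x \<noteq> 0"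
    unfolding Q_def by blast+
  let ?I = "(UNIV :: bool set) \<times> {..<K}"
  \<comment> \<open>One common denominator for all \<open>2 K\<close> matrices; the extra product in
    \<open>num\<close> compensates for the foreign determinants.\<close>
  define D where "D x = (\<Prod>(s, i)\<in>?I. E s i x)" for x
  define num where "num = (\<lambda>(s, i, k, l) x. (\<Sum>m<d. x (s, i, k, m) * G s i m l x) * (\<Prod>(s, i)\<in>?I - {(s, i)}. E s i x))"
  have num: "num j \<in> poly_fun" for j
    unfolding num_def by (cases j) (auto intro!: pmult poly_fun_sum poly_fun_prod pvar G E)
  have D: "D \<in> poly_fun" unfolding D_def by (auto intro!: poly_fun_prod E)
  have Dnz: "D x \<noteq> 0 \<longleftrightarrow> (\<forall>s. \<forall>i<K. E s i x \<noteq> 0)" for x unfolding D_def by auto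
  have quot: "num (s, i, k, l) x / D x = (\<Sum>m<d. x (s, i, k, m) * (G s i m l x / E s i x))"
    if "D x \<noteq> 0" "i < K" for s i k l x
  proof -
    have "D x = E s i x * (\<Prod>(s, i)\<in>?I - {(s, i)}. E s i x)" unfolding D_def
      using that(2) by (subst prod.remove[of ?I "(s, i)"]) auto
    moreover from this have "(\<Prod>(s, i)\<in>?I - {(s, i)}. E s i x) \<noteq> 0" using that(1) by auto
    ultimately show ?thesis by (simp add: num_def sum_divide_distrib)
  qed
  have inv': "D x \<noteq> 0" if inverse: "\<And>s i a b. i < K \<Longrightarrow> a < d \<Longrightarrow> b < d \<Longrightarrow>
        (\<Sum>m<d. x (s, i, \<sigma> (s, i, a), m) * C s i m b) = (if a = b then 1 else 0)" for x C
  proof -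
    have "E s i x \<noteq> 0" if "i < K" for s i
      by (rule inv[of s i x "C s i"]) (simp add: F_def inverse[OF that])
    then show ?thesis by (simp add: Dnz)
  qed
  show thesis
  proof (rule that[OF D num _ inv'])
    fix x w assume eq: "chart_strat K N d \<sigma> w = strat_of K d N x"
    define C where "C s i = (SOME G. \<forall>k<N. \<forall>l<d. chart_point K N d \<sigma> w (s, i, k, l)
      = (\<Sum>m<d. x (s, i, k, m) * G m l))" for s i
    have C: "\<forall>k<N. \<forall>l<d. chart_point K N d \<sigma> w (s, i, k, l) = (\<Sum>m<d. x (s, i, k, m) * C s i m l)"
      if "i < K" for s i
    proof -
      from strat_of_eqD[OF eq that, of s] obtain G where
        "\<And>k l. k < N \<Longrightarrow> l < d \<Longrightarrow> chart_point K N d \<sigma> w (s, i, k, l) = (\<Sum>m<d. x (s, i, k, m) * G m l)"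
        using colspace_subset_imp[OF equalityD1] by blast
      then have "\<exists>G. \<forall>k<N. \<forall>l<d. chart_point K N d \<sigma> w (s, i, k, l) = (\<Sum>m<d. x (s, i, k, m) * G m l)"
        by auto
      then show ?thesis unfolding C_def by (rule someI_ex)
    qed
    show "D x \<noteq> 0"
    proof (rule inv'[of x C])
      fix s i a b assume "i < K" "a < d" "b < d"
      then show "(\<Sum>m<d. x (s, i, \<sigma> (s, i, a), m) * C s i m b) = (if a = b then 1 else 0)"
        using C[of i s] chart_lt[of i a s] chart_point_pivot[of i a b w s] by simp
    qed
  next
    fix x assume Dx: "D x \<noteq> 0"
    let ?y = "\<lambda>j. num j x / D x"
    have Ex: "E s i x \<noteq> 0" if "i < K" for s i using Dx that Dnz by blast
    have piv: "?y (s, i, \<sigma> (s, i, a), l) = (if a = l then 1 else 0)" if "i < K" "a < d" "l < d" for s i a l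
    proof -
      have "?y (s, i, \<sigma> (s, i, a), l) = (\<Sum>m<d. F s i a m x * G s i m l x) / E s i x"
        using quot[OF Dx that(1)] by (simp add: F_def sum_divide_distrib)
      then show ?thesis using FG[OF that(2,3)] Ex[OF that(1)] by simp
    qed
    have pt: "chart_point K N d \<sigma> ?y (s, i, k, l) = ?y (s, i, k, l)" if "i < K" "k < N" "l < d" for s i k l
      by (rule chart_point_eqI[OF piv that])
    have "colspace N d (\<lambda>k l. chart_point K N d \<sigma> ?y (s, i, k, l)) = colspace N d (\<lambda>k l. x (s, i, k, l))"
      if i: "i < K" for s i
    proof
      show "colspace N d (\<lambda>k l. chart_point K N d \<sigma> ?y (s, i, k, l)) \<subseteq> colspace N d (\<lambda>k l. x (s, i, k, l))"
        by (rule colspace_subset[of _ _ _ _ "\<lambda>m l. G s i m l x / E s i x"]) (use pt quot[OF Dx] i in auto)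
      show "colspace N d (\<lambda>k l. x (s, i, k, l)) \<subseteq> colspace N d (\<lambda>k l. chart_point K N d \<sigma> ?y (s, i, k, l))"
      proof (rule colspace_subset[of _ _ _ _ "\<lambda>m l. F s i m l x"])
        fix k l assume kl: "k < N" "l < d"
        have "(\<Sum>m<d. chart_point K N d \<sigma> ?y (s, i, k, m) * F s i m l x)
          = (\<Sum>m<d. \<Sum>m'<d. x (s, i, k, m') * (G s i m' m x * F s i m l x) / E s i x)"
          using pt quot[OF Dx] i kl by (simp add: sum_distrib_right mult.assoc)
        also have "\<dots> = (\<Sum>m'<d. \<Sum>m<d. x (s, i, k, m') * (G s i m' m x * F s i m l x) / E s i x)" by (rule sum.swap)
        also have "\<dots> = (\<Sum>m'<d. x (s, i, k, m') * (\<Sum>m<d. G s i m' m x * F s i m l x) / E s i x)"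
          by (simp add: sum_distrib_left sum_divide_distrib)
        also have "\<dots> = (\<Sum>m'<d. if m' = l then x (s, i, k, m') else 0)"
          using kl Ex[OF i] by (intro sum.cong) (auto simp: GF)
        finally show "x (s, i, k, l) = (\<Sum>m<d. chart_point K N d \<sigma> ?y (s, i, k, m) * F s i m l x)" using kl by simp
      qed
    qed
    then show "chart_strat K N d \<sigma> ?y = strat_of K d N x"
      by (auto simp: strat_of_def fun_eq_iff)
  qed
qed

text \<open>The condition is vacuous for strategies outside the chart, so this is the zero locus of
  \<open>f\<close> in the chart together with the complement of the chart. Taking all of the
  complement makes the set closed.\<close>

definition chart_zeros :: "((strat_index \<Rightarrow> complex) \<Rightarrow> complex) \<Rightarrow> strategy set" where
  "chart_zeros f = {s \<in> strategies K d N. \<forall>w. chart_strat K N d \<sigma> w = s \<longrightarrow> f (chart_point K N d \<sigma> w) = 0}"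

lemma clear_denominators:
  assumes "f \<in> poly_fun" "D \<in> poly_fun" "\<And>i. \<exists>q\<in>poly_fun. \<exists>e. \<forall>x. D x \<noteq> 0 \<longrightarrow> q x = g x i * D x ^ e"
  shows "\<exists>q\<in>poly_fun. \<exists>e. \<forall>x. D x \<noteq> 0 \<longrightarrow> q x = f (g x) * D x ^ e"
  using assms(1)
proof induction
  case (pconst c)
  show ?case by (intro bexI[of _ "\<lambda>_. c"] exI[of _ 0]) (auto intro: poly_fun.pconst)
next
  case (padd p q)
  then obtain a e b n where a: "a \<in> poly_fun" "\<forall>x. D x \<noteq> 0 \<longrightarrow> a x = p (g x) * D x ^ e"
    and b: "b \<in> poly_fun" "\<forall>x. D x \<noteq> 0 \<longrightarrow> b x = q (g x) * D x ^ n" by blast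
  have pw: "(\<lambda>x. D x ^ n) \<in> poly_fun" for n
    by (induction n) (auto intro: poly_fun.pconst poly_fun.pmult assms(2))
  show ?case
    by (intro bexI[of _ "\<lambda>x. a x * D x ^ n + b x * D x ^ e"] exI[of _ "e + n"])
       (use a b pw in \<open>auto simp: algebra_simps power_add intro!: poly_fun.padd poly_fun.pmult\<close>)
next
  case (pmult p q)
  then obtain a e b n where a: "a \<in> poly_fun" "\<forall>x. D x \<noteq> 0 \<longrightarrow> a x = p (g x) * D x ^ e"
    and b: "b \<in> poly_fun" "\<forall>x. D x \<noteq> 0 \<longrightarrow> b x = q (g x) * D x ^ n" by blast
  show ?case
    by (intro bexI[of _ "\<lambda>x. a x * b x"] exI[of _ "e + n"])
       (use a b in \<open>auto simp: algebra_simps power_add intro!: poly_fun.pmult\<close>)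
qed (rule assms(3))

text \<open>On Stiefel tuples the set is cut out by \<open>D x * q x\<close>: the factor
  \<open>D\<close> vanishes outside the chart, and over the chart \<open>q\<close> is
  \<open>f\<close> of the normalised coordinates times a power of \<open>D\<close>.\<close>

lemma grass_closed_chart_zeros:
  assumes f: "f \<in> poly_fun"
  shows "grass_closed K d N (chart_zeros f)"
proof -
  obtain D num where D: "D \<in> poly_fun" and num: "\<And>j. num j \<in> poly_fun"
    and nz: "\<And>x w. chart_strat K N d \<sigma> w = strat_of K d N x \<Longrightarrow> D x \<noteq> 0"
    and eq: "\<And>x. D x \<noteq> 0 \<Longrightarrow> chart_strat K N d \<sigma> (\<lambda>j. num j x / D x) = strat_of K d N x"
    by (rule chart_normalization) blast
  define g where "g x = chart_point K N d \<sigma> (\<lambda>j. num j x / D x)" for x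
  have "\<exists>q\<in>poly_fun. \<exists>e. \<forall>x. D x \<noteq> 0 \<longrightarrow> q x = g x j * D x ^ e" for j
  proof (cases "j \<in> chart_free K N d \<sigma>")
    case True
    then show ?thesis by (intro bexI[OF _ num[of j]] exI[of _ 1]) (auto simp: g_def chart_point_def split: prod.splits)
  next
    case False
    then obtain c where "\<And>x. g x j = c" by (cases j) (auto simp: g_def chart_point_def)
    then show ?thesis by (intro bexI[OF _ pconst[of c]] exI[of _ 0]) auto
  qed
  then have "\<exists>q\<in>poly_fun. \<exists>e. \<forall>x. D x \<noteq> 0 \<longrightarrow> q x = f (g x) * D x ^ e"
    by (rule clear_denominators[OF f D])
  then obtain q where q0: "q \<in> poly_fun" and "\<exists>e. \<forall>x. D x \<noteq> 0 \<longrightarrow> q x = f (g x) * D x ^ e" by (rule bexE)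
  then obtain e where "\<forall>x. D x \<noteq> 0 \<longrightarrow> q x = f (g x) * D x ^ e" by (elim exE)
  with q0 have q: "q \<in> poly_fun" "\<And>x. D x \<noteq> 0 \<Longrightarrow> q x = f (g x) * D x ^ e" by simp_all
  have "strat_of K d N x \<in> chart_zeros f \<longleftrightarrow> D x * q x = 0" if x: "x \<in> stiefel_tuples K d N" for x
  proof (cases "D x = 0")
    case True
    then show ?thesis using nz strat_of_stiefel[OF x] by (auto simp: chart_zeros_def)
  next
    case False
    have "strat_of K d N x \<in> chart_zeros f \<longleftrightarrow> f (g x) = 0"
    proof
      assume "strat_of K d N x \<in> chart_zeros f"
      then show "f (g x) = 0" using eq[OF False] by (auto simp: chart_zeros_def g_def)
    next
      assume f0: "f (g x) = 0"
      have "f (chart_point K N d \<sigma> w) = 0" if w: "chart_strat K N d \<sigma> w = strat_of K d N x" for w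
        using chart_point_unique[of w "\<lambda>j. num j x / D x"] w eq[OF False] f0 by (simp add: g_def)
      then show "strat_of K d N x \<in> chart_zeros f" using strat_of_stiefel[OF x] by (simp add: chart_zeros_def)
    qed
    then show ?thesis using False q(2) by simp
  qed
  then have "{x \<in> stiefel_tuples K d N. strat_of K d N x \<in> chart_zeros f}
    = stiefel_tuples K d N \<inter> zero_set {\<lambda>x. D x * q x}" by (auto simp: zero_set_def)
  then show ?thesis unfolding grass_closed_def zariski_closed_in_def
    using D q(1) by (auto simp: chart_zeros_def intro!: exI[of _ "{\<lambda>x. D x * q x}"] pmult)
qed

lemma grass_closed_trace:
  assumes "grass_closed K d N C"
  obtains P where "P \<subseteq> poly_fun"
    "\<And>w. chart_strat K N d \<sigma> w \<in> C \<longleftrightarrow> (\<forall>p\<in>P. p (chart_point K N d \<sigma> w) = 0)"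
proof -
  from assms obtain P where P: "P \<subseteq> poly_fun"
    "{x \<in> stiefel_tuples K d N. strat_of K d N x \<in> C} = stiefel_tuples K d N \<inter> zero_set P"
    by (auto simp: grass_closed_def zariski_closed_in_def)
  have "chart_strat K N d \<sigma> w \<in> C \<longleftrightarrow> (\<forall>p\<in>P. p (chart_point K N d \<sigma> w) = 0)" for w
    using P(2) chart_point_stiefel[of w] by (auto simp: zero_set_def)
  with P(1) that show thesis by blast
qed

end

lemma stiefel_in_chart:
  assumes "x \<in> stiefel_tuples K d N"
  obtains \<sigma> w where "is_chart K N d \<sigma>" "chart_strat K N d \<sigma> w = strat_of K d N x"
proof -
  define Q where "Q s i \<tau> C \<longleftrightarrow> inj_on \<tau> {..<d} \<and> (\<forall>l<d. \<tau> l < N) \<and>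
    (\<forall>a<d. \<forall>b<d. (\<Sum>m<d. x (s, i, \<tau> a, m) * C m b) = (if a = b then 1 else 0))" for s i \<tau> C
  have "\<exists>\<tau> C. Q s i \<tau> C" if "i < K" for s i
  proof -
    have "full_rank N d (\<lambda>k l. x (s, i, k, l))" using assms that by (auto simp: stiefel_tuples_def)
    then show ?thesis unfolding Q_def by (rule full_rank_pivots) blast
  qed
  note ex = this
  define \<tau> where "\<tau> s i = (SOME \<tau>. \<exists>C. Q s i \<tau> C)" for s i
  define C where "C s i = (SOME C. Q s i (\<tau> s i) C)" for s i
  have "Q s i (\<tau> s i) (C s i)" if "i < K" for s i
    using someI_ex[OF ex[OF that, of s]] unfolding \<tau>_def[symmetric] C_def by (rule someI_ex)
  then have \<tau>: "\<And>s i. i < K \<Longrightarrow> inj_on (\<tau> s i) {..<d}" "\<And>s i l. i < K \<Longrightarrow> l < d \<Longrightarrow> \<tau> s i l < N"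
    and C: "\<And>s i a b. i < K \<Longrightarrow> a < d \<Longrightarrow> b < d \<Longrightarrow> (\<Sum>m<d. x (s, i, \<tau> s i a, m) * C s i m b) = (if a = b then 1 else 0)"
    unfolding Q_def by blast+
  define \<sigma> where "\<sigma> = restrict (\<lambda>(s, i, l). \<tau> s i l) (UNIV \<times> {..<K} \<times> {..<d})"
  have \<sigma>: "\<sigma> (s, i, l) = \<tau> s i l" if "i < K" "l < d" for s i l using that by (simp add: \<sigma>_def)
  have chart: "is_chart K N d \<sigma>" unfolding is_chart_def
  proof
    show "\<sigma> \<in> (UNIV \<times> {..<K} \<times> {..<d}) \<rightarrow>\<^sub>E {..<N}" unfolding \<sigma>_def using \<tau>(2) by auto
    show "\<forall>s. \<forall>i<K. inj_on (\<lambda>l. \<sigma> (s, i, l)) {..<d}"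
      using \<tau>(1) \<sigma> unfolding inj_on_def by auto
  qed
  obtain D num where inv: "\<And>x C. (\<And>s i a b. i < K \<Longrightarrow> a < d \<Longrightarrow> b < d \<Longrightarrow>
        (\<Sum>m<d. x (s, i, \<sigma> (s, i, a), m) * C s i m b) = (if a = b then 1 else 0)) \<Longrightarrow> D x \<noteq> 0"
    and eq: "\<And>x. D x \<noteq> 0 \<Longrightarrow> chart_strat K N d \<sigma> (\<lambda>j. num j x / D x) = strat_of K d N x"
    by (rule chart_normalization[OF chart]) blast
  have "D x \<noteq> 0" by (rule inv[of x C]) (simp add: \<sigma> C)
  from that[OF chart eq[OF this]] show thesis .
qed

section \<open>Chains of irreducible closed sets\<close>

definition trilinear :: "nat \<Rightarrow> (nat \<Rightarrow> complex) \<Rightarrow> (nat \<Rightarrow> nat \<Rightarrow> complex) \<Rightarrow> (nat \<Rightarrow> complex) \<Rightarrow> complex" where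
  "trilinear N v H u = (\<Sum>a<N. \<Sum>b<N. v a * H a b * u b)"

definition align_eqn :: "nat \<Rightarrow> (chan_index \<Rightarrow> complex) \<Rightarrow> (strat_index \<Rightarrow> complex)
    \<Rightarrow> chan_index \<Rightarrow> complex" where
  "align_eqn N h x = (\<lambda>(i, j, a, b). trilinear N (\<lambda>k. x (True, i, k, a)) (\<lambda>k k'. h (i, j, k, k')) (\<lambda>k. x (False, j, k, b)))"

text \<open>Serves twice: with \<open>n = N\<close> it indexes the channel entries, with
  \<open>n = d\<close> the scalar alignment equations.\<close>

definition h_index :: "nat \<Rightarrow> nat \<Rightarrow> chan_index set" where
  "h_index K n = {(i, j, a, b). i < K \<and> j < K \<and> i \<noteq> j \<and> a < n \<and> b < n}"

lemma h_index_Sigma: "h_index K n = (SIGMA i:{..<K}. ({..<K} - {i}) \<times> {..<n} \<times> {..<n})"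
  by (auto simp: h_index_def)

lemma finite_h_index: "finite (h_index K n)"
  unfolding h_index_Sigma by (intro finite_SigmaI) auto

lemma card_h_index: "card (h_index K n) = K * ((K - 1) * (n * n))"
  unfolding h_index_Sigma by (subst card_SigmaI) (auto simp: card_cartesian_product)

lemma trilinear_cong:
  "(\<And>k. k < N \<Longrightarrow> v k = v' k) \<Longrightarrow> (\<And>k k'. k < N \<Longrightarrow> k' < N \<Longrightarrow> H k k' = H' k k') \<Longrightarrow>
   (\<And>k. k < N \<Longrightarrow> u k = u' k) \<Longrightarrow> trilinear N v H u = trilinear N v' H' u'"
  unfolding trilinear_def by (intro sum.cong) auto

lemma trilinear_combination:
  "trilinear N (\<lambda>k. \<Sum>a<d. A k a * c a) H (\<lambda>k. \<Sum>b<e. B k b * c' b)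
    = (\<Sum>a<d. \<Sum>b<e. c a * c' b * trilinear N (\<lambda>k. A k a) H (\<lambda>k. B k b))"
proof -
  have "trilinear N (\<lambda>k. \<Sum>a<d. A k a * c a) H (\<lambda>k. \<Sum>b<e. B k b * c' b)
    = (\<Sum>k<N. \<Sum>k'<N. \<Sum>a<d. \<Sum>b<e. c a * c' b * (A k a * H k k' * B k' b))"
    unfolding trilinear_def
    by (intro sum.cong refl) (simp add: sum_distrib_left sum_distrib_right mult_ac sum.swap[of _ "{..<d}" "{..<e}"])
  also have "\<dots> = (\<Sum>k<N. \<Sum>a<d. \<Sum>k'<N. \<Sum>b<e. c a * c' b * (A k a * H k k' * B k' b))"
    by (intro sum.cong refl) (rule sum.swap)
  also have "\<dots> = (\<Sum>a<d. \<Sum>k<N. \<Sum>k'<N. \<Sum>b<e. c a * c' b * (A k a * H k k' * B k' b))"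
    by (rule sum.swap)
  also have "\<dots> = (\<Sum>a<d. \<Sum>k<N. \<Sum>b<e. \<Sum>k'<N. c a * c' b * (A k a * H k k' * B k' b))"
    by (intro sum.cong refl) (rule sum.swap)
  also have "\<dots> = (\<Sum>a<d. \<Sum>b<e. \<Sum>k<N. \<Sum>k'<N. c a * c' b * (A k a * H k k' * B k' b))"
    by (intro sum.cong refl) (rule sum.swap)
  finally show ?thesis unfolding trilinear_def by (simp add: sum_distrib_left)
qed

lemma feasible_strat_of:
  "feasible K N h (strat_of K d N x) \<longleftrightarrow> (\<forall>q\<in>h_index K d. align_eqn N h x q = 0)"
proof
  assume f: "feasible K N h (strat_of K d N x)"
  show "\<forall>q\<in>h_index K d. align_eqn N h x q = 0"
  proof
    fix q assume "q \<in> h_index K d"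
    then obtain i j a b where q: "q = (i, j, a, b)" "i < K" "j < K" "i \<noteq> j" "a < d" "b < d"
      by (auto simp: h_index_def)
    let ?v = "\<lambda>k. if k < N then x (True, i, k, a) else 0"
    let ?u = "\<lambda>k. if k < N then x (False, j, k, b) else 0"
    have "?v \<in> snd (strat_of K d N x) i" "?u \<in> fst (strat_of K d N x) j"
      using q colspace_column[of a d N "\<lambda>k l. x (True, i, k, l)"] colspace_column[of b d N "\<lambda>k l. x (False, j, k, l)"]
      by (auto simp: strat_of_def)
    from f[unfolded feasible_def, rule_format, OF q(2-4) this]
    have "trilinear N ?v (\<lambda>k k'. h (i, j, k, k')) ?u = 0" unfolding trilinear_def .
    then show "align_eqn N h x q = 0" unfolding q align_eqn_def
      by (simp cong: trilinear_cong)
  qed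
next
  assume e: "\<forall>q\<in>h_index K d. align_eqn N h x q = 0"
  show "feasible K N h (strat_of K d N x)" unfolding feasible_def
  proof (intro allI impI ballI)
    fix i j v u assume ij: "i < K" "j < K" "i \<noteq> j" and v: "v \<in> snd (strat_of K d N x) i" and u: "u \<in> fst (strat_of K d N x) j"
    from v u ij obtain c c' where c: "v = (\<lambda>k. if k < N then (\<Sum>l<d. x (True, i, k, l) * c l) else 0)"
      "u = (\<lambda>k. if k < N then (\<Sum>l<d. x (False, j, k, l) * c' l) else 0)"
      by (auto simp: strat_of_def colspace_def)
    have "trilinear N v (\<lambda>k k'. h (i, j, k, k')) u = trilinear N (\<lambda>k. \<Sum>l<d. x (True, i, k, l) * c l)
      (\<lambda>k k'. h (i, j, k, k')) (\<lambda>k. \<Sum>l<d. x (False, j, k, l) * c' l)"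
      by (rule trilinear_cong) (simp_all add: c)
    also have "\<dots> = 0" unfolding trilinear_combination
      using e ij by (intro sum.neutral) (auto simp: align_eqn_def h_index_def)
    finally show "(\<Sum>a<N. \<Sum>b<N. v a * h (i, j, a, b) * u b) = 0" by (simp add: trilinear_def)
  qed
qed

lemma grass_closed_Inter:
  assumes "\<C> \<noteq> {}" "\<And>C. C \<in> \<C> \<Longrightarrow> grass_closed K d N C"
  shows "grass_closed K d N (\<Inter>\<C>)"
proof -
  have "\<forall>C\<in>\<C>. \<exists>P\<subseteq>poly_fun. {x \<in> stiefel_tuples K d N. strat_of K d N x \<in> C} = stiefel_tuples K d N \<inter> zero_set P"
    using assms(2) by (simp add: grass_closed_def zariski_closed_in_def)
  then obtain P where "\<forall>C\<in>\<C>. P C \<subseteq> poly_fun \<and>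
    {x \<in> stiefel_tuples K d N. strat_of K d N x \<in> C} = stiefel_tuples K d N \<inter> zero_set (P C)"
    by (rule bchoice[THEN exE])
  then have P: "\<And>C. C \<in> \<C> \<Longrightarrow> P C \<subseteq> poly_fun"
    "\<And>C. C \<in> \<C> \<Longrightarrow> {x \<in> stiefel_tuples K d N. strat_of K d N x \<in> C} = stiefel_tuples K d N \<inter> zero_set (P C)"
    by auto
  have "{x \<in> stiefel_tuples K d N. strat_of K d N x \<in> \<Inter>\<C>} = stiefel_tuples K d N \<inter> zero_set (\<Union>(P ` \<C>))"
  proof (rule Set.set_eqI)
    fix x
    have "strat_of K d N x \<in> C \<longleftrightarrow> (\<forall>p\<in>P C. p x = 0)" if "x \<in> stiefel_tuples K d N" "C \<in> \<C>" for C
      using P(2)[OF that(2)] that(1) by (auto simp: zero_set_def)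
    then show "x \<in> {x \<in> stiefel_tuples K d N. strat_of K d N x \<in> \<Inter>\<C>}
      \<longleftrightarrow> x \<in> stiefel_tuples K d N \<inter> zero_set (\<Union>(P ` \<C>))" by (auto simp: zero_set_def)
  qed
  moreover have "\<Union>(P ` \<C>) \<subseteq> poly_fun" using P(1) by blast
  moreover have "\<Inter>\<C> \<subseteq> strategies K d N" using assms by (auto simp: grass_closed_def)
  ultimately show ?thesis unfolding grass_closed_def zariski_closed_in_def by blast
qed

lemma grass_closed_strategies: "grass_closed K d N (strategies K d N)"
proof -
  have "{x \<in> stiefel_tuples K d N. strat_of K d N x \<in> strategies K d N} = stiefel_tuples K d N \<inter> zero_set {}"
    using strat_of_stiefel by (auto simp: zero_set_def)
  then show ?thesis unfolding grass_closed_def zariski_closed_in_def by blast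
qed

lemma closed_in_sub_Int:
  assumes "closed_in_sub K d N F C" "grass_closed K d N C'"
  shows "closed_in_sub K d N F (C \<inter> C')"
proof -
  from assms(1) obtain E where E: "C \<subseteq> F" "grass_closed K d N E" "C = F \<inter> E" by (auto simp: closed_in_sub_def)
  have "grass_closed K d N (\<Inter>{E, C'})" by (rule grass_closed_Inter) (use E assms(2) in auto)
  moreover have "C \<inter> C' = F \<inter> \<Inter>{E, C'}" using E by auto
  ultimately show ?thesis unfolding closed_in_sub_def using E(1) by blast
qed

text \<open>The sets are the traces on \<open>F\<close> of the closures of the zero sets of the
  primes. If two closed sets cover such a trace and neither contains the zero set, the product of
  two equations that fail lies outside the prime, and \<open>nullstellensatz_prime\<close> yields an
  uncovered point. Strictness holds because an \<open>f\<close> in only one of two neighbouring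
  primes separates the closures via \<open>chart_zeros\<close>.\<close>

lemma irred_chain_from_primes:
  assumes chart: "is_chart K N d \<sigma>"
    and pr: "\<forall>k\<le>n. prime_in (poly_in (chart_free K N d \<sigma>)) (Js k)" and strict: "\<forall>k<n. Js (Suc k) \<subset> Js k"
    and F: "\<And>w. (\<forall>p\<in>Js n. p w = 0) \<Longrightarrow> chart_strat K N d \<sigma> w \<in> F"
    and FS: "F \<subseteq> strategies K d N"
  shows "irred_chain K d N F n"
proof -
  let ?T = "chart_free K N d \<sigma>" let ?R = "poly_in ?T"
  let ?s = "\<lambda>w. chart_strat K N d \<sigma> w"
  note R = is_subring_poly_in[of ?T]
  define Z where "Z k = {w. \<forall>p\<in>Js k. p w = 0}" for k
  define cl where "cl k = \<Inter>{C. grass_closed K d N C \<and> ?s ` Z k \<subseteq> C}" for k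
  define C where "C k = F \<inter> cl k" for k
  have dec: "Js n \<subseteq> Js k" if "k \<le> n" for k
    using that
  proof (induction rule: inc_induct)
    case (step m)
    then show ?case using strict by blast
  qed simp
  have ZF: "?s w \<in> F" if "w \<in> Z k" "k \<le> n" for w k
    using that dec[of k] by (intro F) (auto simp: Z_def)
  have cl_closed: "grass_closed K d N (cl k)" if "k \<le> n" for k
    unfolding cl_def
  proof (rule grass_closed_Inter)
    have "?s ` Z k \<subseteq> strategies K d N" using ZF[OF _ that] FS by blast
    with grass_closed_strategies show "{C. grass_closed K d N C \<and> ?s ` Z k \<subseteq> C} \<noteq> {}" by blast
  qed blast
  have Zcl: "?s ` Z k \<subseteq> cl k" for k unfolding cl_def by blast
  have ZC: "?s w \<in> C k" if "w \<in> Z k" "k \<le> n" for w k using that Zcl ZF by (auto simp: C_def)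
  have closed_C: "closed_in_sub K d N F (C k)" if "k \<le> n" for k
    using cl_closed[OF that] by (auto simp: closed_in_sub_def C_def)
  have irr: "irreducible_in K d N F (C k)" if k: "k \<le> n" for k
    unfolding irreducible_in_def
  proof (intro conjI allI impI)
    have pk: "prime_in ?R (Js k)" using pr k by blast
    show "closed_in_sub K d N F (C k)" using closed_C[OF k] .
    obtain w where "w \<in> Z k"
      using nullstellensatz_prime[OF finite_chart_free pk is_subringD(2)[OF R]] prime_inD(3)[OF pk R]
      by (auto simp: Z_def)
    then show "C k \<noteq> {}" using ZC[OF _ k] by blast
    fix C1 C2 assume c: "closed_in_sub K d N F C1" "closed_in_sub K d N F C2" "C k = C1 \<union> C2"
    obtain E1 where E1: "grass_closed K d N E1" "C1 = F \<inter> E1" using c(1) by (auto simp: closed_in_sub_def)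
    obtain E2 where E2: "grass_closed K d N E2" "C2 = F \<inter> E2" using c(2) by (auto simp: closed_in_sub_def)
    have "?s ` Z k \<subseteq> E1 \<or> ?s ` Z k \<subseteq> E2"
    proof (rule ccontr)
      assume "\<not> ?thesis"
      then obtain w1 w2 where w: "w1 \<in> Z k" "?s w1 \<notin> E1" "w2 \<in> Z k" "?s w2 \<notin> E2" by blast
      obtain P1 where P1: "P1 \<subseteq> poly_fun" "\<And>w. ?s w \<in> E1 \<longleftrightarrow> (\<forall>p\<in>P1. p (chart_point K N d \<sigma> w) = 0)"
        by (rule grass_closed_trace[OF chart E1(1)]) blast
      obtain P2 where P2: "P2 \<subseteq> poly_fun" "\<And>w. ?s w \<in> E2 \<longleftrightarrow> (\<forall>p\<in>P2. p (chart_point K N d \<sigma> w) = 0)"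
        by (rule grass_closed_trace[OF chart E2(1)]) blast
      obtain p1 where p1: "p1 \<in> P1" "p1 (chart_point K N d \<sigma> w1) \<noteq> 0" using w P1(2) by blast
      obtain p2 where p2: "p2 \<in> P2" "p2 (chart_point K N d \<sigma> w2) \<noteq> 0" using w P2(2) by blast
      define q1 where "q1 = (\<lambda>w. p1 (chart_point K N d \<sigma> w))"
      define q2 where "q2 = (\<lambda>w. p2 (chart_point K N d \<sigma> w))"
      have q: "q1 \<in> ?R" "q2 \<in> ?R" unfolding q1_def q2_def
        using p1(1) p2(1) P1(1) P2(1) by (auto intro: poly_in_chart_point)
      have "q1 \<notin> Js k" "q2 \<notin> Js k" using w p1(2) p2(2) by (auto simp: Z_def q1_def q2_def)
      then have "q1 * q2 \<notin> Js k" using prime_inD(7)[OF pk R q] by blast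
      then obtain z where z: "z \<in> Z k" "(q1 * q2) z \<noteq> 0"
        using nullstellensatz_prime[OF finite_chart_free pk is_subringD(4)[OF R q]] by (auto simp: Z_def)
      then have "?s z \<notin> E1" "?s z \<notin> E2" using P1(2) P2(2) p1(1) p2(1) by (auto simp: q1_def q2_def)
      moreover have "?s z \<in> C1 \<union> C2" using ZC[OF z(1) k] c(3) by simp
      ultimately show False using E1 E2 by blast
    qed
    then show "C1 = C k \<or> C2 = C k"
    proof
      assume "?s ` Z k \<subseteq> E1"
      then have "cl k \<subseteq> E1" using E1(1) unfolding cl_def by blast
      then show ?thesis using c(3) E1(2) by (auto simp: C_def)
    next
      assume "?s ` Z k \<subseteq> E2"
      then have "cl k \<subseteq> E2" using E2(1) unfolding cl_def by blast
      then show ?thesis using c(3) E2(2) by (auto simp: C_def)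
    qed
  qed
  have "C k \<subset> C (Suc k)" if k: "k < n" for k
  proof -
    have "Z k \<subseteq> Z (Suc k)" using strict k by (auto simp: Z_def)
    then have "cl k \<subseteq> cl (Suc k)" unfolding cl_def by blast
    then have sub: "C k \<subseteq> C (Suc k)" by (auto simp: C_def)
    have pk: "prime_in ?R (Js k)" "prime_in ?R (Js (Suc k))" using pr k by auto
    obtain f where f: "f \<in> Js k" "f \<notin> Js (Suc k)" using strict k by blast
    have fR: "f \<in> ?R" using prime_inD(1)[OF pk(1) R f(1)] .
    obtain w where w: "w \<in> Z (Suc k)" "f w \<noteq> 0"
      using nullstellensatz_prime[OF finite_chart_free pk(2) fR f(2)] by (auto simp: Z_def)
    have "grass_closed K d N (chart_zeros K N d \<sigma> f)"
      by (rule grass_closed_chart_zeros[OF chart poly_inD(1)[OF fR]])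
    moreover have "?s ` Z k \<subseteq> chart_zeros K N d \<sigma> f"
    proof
      fix s assume "s \<in> ?s ` Z k"
      then obtain w' where w': "w' \<in> Z k" "s = ?s w'" by blast
      have "f (chart_point K N d \<sigma> w'') = 0" if "?s w'' = s" for w''
      proof -
        have "chart_point K N d \<sigma> w'' = chart_point K N d \<sigma> w'"
          using chart_point_unique[OF chart] that w'(2) by simp
        then show ?thesis using poly_in_free_eval[OF fR] w'(1) f(1) by (auto simp: Z_def)
      qed
      then show "s \<in> chart_zeros K N d \<sigma> f"
        using ZF[OF w'(1)] k FS w'(2) by (auto simp: chart_zeros_def[OF chart])
    qed
    ultimately have "cl k \<subseteq> chart_zeros K N d \<sigma> f" unfolding cl_def by blast
    moreover have "?s w \<notin> chart_zeros K N d \<sigma> f"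
      using w(2) poly_in_free_eval[OF fR, of w] by (auto simp: chart_zeros_def[OF chart])
    ultimately have "?s w \<notin> C k" by (auto simp: C_def)
    moreover have "?s w \<in> C (Suc k)" using ZC[OF w(1)] k by simp
    ultimately show ?thesis using sub by blast
  qed
  then show ?thesis unfolding irred_chain_def using irr by blast
qed

text \<open>Passing to vanishing ideals in one chart turns the chain into a strict chain of primes,
  to which \<open>prime_chain_independent\<close> applies.\<close>

lemma irred_chain_independent:
  assumes ch: "irred_chain K d N F n" and FS: "F \<subseteq> strategies K d N"
  obtains \<sigma> S where "is_chart K N d \<sigma>" "S \<subseteq> chart_free K N d \<sigma>" "card S = n"
    "\<And>p. p \<in> poly_in S \<Longrightarrow> (\<And>w. chart_strat K N d \<sigma> w \<in> F \<Longrightarrow> p w = 0) \<Longrightarrow> p = 0"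
proof -
  obtain Cs where irr: "\<And>k. k \<le> n \<Longrightarrow> irreducible_in K d N F (Cs k)" and strict: "\<And>k. k < n \<Longrightarrow> Cs k \<subset> Cs (Suc k)"
    using ch unfolding irred_chain_def by blast
  have CF: "Cs k \<subseteq> F" if "k \<le> n" for k
    using irr[OF that] by (auto simp: irreducible_in_def closed_in_sub_def)
  \<comment> \<open>A chart around a point of the smallest member meets every member of the
    chain.\<close>
  obtain s0 where s0: "s0 \<in> Cs 0" using irr[of 0] by (auto simp: irreducible_in_def)
  then obtain x0 where x0: "x0 \<in> stiefel_tuples K d N" "s0 = strat_of K d N x0"
    using strategies_strat_of CF[of 0] FS by blast
  obtain \<sigma> w0 where chart: "is_chart K N d \<sigma>" and w0: "chart_strat K N d \<sigma> w0 = s0"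
    using stiefel_in_chart[OF x0(1)] x0(2) by metis
  let ?T = "chart_free K N d \<sigma>" let ?R = "poly_in ?T"
  let ?s = "\<lambda>w. chart_strat K N d \<sigma> w"
  note R = is_subring_poly_in[of ?T]
  have inc: "Cs 0 \<subseteq> Cs k" if "k \<le> n" for k
    using that
  proof (induction k)
    case (Suc k)
    then have "Cs k \<subset> Cs (Suc k)" by (intro strict) simp
    with Suc show ?case by auto
  qed simp
  have w0C: "?s w0 \<in> Cs k" if "k \<le> n" for k using inc[OF that] s0 w0 by auto
  define Js where "Js k = {p \<in> ?R. \<forall>w. ?s w \<in> Cs k \<longrightarrow> p w = 0}" for k
  have cz: "closed_in_sub K d N F (Cs k \<inter> chart_zeros K N d \<sigma> f)" if "k \<le> n" "f \<in> poly_fun" for k f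
    by (rule closed_in_sub_Int[OF _ grass_closed_chart_zeros[OF chart that(2)]])
       (use irr[OF that(1)] in \<open>auto simp: irreducible_in_def\<close>)
  have in_cz: "?s w \<in> chart_zeros K N d \<sigma> f \<longleftrightarrow> f (chart_point K N d \<sigma> w) = 0" for f w
    using chart_point_unique[OF chart] strat_of_stiefel[OF chart_point_stiefel[OF chart]]
    unfolding chart_zeros_def[OF chart] by (simp, metis)
  have out_cz: "s \<in> chart_zeros K N d \<sigma> f" if "s \<in> strategies K d N" "\<nexists>w. s = ?s w" for s f
    using that by (auto simp: chart_zeros_def[OF chart])
  have pr: "prime_in ?R (Js k)" if k: "k \<le> n" for k
    unfolding prime_in_def
  proof (intro conjI ballI impI)
    show "1 \<notin> Js k" using w0C[OF k] by (auto simp: Js_def)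
    fix f g assume fg: "f \<in> ?R" "g \<in> ?R" "f * g \<in> Js k"
    have pf: "f \<in> poly_fun" "g \<in> poly_fun" using fg by (auto dest: poly_inD(1))
    have "Cs k = (Cs k \<inter> chart_zeros K N d \<sigma> f) \<union> (Cs k \<inter> chart_zeros K N d \<sigma> g)"
    proof (rule equalityI; rule subsetI)
      fix s assume s: "s \<in> Cs k"
      show "s \<in> (Cs k \<inter> chart_zeros K N d \<sigma> f) \<union> (Cs k \<inter> chart_zeros K N d \<sigma> g)"
      proof (cases "\<exists>w. s = ?s w")
        case True
        then obtain w where w: "s = ?s w" by blast
        with s fg(3) have "f w * g w = 0" by (auto simp: Js_def)
        then show ?thesis using s w in_cz poly_in_free_eval[OF fg(1)] poly_in_free_eval[OF fg(2)] by auto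
      next
        case False
        then show ?thesis using s out_cz CF[OF k] FS by blast
      qed
    qed blast
    with irr[OF k] cz[OF k pf(1)] cz[OF k pf(2)]
    have "Cs k \<inter> chart_zeros K N d \<sigma> f = Cs k \<or> Cs k \<inter> chart_zeros K N d \<sigma> g = Cs k"
      unfolding irreducible_in_def by blast
    moreover have "f' \<in> Js k" if f': "f' \<in> ?R" "Cs k \<inter> chart_zeros K N d \<sigma> f' = Cs k" for f'
    proof -
      have "f' w = 0" if "?s w \<in> Cs k" for w
      proof -
        have "?s w \<in> chart_zeros K N d \<sigma> f'" using f'(2) that by blast
        then show ?thesis using in_cz[of w f'] poly_in_free_eval[OF f'(1)] by simp
      qed
      then show ?thesis using f'(1) by (simp add: Js_def)
    qed
    ultimately show "f \<in> Js k \<or> g \<in> Js k" using fg(1,2) by blast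
  qed (use is_subringD[OF R] in \<open>auto simp: Js_def\<close>)
  have "Js (Suc k) \<subset> Js k" if k: "k < n" for k
  proof -
    have sub: "Js (Suc k) \<subseteq> Js k" using strict[OF k] by (auto simp: Js_def)
    have "Js (Suc k) \<noteq> Js k"
    proof
      assume eq: "Js (Suc k) = Js k"
      have kn: "k \<le> n" "Suc k \<le> n" using k by auto
      obtain E where E: "grass_closed K d N E" "Cs k = F \<inter> E"
        using irr[OF kn(1)] by (auto simp: irreducible_in_def closed_in_sub_def)
      obtain P where P: "P \<subseteq> poly_fun" "\<And>w. ?s w \<in> E \<longleftrightarrow> (\<forall>p\<in>P. p (chart_point K N d \<sigma> w) = 0)"
        by (rule grass_closed_trace[OF chart E(1)]) blast
      have trace: "?s w \<in> Cs k" if w: "?s w \<in> Cs (Suc k)" for w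
      proof -
        have "p (chart_point K N d \<sigma> w) = 0" if p: "p \<in> P" for p
        proof -
          have "(\<lambda>w. p (chart_point K N d \<sigma> w)) \<in> Js k"
            using P p E by (auto simp: Js_def intro!: poly_in_chart_point)
          then show ?thesis using eq w by (auto simp: Js_def)
        qed
        then show ?thesis using P(2) E(2) CF[OF kn(2)] w by blast
      qed
      \<comment> \<open>Since 1 has no zeros, \<open>?z\<close> is the complement of the chart. If
        the two ideals agreed, \<open>Cs (Suc k)\<close> would be the union of \<open>Cs k\<close>
        and its part outside the chart, contrary to irreducibility because the base point lies in
        the chart.\<close>
      let ?z = "chart_zeros K N d \<sigma> (\<lambda>_. 1)"
      have "Cs (Suc k) = Cs k \<union> (Cs (Suc k) \<inter> ?z)"
      proof (rule equalityI; rule subsetI)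
        fix s assume s: "s \<in> Cs (Suc k)"
        show "s \<in> Cs k \<union> (Cs (Suc k) \<inter> ?z)"
        proof (cases "\<exists>w. s = ?s w")
          case True
          then show ?thesis using trace s by blast
        next
          case False
          then show ?thesis using s out_cz CF[OF kn(2)] FS by blast
        qed
      qed (use strict[OF k] in blast)
      moreover have "closed_in_sub K d N F (Cs k)" using irr[OF kn(1)] by (simp add: irreducible_in_def)
      ultimately have "Cs k = Cs (Suc k) \<or> Cs (Suc k) \<inter> ?z = Cs (Suc k)"
        using irr[OF kn(2)] cz[OF kn(2) pconst] unfolding irreducible_in_def by blast
      moreover have "?s w0 \<notin> ?z" using in_cz[of w0 "\<lambda>_. 1"] by simp
      ultimately show False using strict[OF k] w0C[OF kn(2)] by blast
    qed
    with sub show ?thesis by blast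
  qed
  with pr obtain S where S: "S \<subseteq> ?T" "card S = n" "Js n \<inter> poly_in S \<subseteq> {0}"
    using prime_chain_independent[OF finite_chart_free, of n K N d \<sigma> Js] by blast
  show thesis
  proof (rule that[OF chart S(1,2)])
    fix p assume p: "p \<in> poly_in S" "\<And>w. ?s w \<in> F \<Longrightarrow> p w = 0"
    then have "p \<in> Js n" using CF[of n] poly_in_mono[OF S(1)] by (auto simp: Js_def)
    with p(1) S(3) show "p = 0" by blast
  qed
qed

section \<open>The incidence variety over a chart\<close>

text \<open>The entry of \<open>H\<close> that occurs with coefficient 1 in the given equation over
  the chart: both pivot rows carry unit vectors.\<close>

definition pivot_index :: "(bool \<times> nat \<times> nat \<Rightarrow> nat) \<Rightarrow> chan_index \<Rightarrow> chan_index" where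
  "pivot_index \<sigma> = (\<lambda>(i, j, a, b). (i, j, \<sigma> (True, i, a), \<sigma> (False, j, b)))"

definition h_pivots :: "nat \<Rightarrow> nat \<Rightarrow> (bool \<times> nat \<times> nat \<Rightarrow> nat) \<Rightarrow> chan_index set" where
  "h_pivots K d \<sigma> = pivot_index \<sigma> ` h_index K d"

text \<open>Variables \<open>Inl\<close> are chart coordinates, \<open>Inr\<close> entries of \<open>h\<close>. The map keeps all variables except the
  pivot entries of \<open>h\<close>, which are replaced by the values that the alignment equations force.\<close>
definition solve_pivots :: "nat \<Rightarrow> nat \<Rightarrow> nat \<Rightarrow> (bool \<times> nat \<times> nat \<Rightarrow> nat) \<Rightarrow>
    (strat_index + chan_index \<Rightarrow> complex) \<Rightarrow>
    strat_index + chan_index \<Rightarrow> complex" where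
  "solve_pivots K N d \<sigma> z = case_sum (\<lambda>j. z (Inl j))
     (\<lambda>q. if q \<in> h_pivots K d \<sigma>
          then - align_eqn N (restr (- h_pivots K d \<sigma>) (\<lambda>q. z (Inr q))) (chart_point K N d \<sigma> (\<lambda>j. z (Inl j)))
                   (inv_into (h_index K d) (pivot_index \<sigma>) q)
          else z (Inr q))"

lemma poly_fun_align_eqn:
  assumes "\<And>q. (\<lambda>z. H z q) \<in> poly_fun" "\<And>j. (\<lambda>z. X z j) \<in> poly_fun"
  shows "(\<lambda>z. align_eqn N (H z) (X z) q) \<in> poly_fun"
  by (cases q) (auto simp: align_eqn_def trilinear_def intro!: poly_fun_sum pmult assms)

lemma align_eqn_cong:
  assumes "\<And>q. q \<in> h_index K N \<Longrightarrow> h q = h' q" "q \<in> h_index K d"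
  shows "align_eqn N h x q = align_eqn N h' x q"
  using assms by (cases q) (auto simp: align_eqn_def h_index_def intro!: trilinear_cong)

context
  fixes K N d :: nat and \<sigma> :: "bool \<times> nat \<times> nat \<Rightarrow> nat"
  assumes chart: "is_chart K N d \<sigma>"
begin

lemma inj_on_pivot_index: "inj_on (pivot_index \<sigma>) (h_index K d)"
  by (auto simp: inj_on_def pivot_index_def h_index_def chart_inj[OF chart])

lemma h_pivots_subset: "h_pivots K d \<sigma> \<subseteq> h_index K N"
  by (auto simp: h_pivots_def pivot_index_def h_index_def chart_lt[OF chart])

lemma card_h_pivots: "card (h_pivots K d \<sigma>) = card (h_index K d)"
  unfolding h_pivots_def by (rule card_image[OF inj_on_pivot_index])

lemma card_chart_free: "card (chart_free K N d \<sigma>) = 2 * (K * ((N - d) * d))"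
proof -
  have eq: "chart_free K N d \<sigma> = (SIGMA s:UNIV. SIGMA i:{..<K}. ({..<N} - (\<lambda>l. \<sigma> (s, i, l)) ` {..<d}) \<times> {..<d})"
    by (auto simp: chart_free_def)
  have "card ({..<N} - (\<lambda>l. \<sigma> (s, i, l)) ` {..<d}) = N - d" if "i < K" for s i
  proof -
    have "(\<lambda>l. \<sigma> (s, i, l)) ` {..<d} \<subseteq> {..<N}" using chart_lt[OF chart that] by auto
    moreover have "card ((\<lambda>l. \<sigma> (s, i, l)) ` {..<d}) = d"
      using chart that by (subst card_image) (auto simp: is_chart_def)
    ultimately show ?thesis by (subst card_Diff_subset) auto
  qed
  then show ?thesis unfolding eq by (simp add: card_SigmaI card_cartesian_product UNIV_bool)
qed

text \<open>In the equation \<open>(i, j, a, b)\<close> an entry of \<open>H\<close> in two pivot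
  positions is multiplied by entries of two identity blocks, so only the pivot entry belonging to
  \<open>a\<close> and \<open>b\<close> survives.\<close>

lemma align_eqn_chart:
  assumes q: "q \<in> h_index K d"
  shows "align_eqn N h (chart_point K N d \<sigma> w) q
    = h (pivot_index \<sigma> q) + align_eqn N (restr (- h_pivots K d \<sigma>) h) (chart_point K N d \<sigma> w) q"
proof -
  obtain i j a b where ij: "q = (i, j, a, b)" "i < K" "j < K" "i \<noteq> j" "a < d" "b < d"
    using q by (auto simp: h_index_def)
  let ?v = "\<lambda>k. chart_point K N d \<sigma> w (True, i, k, a)" and ?u = "\<lambda>k. chart_point K N d \<sigma> w (False, j, k, b)"
  let ?H = "\<lambda>k k'. h (i, j, k, k')" and ?H' = "\<lambda>k k'. restr (- h_pivots K d \<sigma>) h (i, j, k, k')"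
  let ?\<alpha> = "\<sigma> (True, i, a)" and ?\<beta> = "\<sigma> (False, j, b)"
  have entry: "?v k * (?H k k' - ?H' k k') * ?u k' = (if k = ?\<alpha> then if k' = ?\<beta> then ?H ?\<alpha> ?\<beta> else 0 else 0)" for k k'
  proof (cases "(i, j, k, k') \<in> h_pivots K d \<sigma>")
    case True
    then obtain a' b' where "a' < d" "b' < d" "k = \<sigma> (True, i, a')" "k' = \<sigma> (False, j, b')"
      by (auto simp: h_pivots_def pivot_index_def h_index_def)
    with True ij show ?thesis by (auto simp: restr_def chart_point_pivot[OF chart] chart_inj[OF chart])
  next
    case False
    moreover have "(i, j, ?\<alpha>, ?\<beta>) \<in> h_pivots K d \<sigma>"
      using q unfolding h_pivots_def ij(1) by (auto simp: pivot_index_def image_iff intro!: bexI[of _ "(i, j, a, b)"])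
    ultimately show ?thesis by (auto simp: restr_def)
  qed
  have "trilinear N ?v ?H ?u - trilinear N ?v ?H' ?u = (\<Sum>k<N. \<Sum>k'<N. ?v k * (?H k k' - ?H' k k') * ?u k')"
    by (simp add: trilinear_def sum_subtractf[symmetric] algebra_simps)
  also have "\<dots> = (\<Sum>k<N. if k = ?\<alpha> then (\<Sum>k'<N. if k' = ?\<beta> then ?H ?\<alpha> ?\<beta> else 0) else 0)"
    unfolding entry by (intro sum.cong) auto
  also have "\<dots> = ?H ?\<alpha> ?\<beta>" using ij chart_lt[OF chart] by simp
  finally show ?thesis by (simp add: ij(1) align_eqn_def pivot_index_def algebra_simps)
qed

lemma poly_fun_solve_pivots: "(\<lambda>z. solve_pivots K N d \<sigma> z v) \<in> poly_fun"
proof (cases v)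
  case (Inl j)
  then show ?thesis by (simp add: solve_pivots_def pvar)
next
  case (Inr q)
  have "(\<lambda>z. restr (- h_pivots K d \<sigma>) (\<lambda>q. z (Inr q)) q') \<in> poly_fun" for q'
    by (cases "q' \<in> h_pivots K d \<sigma>") (auto simp: restr_def intro: pvar pconst)
  moreover have "(\<lambda>z. chart_point K N d \<sigma> (\<lambda>j. z (Inl j)) j) \<in> poly_fun" for j
    by (rule poly_fun_subst[OF poly_fun_chart_point pvar])
  ultimately have "(\<lambda>z. align_eqn N (restr (- h_pivots K d \<sigma>) (\<lambda>q. z (Inr q)))
      (chart_point K N d \<sigma> (\<lambda>j. z (Inl j))) q') \<in> poly_fun" for q'
    by (rule poly_fun_align_eqn)
  from poly_fun_uminus[OF this] show ?thesis using Inr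
    by (cases "q \<in> h_pivots K d \<sigma>") (simp_all add: solve_pivots_def pvar)
qed

text \<open>Only the free chart coordinates and the non-pivot entries of \<open>h\<close> matter,
  which is the parameter count behind the dimension formula.\<close>

lemma solve_pivots_cong:
  assumes "\<And>j. j \<in> chart_free K N d \<sigma> \<Longrightarrow> z (Inl j) = z' (Inl j)"
    "\<And>q. q \<in> h_index K N - h_pivots K d \<sigma> \<Longrightarrow> z (Inr q) = z' (Inr q)"
    and v: "v \<in> Inl ` chart_free K N d \<sigma> \<union> Inr ` h_index K N"
  shows "solve_pivots K N d \<sigma> z v = solve_pivots K N d \<sigma> z' v"
proof (cases v)
  case (Inl j)
  then show ?thesis using assms by (auto simp: solve_pivots_def)
next
  case (Inr q)
  then have q: "q \<in> h_index K N" using v by auto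
  show ?thesis
  proof (cases "q \<in> h_pivots K d \<sigma>")
    case True
    then have inv: "inv_into (h_index K d) (pivot_index \<sigma>) q \<in> h_index K d"
      unfolding h_pivots_def by (rule inv_into_into)
    have "chart_point K N d \<sigma> (\<lambda>j. z (Inl j)) = chart_point K N d \<sigma> (\<lambda>j. z' (Inl j))"
      using assms(1) by (rule chart_point_cong)
    moreover have "align_eqn N (restr (- h_pivots K d \<sigma>) (\<lambda>q. z (Inr q))) x (inv_into (h_index K d) (pivot_index \<sigma>) q)
      = align_eqn N (restr (- h_pivots K d \<sigma>) (\<lambda>q. z' (Inr q))) x (inv_into (h_index K d) (pivot_index \<sigma>) q)" for x
      by (rule align_eqn_cong[OF _ inv]) (use assms(2) in \<open>auto simp: restr_def\<close>)
    ultimately show ?thesis using True by (simp add: solve_pivots_def Inr)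
  next
    case False
    then show ?thesis using Inr q assms(2) by (simp add: solve_pivots_def)
  qed
qed

lemma feasible_iff_solve_pivots:
  "feasible K N h (chart_strat K N d \<sigma> w) \<longleftrightarrow>
    (\<forall>q\<in>h_pivots K d \<sigma>. solve_pivots K N d \<sigma> (case_sum w h) (Inr q) = h q)"
proof -
  have "solve_pivots K N d \<sigma> (case_sum w h) (Inr (pivot_index \<sigma> q)) = h (pivot_index \<sigma> q)
      \<longleftrightarrow> align_eqn N h (chart_point K N d \<sigma> w) q = 0" if q: "q \<in> h_index K d" for q
  proof -
    have "pivot_index \<sigma> q \<in> h_pivots K d \<sigma>" using q by (simp add: h_pivots_def)
    then have "solve_pivots K N d \<sigma> (case_sum w h) (Inr (pivot_index \<sigma> q))
      = - align_eqn N (restr (- h_pivots K d \<sigma>) h) (chart_point K N d \<sigma> w) q"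
      using inv_into_f_f[OF inj_on_pivot_index q] by (simp add: solve_pivots_def)
    then show ?thesis unfolding align_eqn_chart[OF q, of h w] by (metis add.commute neg_eq_iff_add_eq_0)
  qed
  then show ?thesis unfolding feasible_strat_of h_pivots_def by auto
qed

text \<open>Feasible pairs are fixed by \<open>solve_pivots\<close>, so a polynomial that vanishes
  on its image vanishes at every feasible pair.\<close>

lemma solve_pivots_fixed:
  assumes "feasible K N h (chart_strat K N d \<sigma> w)"
  shows "solve_pivots K N d \<sigma> (case_sum w h) = case_sum w h"
proof
  fix v
  show "solve_pivots K N d \<sigma> (case_sum w h) v = case_sum w h v"
  proof (cases v)
    case (Inr q)
    then show ?thesis using assms unfolding feasible_iff_solve_pivots
      by (cases "q \<in> h_pivots K d \<sigma>") (auto simp: solve_pivots_def)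
  qed (simp add: solve_pivots_def)
qed

lemma slice_h:
  assumes "P \<in> poly_in (Inl ` S \<union> Inr ` B)"
  shows "(\<lambda>h. P (case_sum w h)) \<in> poly_in B"
proof (rule poly_inI)
  show "(\<lambda>h. P (case_sum w h)) \<in> poly_fun"
  proof (rule poly_fun_subst[OF poly_inD(1)[OF assms]])
    show "(\<lambda>x. case_sum w x i) \<in> poly_fun" for i by (cases i) (auto intro: pvar pconst)
  qed
  show "P (case_sum w x) = P (case_sum w y)" if "\<And>i. i \<in> B \<Longrightarrow> x i = y i" for x y
    by (rule poly_inD(2)[OF assms]) (use that in auto)
qed

lemma slice_w:
  assumes "P \<in> poly_in (Inl ` S \<union> Inr ` B)"
  shows "(\<lambda>w. P (case_sum w h)) \<in> poly_in S"
proof (rule poly_inI)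
  show "(\<lambda>w. P (case_sum w h)) \<in> poly_fun"
  proof (rule poly_fun_subst[OF poly_inD(1)[OF assms]])
    show "(\<lambda>x. case_sum x h i) \<in> poly_fun" for i by (cases i) (auto intro: pvar pconst)
  qed
  show "P (case_sum x h) = P (case_sum y h)" if "\<And>i. i \<in> S \<Longrightarrow> x i = y i" for x y
    by (rule poly_inD(2)[OF assms]) (use that in auto)
qed

text \<open>The incidence variety is parametrised by fewer variables than there are functions in
  \<open>S\<close> and entries of \<open>h\<close>, so \<open>algebraic_dependence\<close> yields a
  relation \<open>P\<close>. Slicing it at a suitable \<open>w0\<close> gives the condition on
  \<open>h\<close>, slicing it at \<open>h\<close> the relation on the fibre.\<close>

lemma generic_dependence:
  assumes S: "S \<subseteq> chart_free K N d \<sigma>" and card: "card (chart_free K N d \<sigma>) < card S + card (h_index K d)"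
  shows "\<exists>p\<in>poly_in (h_index K N). p \<noteq> 0 \<and> (\<forall>h. p h \<noteq> 0 \<longrightarrow>
    (\<exists>q\<in>poly_in S. q \<noteq> 0 \<and> (\<forall>w. feasible K N h (chart_strat K N d \<sigma> w) \<longrightarrow> q w = 0)))"
proof -
  let ?T = "chart_free K N d \<sigma>" let ?Q = "h_pivots K d \<sigma>" let ?H = "h_index K N"
  let ?A = "Inl ` ?T \<union> Inr ` (?H - ?Q)" let ?B = "Inl ` S \<union> Inr ` ?H"
  have fin: "finite ?T" "finite ?H" "finite S" "finite ?Q"
    using finite_chart_free finite_h_index finite_subset[OF S finite_chart_free] finite_subset[OF h_pivots_subset finite_h_index] by auto
  have "card ?A = card ?T + (card ?H - card ?Q)" using fin h_pivots_subset
    by (subst card_Un_disjoint) (auto simp: card_image card_Diff_subset)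
  moreover have "card ?B = card S + card ?H" using fin by (subst card_Un_disjoint) (auto simp: card_image)
  moreover have "card ?Q \<le> card ?H" using card_mono[OF fin(2) h_pivots_subset] .
  ultimately have less: "card ?A < card ?B" using card card_h_pivots by linarith
  have "(\<lambda>z. solve_pivots K N d \<sigma> z v) \<in> poly_in ?A" if "v \<in> ?B" for v
    by (rule poly_inI[OF poly_fun_solve_pivots], rule solve_pivots_cong) (use that S in auto)
  then have "\<exists>P\<in>poly_in ?B. P \<noteq> 0 \<and> (\<forall>z. P (\<lambda>v. solve_pivots K N d \<sigma> z v) = 0)"
    using fin by (intro algebraic_dependence[OF _ _ less]) auto
  then obtain P where P: "P \<in> poly_in ?B" "P \<noteq> 0" "\<And>z. P (solve_pivots K N d \<sigma> z) = 0" by blast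
  then obtain z0 where z0: "P z0 \<noteq> 0" by (auto simp: fun_eq_iff)
  define w0 where "w0 j = z0 (Inl j)" for j
  define h0 where "h0 q = z0 (Inr q)" for q
  have z0': "z0 = case_sum w0 h0" by (auto simp: fun_eq_iff w0_def h0_def split: sum.split)
  show ?thesis
  \<comment> \<open>If \<open>P\<close> is nonzero at \<open>(w0, h)\<close>, then \<open>w0\<close>
    shows that the slice of \<open>P\<close> at this \<open>h\<close> is a nonzero
    polynomial.\<close>
  proof (intro bexI[OF _ slice_h[OF P(1), of w0]] conjI allI impI)
    show "(\<lambda>h. P (case_sum w0 h)) \<noteq> 0" using z0 z0' by (metis zero_fun_apply)
    fix h assume h: "P (case_sum w0 h) \<noteq> 0"
    show "\<exists>q\<in>poly_in S. q \<noteq> 0 \<and> (\<forall>w. feasible K N h (chart_strat K N d \<sigma> w) \<longrightarrow> q w = 0)"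
    proof (intro bexI[OF _ slice_w[OF P(1), of h]] conjI allI impI)
      show "(\<lambda>w. P (case_sum w h)) \<noteq> 0" using h by (metis zero_fun_apply)
      fix w assume "feasible K N h (chart_strat K N d \<sigma> w)"
      from solve_pivots_fixed[OF this] P(3)[of "case_sum w h"] show "P (case_sum w h) = 0" by simp
    qed
  qed
qed

text \<open>The hypothesis says that the ideal of the incidence variety contains no nonzero
  polynomial in \<open>S\<close> and \<open>h\<close>, so \<open>extend_point\<close> lifts every
  pair \<open>(y, h)\<close> off a hypersurface to a zero of that ideal, and such a zero is a
  feasible pair.\<close>

lemma generic_fibre_projection:
  assumes S: "S \<subseteq> chart_free K N d \<sigma>"
    and ind: "\<And>P. P \<in> poly_in (Inl ` S \<union> Inr ` h_index K N) \<Longrightarrow> (\<And>z. P (solve_pivots K N d \<sigma> z) = 0) \<Longrightarrow> P = 0"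
  shows "\<exists>p\<in>poly_in (h_index K N). p \<noteq> 0 \<and> (\<forall>h. p h \<noteq> 0 \<longrightarrow>
    (\<exists>b\<in>poly_in S. b \<noteq> 0 \<and> (\<forall>y. b y \<noteq> 0 \<longrightarrow>
       (\<exists>w. (\<forall>i\<in>S. w i = y i) \<and> feasible K N h (chart_strat K N d \<sigma> w)))))"
proof -
  let ?T = "chart_free K N d \<sigma>" let ?H = "h_index K N" let ?Q = "h_pivots K d \<sigma>"
  let ?V = "Inl ` ?T \<union> Inr ` ?H" let ?B = "Inl ` S \<union> Inr ` ?H"
  let ?\<psi> = "solve_pivots K N d \<sigma>"
  define J where "J = {p \<in> poly_in ?V. \<forall>z. p (?\<psi> z) = 0}"
  have J: "prime_in (poly_in ?V) J" unfolding J_def by (rule prime_in_vanishing[OF poly_fun_solve_pivots])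
  note R = is_subring_poly_in[of ?V]
  have V: "finite ?V" "?B \<subseteq> ?V" using finite_chart_free finite_h_index S by auto
  have JB: "J \<inter> poly_in ?B \<subseteq> {0}" using ind by (auto simp: J_def)
  obtain b where b: "b \<in> poly_in ?B" "b \<notin> J"
    and e: "\<And>y. b y \<noteq> 0 \<Longrightarrow> (\<forall>p\<in>J \<inter> poly_in ?B. p y = 0) \<Longrightarrow>
      \<exists>z. (\<forall>i\<in>?B. z i = y i) \<and> (\<forall>p\<in>J. p z = 0) \<and> 1 z \<noteq> (0::complex)"
    by (rule extend_point[OF V J is_subringD(2)[OF R] prime_inD(3)[OF J R]]) blast
  have ext: "\<exists>w. (\<forall>i\<in>S. w i = y i) \<and> feasible K N h (chart_strat K N d \<sigma> w)"
    if "b (case_sum y h) \<noteq> 0" for y h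
  proof -
    have "\<forall>p\<in>J \<inter> poly_in ?B. p (case_sum y h) = 0"
    proof
      fix p assume "p \<in> J \<inter> poly_in ?B"
      then have "p = 0" using JB by blast
      then show "p (case_sum y h) = 0" by simp
    qed
    from e[OF that this] obtain z where z: "\<forall>i\<in>?B. z i = case_sum y h i" "\<forall>p\<in>J. p z = 0" by blast
    define w where "w j = z (Inl j)" for j
    have zh: "z (Inr q) = h q" if "q \<in> ?H" for q using z(1) that by auto
    have "feasible K N h (chart_strat K N d \<sigma> w)"
      unfolding feasible_iff_solve_pivots
    proof
      fix q assume q: "q \<in> ?Q"
      then have qH: "q \<in> ?H" using h_pivots_subset by blast
      \<comment> \<open>Idempotence of \<open>solve_pivots\<close> puts these differences into
        \<open>J\<close>; they are the equations of the graph, and their vanishing at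
        \<open>z\<close> is feasibility.\<close>
      define p where "p = (\<lambda>z. z (Inr q) - ?\<psi> z (Inr q))"
      have idem: "?\<psi> (?\<psi> z) (Inr q) = ?\<psi> z (Inr q)" for z
        by (rule solve_pivots_cong) (use qH in \<open>auto simp: solve_pivots_def\<close>)
      have "p \<in> poly_in ?V"
      proof (rule poly_inI)
        show "p \<in> poly_fun" unfolding p_def by (intro poly_fun_diff pvar poly_fun_solve_pivots)
        fix x y :: "strat_index + chan_index \<Rightarrow> complex"
        assume xy: "\<And>i. i \<in> ?V \<Longrightarrow> x i = y i"
        have "?\<psi> x (Inr q) = ?\<psi> y (Inr q)" by (rule solve_pivots_cong) (use xy qH in auto)
        then show "p x = p y" using xy[of "Inr q"] qH by (simp add: p_def)
      qed
      then have "p \<in> J" by (simp add: J_def p_def idem)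
      then have "?\<psi> z (Inr q) = z (Inr q)" using z(2) by (auto simp: p_def)
      moreover have "?\<psi> (case_sum w h) (Inr q) = ?\<psi> z (Inr q)"
        by (rule solve_pivots_cong) (use qH zh in \<open>auto simp: w_def\<close>)
      ultimately show "?\<psi> (case_sum w h) (Inr q) = h q" using zh[OF qH] by simp
    qed
    moreover have "\<forall>i\<in>S. w i = y i" using z(1) by (auto simp: w_def)
    ultimately show ?thesis by blast
  qed
  have "b \<noteq> 0" using b prime_inD(2)[OF J R] by auto
  then obtain z0 where z0: "b z0 \<noteq> 0" by (auto simp: fun_eq_iff)
  define w0 where "w0 j = z0 (Inl j)" for j
  define h0 where "h0 q = z0 (Inr q)" for q
  have z0': "z0 = case_sum w0 h0" by (auto simp: fun_eq_iff w0_def h0_def split: sum.split)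
  show ?thesis
  proof (intro bexI[OF _ slice_h[OF b(1), of w0]] conjI allI impI)
    show "(\<lambda>h. b (case_sum w0 h)) \<noteq> 0" using z0 z0' by (metis zero_fun_apply)
    fix h assume h: "b (case_sum w0 h) \<noteq> 0"
    have "(\<lambda>w. b (case_sum w h)) \<noteq> 0" using h by (metis zero_fun_apply)
    then show "\<exists>b\<in>poly_in S. b \<noteq> 0 \<and> (\<forall>y. b y \<noteq> 0 \<longrightarrow>
       (\<exists>w. (\<forall>i\<in>S. w i = y i) \<and> feasible K N h (chart_strat K N d \<sigma> w)))"
      by (intro bexI[OF _ slice_w[OF b(1), of h]] conjI allI impI ext)
  qed
qed

end

section \<open>Generic conditions on the channels, the chart with leading identity blocks\<close>

lemma generic_finite:
  assumes "finite I" "\<And>i. i \<in> I \<Longrightarrow> \<exists>p\<in>poly_in V. p \<noteq> 0 \<and> (\<forall>h. p h \<noteq> 0 \<longrightarrow> Q i h)"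
  shows "\<exists>p\<in>poly_in V. p \<noteq> 0 \<and> (\<forall>h. p h \<noteq> 0 \<longrightarrow> (\<forall>i\<in>I. Q i h))"
  using assms
proof (induction I rule: finite_induct)
  case empty
  show ?case by (rule bexI[OF _ is_subringD(2)[OF is_subring_poly_in]]) (auto simp: fun_eq_iff)
next
  case (insert i I)
  obtain p where p: "p \<in> poly_in V" "p \<noteq> 0" "\<forall>h. p h \<noteq> 0 \<longrightarrow> Q i h" using insert.prems by blast
  obtain q where q: "q \<in> poly_in V" "q \<noteq> 0" "\<forall>h. q h \<noteq> 0 \<longrightarrow> (\<forall>i\<in>I. Q i h)"
    using insert.IH insert.prems by blast
  have "p * q \<noteq> 0" using poly_fun_mult_eq_0[OF poly_inD(1)[OF p(1)] poly_inD(1)[OF q(1)]] p(2) q(2) by blast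
  moreover have "\<forall>h. (p * q) h \<noteq> 0 \<longrightarrow> (\<forall>i\<in>insert i I. Q i h)" using p(3) q(3) by auto
  ultimately show ?case using is_subringD(4)[OF is_subring_poly_in p(1) q(1)] by blast
qed

lemma generic_from_poly:
  assumes p: "p \<in> poly_in (h_index K N)" "p \<noteq> 0" and Q: "\<And>h. p h \<noteq> 0 \<Longrightarrow> Q h"
  shows "generic K N Q"
proof -
  obtain h0 where h0: "p h0 \<noteq> 0" using p(2) by (auto simp: fun_eq_iff)
  let ?W = "{h \<in> Hspace K N. p h \<noteq> 0}"
  \<comment> \<open>The witness \<open>h0\<close> may have nonzero coordinates outside
    \<open>Hspace\<close>; truncation does not change \<open>p\<close>.\<close>
  have "restr (h_index K N) h0 \<in> ?W" using h0 poly_in_restr[OF p(1), of h0]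
    by (auto simp: Hspace_def restr_def h_index_def split: if_splits)
  moreover have "Hspace K N - ?W = Hspace K N \<inter> zero_set {p}" by (auto simp: zero_set_def)
  then have "zariski_open_in (Hspace K N) ?W"
    using poly_inD(1)[OF p(1)] unfolding zariski_open_in_def zariski_closed_in_def by blast
  ultimately show ?thesis unfolding generic_def using Q by (intro exI[of _ ?W]) auto
qed

definition std_chart :: "nat \<Rightarrow> nat \<Rightarrow> bool \<times> nat \<times> nat \<Rightarrow> nat" where
  "std_chart K d = restrict (\<lambda>(s, i, l). l) (UNIV \<times> {..<K} \<times> {..<d})"

lemma std_chart: "i < K \<Longrightarrow> l < d \<Longrightarrow> std_chart K d (s, i, l) = l"
  by (simp add: std_chart_def)

lemma is_chart_std: "d \<le> N \<Longrightarrow> is_chart K N d (std_chart K d)"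
  by (auto simp: is_chart_def std_chart_def inj_on_def)

lemma chart_free_std: "chart_free K N d (std_chart K d) = {(s, i, k, l). i < K \<and> d \<le> k \<and> k < N \<and> l < d}"
proof -
  have "(\<forall>l'<d. std_chart K d (s, i, l') \<noteq> k) \<longleftrightarrow> d \<le> k" if "i < K" for s i k
    using std_chart[OF that] by (metis leD leI)
  then show ?thesis by (auto simp: chart_free_def)
qed

lemma trilinear_expand:
  "trilinear N (\<lambda>k. v k + s * v' k) (\<lambda>k k'. H k k' + s * H' k k') (\<lambda>k. u k + s * u' k)
    = trilinear N v H u + s * (trilinear N v' H u + trilinear N v H' u + trilinear N v H u')
      + s ^ 2 * (trilinear N v' H' u + trilinear N v' H u' + trilinear N v H' u')
      + s ^ 3 * trilinear N v' H' u'"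
  unfolding trilinear_def
  by (simp add: sum_distrib_left sum.distrib[symmetric] algebra_simps power2_eq_square power3_eq_cube)

lemma trilinear_unit_left:
  "a < N \<Longrightarrow> trilinear N (\<lambda>k. if k = a then 1 else 0) H u = (\<Sum>k<N. H a k * u k)"
proof -
  assume a: "a < N"
  have "trilinear N (\<lambda>k. if k = a then 1 else 0) H u = (\<Sum>k<N. if k = a then (\<Sum>k'<N. H a k' * u k') else 0)"
    unfolding trilinear_def by (intro sum.cong) auto
  then show ?thesis using a by simp
qed

lemma trilinear_unit_right:
  "b < N \<Longrightarrow> trilinear N v H (\<lambda>k. if k = b then 1 else 0) = (\<Sum>k<N. v k * H k b)"
  unfolding trilinear_def by (intro sum.cong) (auto simp: if_distrib cong: if_cong)

section \<open>The standard chart\<close>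

lemma std_chart_pivots:
  assumes "q \<in> h_index K d"
  shows "pivot_index (std_chart K d) q = q"
  using assms by (auto simp: h_index_def pivot_index_def std_chart)

lemma h_pivots_std: "h_pivots K d (std_chart K d) = h_index K d"
  using std_chart_pivots by (force simp: h_pivots_def image_iff)

lemma inv_pivot_std:
  assumes "d \<le> N" "q \<in> h_index K d"
  shows "inv_into (h_index K d) (pivot_index (std_chart K d)) q = q"
  using inv_into_f_f[OF inj_on_pivot_index[OF is_chart_std[OF assms(1)]] assms(2)] std_chart_pivots[OF assms(2)]
  by simp

lemma trilinear_units:
  assumes "a < N" "b < N"
  shows "trilinear N (\<lambda>k. if k = a then 1 else 0) H (\<lambda>k. if k = b then 1 else 0) = H a b"
proof -
  have "(\<Sum>k<N. H a k * (if k = b then 1 else 0)) = (\<Sum>k<N. if k = b then H a k else 0)"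
    by (intro sum.cong) auto
  then show ?thesis using assms by (simp add: trilinear_unit_left)
qed

lemma offset_mod:
  fixes i j K :: nat
  assumes "i < K" "j < K" "i \<noteq> j"
  defines "\<delta> \<equiv> (j + K - i) mod K"
  shows "1 \<le> \<delta>" "\<delta> < K" "(i + \<delta>) mod K = j"
proof -
  show "\<delta> < K" using assms by simp
  have "\<delta> = (if i < j then j - i else j + K - i)"
  proof (cases "i < j")
    case True
    then have "j + K - i = (j - i) + K" by simp
    then have "\<delta> = (j - i) mod K" unfolding \<delta>_def by simp
    then show ?thesis using True assms(2) by simp
  qed (use assms in \<open>simp add: \<delta>_def\<close>)
  then show "1 \<le> \<delta>" "(i + \<delta>) mod K = j" using assms(1-3) by auto
qed

text \<open>Independence is checked at first order at the point with chart coordinates 0 and channel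
  \<open>g\<close>. There the equations linearise to the system of \<open>alignment_design\<close>,
  so the coordinates \<open>S\<close> and all entries of \<open>h\<close> can be moved in any
  direction along the image of \<open>solve_pivots\<close>, and
  \<open>zero_on_curves_in_all_directions\<close> applies.\<close>

lemma std_chart_independent:
  assumes K: "K \<ge> 3" and d: "d \<ge> 1" and dN: "d \<le> N" and r: "(K - 1) * d \<le> 2 * (N - d)"
    and card: "card (h_index K d) \<le> card (chart_free K N d (std_chart K d))"
  shows "\<exists>S\<subseteq>chart_free K N d (std_chart K d).
    card S = card (chart_free K N d (std_chart K d)) - card (h_index K d) \<and>
    (\<forall>P\<in>poly_in (Inl ` S \<union> Inr ` h_index K N). (\<forall>z. P (solve_pivots K N d (std_chart K d) z) = 0) \<longrightarrow> P = 0)"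
proof -
  let ?\<sigma> = "std_chart K d"
  let ?T = "chart_free K N d ?\<sigma>" let ?Q = "h_index K d" let ?H = "h_index K N"
  define r where "r = N - d"
  define \<delta> where "\<delta> i j = (j + K - i) mod K" for i j
  note \<delta> = offset_mod[where K=K, folded \<delta>_def]
  note T = chart_free_std[of K N d]
  obtain \<gamma> \<beta> where design: "\<And>Z :: nat \<Rightarrow> nat \<Rightarrow> nat \<Rightarrow> nat \<Rightarrow> complex. \<exists>Y X. \<forall>i<K. \<forall>\<delta>. 1 \<le> \<delta> \<longrightarrow> \<delta> < K \<longrightarrow> (\<forall>a<d. \<forall>b<d.
    (if \<gamma> \<delta> b < r then Y i a (\<gamma> \<delta> b) else 0) + (if \<beta> \<delta> a < r then X ((i + \<delta>) mod K) (\<beta> \<delta> a) b else 0)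
      = Z i \<delta> a b)"
    using alignment_design[OF K d r[folded r_def]] by (elim exE) (rule that, elim allE)
  \<comment> \<open>\<open>Inl\<close> rows are the linearised equations, \<open>Inr\<close> rows
    the single chart coordinates.\<close>
  define rows :: "chan_index + strat_index \<Rightarrow> strat_index \<Rightarrow> complex" where
    "rows = case_sum (\<lambda>(i, j, a, b) t.
        (if t = (True, i, d + \<gamma> (\<delta> i j) b, a) then (if \<gamma> (\<delta> i j) b < r then 1 else 0) else 0) +
        (if t = (False, j, d + \<beta> (\<delta> i j) a, b) then (if \<beta> (\<delta> i j) a < r then 1 else 0) else 0))
      (\<lambda>j t. if t = j then 1 else 0)"
  have finT: "finite ?T" by (rule finite_chart_free)
  define L where "L w = (\<lambda>(i, j, a, b). (if \<gamma> (\<delta> i j) b < r then w (True, i, d + \<gamma> (\<delta> i j) b, a) else 0) +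
        (if \<beta> (\<delta> i j) a < r then w (False, j, d + \<beta> (\<delta> i j) a, b) else (0::complex)))"
    for w :: "strat_index \<Rightarrow> complex"
  have rows_Inl: "(\<Sum>t\<in>?T. rows (Inl q) t * w t) = L w q" if q: "q \<in> ?Q" for q w
  proof -
    obtain i j a b where ij: "q = (i, j, a, b)" "i < K" "j < K" "a < d" "b < d"
      using q by (auto simp: h_index_def)
    let ?t1 = "(True, i, d + \<gamma> (\<delta> i j) b, a)" and ?t2 = "(False, j, d + \<beta> (\<delta> i j) a, b)"
    have "(\<Sum>t\<in>?T. rows (Inl q) t * w t) = (\<Sum>t\<in>?T. if t = ?t1 then (if \<gamma> (\<delta> i j) b < r then w ?t1 else 0) else 0)
      + (\<Sum>t\<in>?T. if t = ?t2 then (if \<beta> (\<delta> i j) a < r then w ?t2 else 0) else 0)"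
      unfolding sum.distrib[symmetric] by (intro sum.cong) (auto simp: rows_def ij(1))
    also have "\<dots> = L w q" using ij(2-) finT by (auto simp: L_def ij(1) T r_def)
    finally show ?thesis .
  qed
  have rows_Inr: "(\<Sum>t\<in>?T. rows (Inr j) t * w t) = w j" if "j \<in> ?T" for j w
  proof -
    have "(\<Sum>t\<in>?T. rows (Inr j) t * w t) = (\<Sum>t\<in>?T. if t = j then w j else 0)"
      by (intro sum.cong) (auto simp: rows_def)
    then show ?thesis using that finT by simp
  qed
  have solv: "solvable_rows rows ?T (Inl ` ?Q)" unfolding solvable_rows_def
  proof
    fix z :: "chan_index + strat_index \<Rightarrow> complex"
    obtain Y X where YX: "\<forall>i<K. \<forall>\<delta>. 1 \<le> \<delta> \<longrightarrow> \<delta> < K \<longrightarrow> (\<forall>a<d. \<forall>b<d.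
      (if \<gamma> \<delta> b < r then Y i a (\<gamma> \<delta> b) else 0) + (if \<beta> \<delta> a < r then X ((i + \<delta>) mod K) (\<beta> \<delta> a) b else 0)
        = z (Inl (i, (i + \<delta>) mod K, a, b)))"
      using design[of "\<lambda>i \<delta> a b. z (Inl (i, (i + \<delta>) mod K, a, b))"] by blast
    define w where "w = (\<lambda>(s, i, k, l). if s then Y i l (k - d) else X i (k - d) l)"
    have "L w q = z (Inl q)" if q: "q \<in> ?Q" for q
    proof -
      obtain i j a b where ij: "q = (i, j, a, b)" "i < K" "j < K" "i \<noteq> j" "a < d" "b < d"
        using q by (auto simp: h_index_def)
      note \<delta>' = \<delta>[OF ij(2-4)]
      show ?thesis using YX[rule_format, OF ij(2) \<delta>'(1,2) ij(5,6)] unfolding \<delta>'(3)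
        by (simp add: L_def w_def ij(1) split: if_splits)
    qed
    then have "\<forall>i\<in>Inl ` ?Q. (\<Sum>t\<in>?T. rows i t * w t) = z i" using rows_Inl by auto
    then show "\<exists>v. \<forall>i\<in>Inl ` ?Q. (\<Sum>t\<in>?T. rows i t * v t) = z i" by (rule exI[of _ w])
  qed
  \<comment> \<open>The independent equation rows are completed to a square system by coordinate
    rows; the coordinates added form \<open>S\<close>, which explains its cardinality.\<close>
  have "\<exists>R. Inl ` ?Q \<subseteq> R \<and> R \<subseteq> Inl ` ?Q \<union> Inr ` ?T \<and> finite R \<and> card R = card ?T \<and> solvable_rows rows ?T R"
  proof (rule extend_solvable_rows[OF finT])
    show "\<forall>t\<in>?T. v t = 0" if "\<forall>i\<in>Inl ` ?Q \<union> Inr ` ?T. (\<Sum>t\<in>?T. rows i t * v t) = 0" for v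
    proof
      fix t assume t: "t \<in> ?T"
      then have "(\<Sum>t'\<in>?T. rows (Inr t) t' * v t') = 0" using that by blast
      then show "v t = 0" using rows_Inr[OF t] by simp
    qed
    show "card (Inl ` ?Q) \<le> card ?T" using card by (simp add: card_image)
  qed (use finite_h_index solv in auto)
  then obtain R where R: "Inl ` ?Q \<subseteq> R" "R \<subseteq> Inl ` ?Q \<union> Inr ` ?T" "finite R" "card R = card ?T" "solvable_rows rows ?T R"
    by blast
  define S where "S = {t \<in> ?T. Inr t \<in> R}"
  have ST: "S \<subseteq> ?T" by (auto simp: S_def)
  have "R = Inl ` ?Q \<union> Inr ` S" using R(1,2) by (auto simp: S_def)
  moreover have "card (Inl ` ?Q \<union> Inr ` S :: (chan_index + strat_index) set) = card ?Q + card S"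
    using finite_h_index finite_subset[OF ST finT] by (subst card_Un_disjoint) (auto simp: card_image)
  ultimately have cardS: "card S = card ?T - card ?Q" using R(4) by simp
  have "P = 0" if P: "P \<in> poly_in (Inl ` S \<union> Inr ` ?H)" and van: "\<And>z. P (solve_pivots K N d ?\<sigma> z) = 0" for P
  proof -
    \<comment> \<open>In block form with pivots first, the lower left block of \<open>H_ij\<close>
      has unit vectors \<open>\<gamma>\<close> as columns and the upper right block unit vectors
      \<open>\<beta>\<close> as rows. The other two blocks are 0, so \<open>g\<close> is feasible at
      chart coordinates 0.\<close>
    define g :: "chan_index \<Rightarrow> complex" where "g = (\<lambda>(i, j, k, k').
      if d \<le> k \<and> k' < d then (if k = d + \<gamma> (\<delta> i j) k' \<and> \<gamma> (\<delta> i j) k' < r then 1 else 0)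
      else if k < d \<and> d \<le> k' then (if k' = d + \<beta> (\<delta> i j) k \<and> \<beta> (\<delta> i j) k < r then 1 else 0) else 0)"
    have gQ: "g q = 0" if "q \<in> ?Q" for q using that by (auto simp: g_def h_index_def)
    show "P = 0"
    proof (rule zero_on_curves_in_all_directions[OF poly_inD(1)[OF P], of "case_sum (\<lambda>_. 0) g"])
      fix v :: "strat_index + chan_index \<Rightarrow> complex"
      \<comment> \<open>The velocity of the chart coordinates. The sign is negative because a pivot
        entry equals minus the rest of its equation, so it moves with velocity
        \<open>v\<close>.\<close>
      obtain w where w: "\<forall>i\<in>R. (\<Sum>t\<in>?T. rows i t * w t) = case_sum (\<lambda>q. - v (Inr q)) (\<lambda>j. v (Inl j)) i"
        using R(5) unfolding solvable_rows_def by blast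
      have wS: "w j = v (Inl j)" if "j \<in> S" for j
        using w rows_Inr[of j w] that by (auto simp: S_def)
      have Lw: "L w q = - v (Inr q)" if "q \<in> ?Q" for q
        using w rows_Inl[OF that, of w] R(1) that by auto
      define y where "y j = (if j \<in> ?T then w j else 0)" for j
      define u where "u q = (if q \<in> ?Q then 0 else v (Inr q))" for q
      define e where "e a k = (if k = a then 1 else (0::complex))" for a k :: nat
      define c2 where "c2 = (\<lambda>(i, j, a, b).
        trilinear N (\<lambda>k. y (True, i, k, a)) (\<lambda>k k'. u (i, j, k, k')) (e b) +
        trilinear N (\<lambda>k. y (True, i, k, a)) (\<lambda>k k'. g (i, j, k, k')) (\<lambda>k. y (False, j, k, b)) +
        trilinear N (e a) (\<lambda>k k'. u (i, j, k, k')) (\<lambda>k. y (False, j, k, b)))"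
      define c3 where "c3 = (\<lambda>(i, j, a, b).
        trilinear N (\<lambda>k. y (True, i, k, a)) (\<lambda>k k'. u (i, j, k, k')) (\<lambda>k. y (False, j, k, b)))"
      define z where "z s = case_sum (\<lambda>j. s * w j) (\<lambda>q. g q + s * v (Inr q))" for s
      have eqn: "align_eqn N (restr (- ?Q) (\<lambda>q. z s (Inr q))) (chart_point K N d ?\<sigma> (\<lambda>j. z s (Inl j))) q
        = - s * v (Inr q) + s ^ 2 * c2 q + s ^ 3 * c3 q" if q: "q \<in> ?Q" for q s
      proof -
        obtain i j a b where ij: "q = (i, j, a, b)" "i < K" "j < K" "i \<noteq> j" "a < d" "b < d"
          using q by (auto simp: h_index_def)
        have aN: "a < N" "b < N" using ij dN by auto
        have pt: "chart_point K N d ?\<sigma> (\<lambda>j. z s (Inl j)) (s', i', k, l) = e l k + s * y (s', i', k, l)"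
          if "i' < K" "k < N" "l < d" for s' i' k l
          using that by (auto simp: chart_point_def z_def e_def y_def T std_chart)
        have rs: "restr (- ?Q) (\<lambda>q. z s (Inr q)) q' = g q' + s * u q'" for q'
          using gQ by (auto simp: restr_def z_def u_def)
        have "align_eqn N (restr (- ?Q) (\<lambda>q. z s (Inr q))) (chart_point K N d ?\<sigma> (\<lambda>j. z s (Inl j))) q
          = trilinear N (\<lambda>k. e a k + s * y (True, i, k, a)) (\<lambda>k k'. g (i, j, k, k') + s * u (i, j, k, k'))
              (\<lambda>k. e b k + s * y (False, j, k, b))"
          unfolding align_eqn_def ij(1) prod.case
          by (rule trilinear_cong) (use pt rs ij in auto)
        moreover have "trilinear N (e a) (\<lambda>k k'. g (i, j, k, k')) (e b) = 0"
          using gQ[OF q] by (simp add: e_def[abs_def] trilinear_units[OF aN] ij(1))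
        moreover have "trilinear N (e a) (\<lambda>k k'. u (i, j, k, k')) (e b) = 0"
          using q by (simp add: e_def[abs_def] trilinear_units[OF aN] u_def ij(1))
        moreover have "trilinear N (\<lambda>k. y (True, i, k, a)) (\<lambda>k k'. g (i, j, k, k')) (e b)
          = (if \<gamma> (\<delta> i j) b < r then w (True, i, d + \<gamma> (\<delta> i j) b, a) else 0)"
        proof -
          have "trilinear N (\<lambda>k. y (True, i, k, a)) (\<lambda>k k'. g (i, j, k, k')) (e b)
            = (\<Sum>k<N. y (True, i, k, a) * g (i, j, k, b))"
            using trilinear_unit_right[OF aN(2)] by (simp add: e_def[abs_def])
          also have "\<dots> = (\<Sum>k<N. if k = d + \<gamma> (\<delta> i j) b then
              (if \<gamma> (\<delta> i j) b < r then w (True, i, d + \<gamma> (\<delta> i j) b, a) else 0) else 0)"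
            using ij by (intro sum.cong) (auto simp: y_def T g_def)
          finally show ?thesis by (auto simp: r_def)
        qed
        moreover have "trilinear N (e a) (\<lambda>k k'. g (i, j, k, k')) (\<lambda>k. y (False, j, k, b))
          = (if \<beta> (\<delta> i j) a < r then w (False, j, d + \<beta> (\<delta> i j) a, b) else 0)"
        proof -
          have "trilinear N (e a) (\<lambda>k k'. g (i, j, k, k')) (\<lambda>k. y (False, j, k, b))
            = (\<Sum>k<N. g (i, j, a, k) * y (False, j, k, b))"
            using trilinear_unit_left[OF aN(1)] by (simp add: e_def[abs_def])
          also have "\<dots> = (\<Sum>k<N. if k = d + \<beta> (\<delta> i j) a then
              (if \<beta> (\<delta> i j) a < r then w (False, j, d + \<beta> (\<delta> i j) a, b) else 0) else 0)"
            using ij by (intro sum.cong) (auto simp: y_def T g_def)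
          finally show ?thesis by (auto simp: r_def)
        qed
        ultimately show ?thesis using Lw[OF q] unfolding trilinear_expand
          by (simp add: L_def ij(1) c2_def c3_def)
      qed
      \<comment> \<open>Terms of order 2 and 3 in \<open>s\<close> occur only in the pivot entries
        and form the remainder of the curve.\<close>
      define A where "A = case_sum (\<lambda>_::strat_index. 0) (\<lambda>q. if q \<in> ?Q then - [:c2 q, c3 q:] else (0 :: complex poly))"
      have "P (\<lambda>i. case_sum (\<lambda>_. 0) g i + s * (v i + s * poly (A i) s)) = 0" for s
      proof -
        have "P (\<lambda>i. case_sum (\<lambda>_. 0) g i + s * (v i + s * poly (A i) s)) = P (solve_pivots K N d ?\<sigma> (z s))"
        proof (rule poly_inD(2)[OF P])
          fix i :: "strat_index + chan_index"
          assume i: "i \<in> Inl ` S \<union> Inr ` ?H"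
          show "case_sum (\<lambda>_. 0) g i + s * (v i + s * poly (A i) s) = solve_pivots K N d ?\<sigma> (z s) i"
          proof (cases i)
            case (Inl j)
            then have "j \<in> S" using i by auto
            then show ?thesis using wS Inl by (simp add: solve_pivots_def z_def A_def)
          next
            case (Inr q)
            show ?thesis
            proof (cases "q \<in> ?Q")
              case True
              then have "solve_pivots K N d ?\<sigma> (z s) i = s * v (Inr q) - s ^ 2 * c2 q - s ^ 3 * c3 q"
                using eqn[OF True, of s] inv_pivot_std[OF dN True] Inr
                by (simp add: solve_pivots_def h_pivots_std)
              then show ?thesis using True gQ[OF True] Inr
                by (simp add: A_def power2_eq_square power3_eq_cube algebra_simps)
            next
              case False
              then show ?thesis using Inr by (simp add: solve_pivots_def h_pivots_std z_def A_def)
            qed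
          qed
        qed
        then show ?thesis using van by simp
      qed
      then show "\<exists>A. \<forall>s. P (\<lambda>i. case_sum (\<lambda>_. 0) g i + s * (v i + s * poly (A i) s)) = 0" by blast
    qed
  qed
  then show ?thesis using ST cardS by blast
qed

section \<open>Lower bound on a fibre and conclusion\<close>

lemma irred_chain_of_dominant_fibre:
  assumes chart: "is_chart K N d \<sigma>" and S: "S \<subseteq> chart_free K N d \<sigma>" and b: "b \<in> poly_in S" "b \<noteq> 0"
    and lift: "\<And>y. b y \<noteq> 0 \<Longrightarrow> \<exists>w. (\<forall>i\<in>S. w i = y i) \<and> feasible K N h (chart_strat K N d \<sigma> w)"
  shows "irred_chain K d N (feasible_set K d N h) (card S)"
proof -
  let ?T = "chart_free K N d \<sigma>" let ?R = "poly_in ?T"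
  let ?f = "\<lambda>w. feasible K N h (chart_strat K N d \<sigma> w)"
  note R = is_subring_poly_in[of ?T]
  define I where "I = {p \<in> ?R. \<forall>w. ?f w \<longrightarrow> p w = 0}"
  have id: "ideal_in ?R I" unfolding ideal_in_def I_def using is_subringD[OF R] by auto
  let ?M = "poly_in S - {0}"
  have M: "?M \<subseteq> ?R" "1 \<in> ?M"
    using poly_in_mono[OF S] is_subringD(2)[OF is_subring_poly_in[of S]] by (auto simp: fun_eq_iff)
  have mult: "p * q \<in> ?M" if "p \<in> ?M" "q \<in> ?M" for p q
    using that poly_fun_mult_eq_0[of p q] is_subringD(4)[OF is_subring_poly_in[of S], of p q]
    by (auto dest: poly_inD(1))
  \<comment> \<open>The ideal \<open>I\<close> need not be prime, so a prime above it that keeps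
    \<open>S\<close> independent must be found. A nonzero \<open>p\<close> in \<open>I\<close>
    depending on \<open>S\<close> only would have a point \<open>y\<close> with both
    \<open>p\<close> and \<open>b\<close> nonzero, and the lift of \<open>y\<close> to the fibre
    contradicts membership in \<open>I\<close>.\<close>
  have IM: "I \<inter> ?M = {}"
  proof (rule ccontr)
    assume "\<not> ?thesis"
    then obtain p where p: "p \<in> I" "p \<in> poly_in S" "p \<noteq> 0" by blast
    have "p * b \<noteq> 0" using poly_fun_mult_eq_0[OF poly_inD(1)[OF p(2)] poly_inD(1)[OF b(1)]] p(3) b(2) by blast
    then obtain y where y: "p y \<noteq> 0" "b y \<noteq> 0" by (auto simp: fun_eq_iff)
    obtain w where w: "\<forall>i\<in>S. w i = y i" "?f w" using lift[OF y(2)] by blast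
    have "p w = p y" by (rule poly_inD(2)[OF p(2)]) (use w in auto)
    with y(1) w(2) p(1) show False by (auto simp: I_def)
  qed
  obtain J where J: "I \<subseteq> J" "prime_in ?R J" "J \<inter> ?M = {}"
    by (rule prime_avoidance[OF R id M mult IM])
  have "J \<inter> poly_in S \<subseteq> {0}" using J(3) by blast
  then obtain Js where Js: "Js (card S) = J" "\<forall>k\<le>card S. prime_in ?R (Js k)" "\<forall>k<card S. Js (Suc k) \<subset> Js k"
    using prime_chain_above[OF finite_chart_free finite_subset[OF S finite_chart_free] S J(2)] by blast
  show ?thesis
  proof (rule irred_chain_from_primes[OF chart Js(2,3)])
    fix w assume w: "\<forall>p\<in>Js (card S). p w = 0"
    have "align_eqn N h (chart_point K N d \<sigma> w) q = 0" if q: "q \<in> h_index K d" for q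
    proof -
      have "(\<lambda>w. align_eqn N h (chart_point K N d \<sigma> w) q) \<in> ?R"
        by (rule poly_in_chart_point[of "\<lambda>x. align_eqn N h x q"], rule poly_fun_align_eqn) (rule pconst pvar)+
      then have "(\<lambda>w. align_eqn N h (chart_point K N d \<sigma> w) q) \<in> I"
        using q by (auto simp: I_def feasible_strat_of)
      then show ?thesis using w Js(1) J(1) by auto
    qed
    then show "chart_strat K N d \<sigma> w \<in> feasible_set K d N h"
      using strat_of_stiefel[OF chart_point_stiefel[OF chart]] by (auto simp: feasible_set_def feasible_strat_of)
  qed (auto simp: feasible_set_def)
qed

theorem theorem3:
  fixes K N d :: nat
  assumes "K \<ge> 3" and "N \<ge> 1" and "d \<ge> 1"
  shows "generic K N (\<lambda>h.
     let D = int K * int d * (2 * int N - (int K + 1) * int d) in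
       (D \<ge> 0 \<longrightarrow> feasible_set K d N h \<noteq> {} \<and> has_dim K d N (feasible_set K d N h) (nat D)) \<and>
       (D < 0 \<longrightarrow> feasible_set K d N h = {}))"
proof -
  define D where "D = int K * int d * (2 * int N - (int K + 1) * int d)"
  define q where "q = card (h_index K d)"
  have q: "int q = int K * (int K - 1) * int d * int d"
    using assms(1) by (simp add: q_def card_h_index of_nat_diff)
  \<comment> \<open>A chart has \<open>d\<close> distinct pivot rows, which forces
    \<open>d \<le> N\<close>, so the difference \<open>N - d\<close> is not truncated. For
    \<open>d > N\<close> there are no charts, and \<open>D\<close> is negative.\<close>
  have dim: "int (card (chart_free K N d \<sigma>)) = D + int q" "d \<le> N" if "is_chart K N d \<sigma>" for \<sigma>
  proof -
    have "0 < K" using assms(1) by simp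
    then have "(\<lambda>l. \<sigma> (True, 0, l)) ` {..<d} \<subseteq> {..<N}" "inj_on (\<lambda>l. \<sigma> (True, 0, l)) {..<d}"
      using that chart_lt[OF that] by (auto simp: is_chart_def)
    then show "d \<le> N" using card_inj_on_le[of "\<lambda>l. \<sigma> (True, 0, l)" "{..<d}" "{..<N}"] by simp
    then have "int (card (chart_free K N d \<sigma>)) = 2 * (int K * ((int N - int d) * int d))"
      unfolding card_chart_free[OF that] by (simp add: of_nat_diff)
    then show "int (card (chart_free K N d \<sigma>)) = D + int q" unfolding q D_def by (simp add: algebra_simps)
  qed
  let ?F = "feasible_set K d N"
  let ?fib = "\<lambda>\<sigma> h w. feasible K N h (chart_strat K N d \<sigma> w)"
  \<comment> \<open>By \<open>dim\<close> these are the pairs with \<open>D < card S\<close>; being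
    finitely many, they share one exceptional polynomial \<open>p1\<close>.\<close>
  define I where "I = (SIGMA \<sigma>:{\<sigma>. is_chart K N d \<sigma>}. {S. S \<subseteq> chart_free K N d \<sigma> \<and> card (chart_free K N d \<sigma>) < card S + q})"
  define Q1 where "Q1 = (\<lambda>(\<sigma>, S) h. \<exists>f\<in>poly_in S. f \<noteq> 0 \<and> (\<forall>w. ?fib \<sigma> h w \<longrightarrow> f w = 0))"
  have "finite I" unfolding I_def
    by (intro finite_SigmaI finite_charts) (rule finite_subset[OF _ finite_Pow_iff[THEN iffD2, OF finite_chart_free]], auto)
  then obtain p1 where p1: "p1 \<in> poly_in (h_index K N)" "p1 \<noteq> 0" "\<And>h. p1 h \<noteq> 0 \<Longrightarrow> \<forall>i\<in>I. Q1 i h"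
    using generic_finite[of I "h_index K N" Q1] generic_dependence by (force simp: I_def Q1_def q_def)
  define Q2 where "Q2 h \<longleftrightarrow> (D \<ge> 0 \<longrightarrow> (\<exists>\<sigma> S b. is_chart K N d \<sigma> \<and> S \<subseteq> chart_free K N d \<sigma> \<and> card S = nat D \<and>
    b \<in> poly_in S \<and> b \<noteq> 0 \<and> (\<forall>y. b y \<noteq> 0 \<longrightarrow> (\<exists>w. (\<forall>i\<in>S. w i = y i) \<and> ?fib \<sigma> h w))))" for h
  have "\<exists>p\<in>poly_in (h_index K N). p \<noteq> 0 \<and> (\<forall>h. p h \<noteq> 0 \<longrightarrow> Q2 h)"
  proof (cases "D \<ge> 0")
    case False
    then show ?thesis using p1(1,2) by (auto simp: Q2_def)
  next
    case True
    have "int K * int d > 0" using assms by simp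
    then have N2: "(int K + 1) * int d \<le> 2 * int N"
      using True unfolding D_def by (simp add: zero_le_mult_iff)
    \<comment> \<open>With \<open>K \<ge> 3\<close>, nonnegative \<open>D\<close> even gives
      \<open>2 d \<le> N\<close>, so the chart with pivots in the first \<open>d\<close> rows
      exists.\<close>
    have "4 * int d \<le> (int K + 1) * int d" using assms(1) by (intro mult_right_mono) auto
    then have dN: "d \<le> N" using N2 by linarith
    have "int ((K - 1) * d) \<le> int (2 * (N - d))" using N2 dN assms(1) by (simp add: of_nat_diff algebra_simps)
    then have r: "(K - 1) * d \<le> 2 * (N - d)" by linarith
    let ?\<sigma> = "std_chart K d"
    note chart = is_chart_std[OF dN, of K]
    have card: "q \<le> card (chart_free K N d ?\<sigma>)" "nat D = card (chart_free K N d ?\<sigma>) - q"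
      using dim[OF chart] True by linarith+
    obtain S where S: "S \<subseteq> chart_free K N d ?\<sigma>" "card S = nat D"
      "\<forall>P\<in>poly_in (Inl ` S \<union> Inr ` h_index K N). (\<forall>z. P (solve_pivots K N d ?\<sigma> z) = 0) \<longrightarrow> P = 0"
      using std_chart_independent[OF assms(1,3) dN r] card unfolding q_def by metis
    have "\<exists>p\<in>poly_in (h_index K N). p \<noteq> 0 \<and> (\<forall>h. p h \<noteq> 0 \<longrightarrow>
      (\<exists>b\<in>poly_in S. b \<noteq> 0 \<and> (\<forall>y. b y \<noteq> 0 \<longrightarrow> (\<exists>w. (\<forall>i\<in>S. w i = y i) \<and> ?fib ?\<sigma> h w))))"
      by (rule generic_fibre_projection[OF chart S(1)]) (use S(3) in blast)
    then obtain p where p: "p \<in> poly_in (h_index K N)" "p \<noteq> 0" and pb: "\<And>h. p h \<noteq> 0 \<Longrightarrow>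
      \<exists>b\<in>poly_in S. b \<noteq> 0 \<and> (\<forall>y. b y \<noteq> 0 \<longrightarrow> (\<exists>w. (\<forall>i\<in>S. w i = y i) \<and> ?fib ?\<sigma> h w))" by blast
    have "Q2 h" if "p h \<noteq> 0" for h
    proof -
      from pb[OF that] obtain b where "b \<in> poly_in S" "b \<noteq> 0"
        "\<forall>y. b y \<noteq> 0 \<longrightarrow> (\<exists>w. (\<forall>i\<in>S. w i = y i) \<and> ?fib ?\<sigma> h w)" by (elim bexE conjE)
      then show ?thesis unfolding Q2_def using chart S(1,2)
        by (intro impI exI[of _ ?\<sigma>] exI[of _ S] exI[of _ b] conjI)
    qed
    then show ?thesis using p by blast
  qed
  then obtain p2 where p2: "p2 \<in> poly_in (h_index K N)" "p2 \<noteq> 0" "\<And>h. p2 h \<noteq> 0 \<Longrightarrow> Q2 h" by blast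
  have "p1 * p2 \<noteq> 0"
    using poly_fun_mult_eq_0[OF poly_inD(1)[OF p1(1)] poly_inD(1)[OF p2(1)]] p1(2) p2(2) by blast
  show ?thesis
  proof (rule generic_from_poly[OF is_subringD(4)[OF is_subring_poly_in p1(1) p2(1)] \<open>p1 * p2 \<noteq> 0\<close>])
    fix h assume "(p1 * p2) h \<noteq> 0"
    then have p: "p1 h \<noteq> 0" "p2 h \<noteq> 0" by auto
    have dep: "\<exists>f\<in>poly_in S. f \<noteq> 0 \<and> (\<forall>w. ?fib \<sigma> h w \<longrightarrow> f w = 0)"
      if "is_chart K N d \<sigma>" "S \<subseteq> chart_free K N d \<sigma>" "D < int (card S)" for \<sigma> S
    proof -
      have "(\<sigma>, S) \<in> I" using that dim[OF that(1)] by (simp add: I_def)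
      then show ?thesis using p1(3)[OF p(1)] by (auto simp: Q1_def)
    qed
    have "?F h \<noteq> {} \<and> has_dim K d N (?F h) (nat D)" if D: "D \<ge> 0"
    proof -
      obtain \<sigma> S b where *: "is_chart K N d \<sigma>" "S \<subseteq> chart_free K N d \<sigma>" "card S = nat D" "b \<in> poly_in S" "b \<noteq> 0"
        and lift: "\<And>y. b y \<noteq> 0 \<Longrightarrow> \<exists>w. (\<forall>i\<in>S. w i = y i) \<and> ?fib \<sigma> h w"
        using p2(3)[OF p(2)] D unfolding Q2_def by blast
      have ch: "irred_chain K d N (?F h) (nat D)"
        using irred_chain_of_dominant_fibre[OF *(1,2,4,5) lift] *(3) by simp
      have "\<not> irred_chain K d N (?F h) (Suc (nat D))"
      proof
        assume "irred_chain K d N (?F h) (Suc (nat D))"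
        then obtain \<sigma> S where S: "is_chart K N d \<sigma>" "S \<subseteq> chart_free K N d \<sigma>" "card S = Suc (nat D)"
          and z: "\<And>f. f \<in> poly_in S \<Longrightarrow> (\<And>w. chart_strat K N d \<sigma> w \<in> ?F h \<Longrightarrow> f w = 0) \<Longrightarrow> f = 0"
          by (rule irred_chain_independent) (auto simp: feasible_set_def)
        have "D < int (card S)" using S(3) D by simp
        from dep[OF S(1,2) this] obtain f where f: "f \<in> poly_in S" "f \<noteq> 0" "\<And>w. ?fib \<sigma> h w \<Longrightarrow> f w = 0"
          by blast
        have "f = 0" by (rule z[OF f(1) f(3)]) (simp add: feasible_set_def)
        with f(2) show False by simp
      qed
      moreover have "?F h \<noteq> {}"
        using ch by (auto simp: irred_chain_def irreducible_in_def closed_in_sub_def)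
      ultimately show ?thesis using ch by (simp add: has_dim_def)
    qed
    moreover have "?F h = {}" if D: "D < 0"
    proof (rule ccontr)
      assume "?F h \<noteq> {}"
      then obtain s where s: "s \<in> strategies K d N" "feasible K N h s" by (auto simp: feasible_set_def)
      obtain x where x: "x \<in> stiefel_tuples K d N" "s = strat_of K d N x" by (rule strategies_strat_of[OF s(1)])
      obtain \<sigma> w where w: "is_chart K N d \<sigma>" "chart_strat K N d \<sigma> w = strat_of K d N x"
        by (rule stiefel_in_chart[OF x(1)])
      \<comment> \<open>For negative \<open>D\<close> the empty set already has more than
        \<open>D\<close> elements, so a nonzero constant would vanish at the feasible point.\<close>
      obtain f where f: "f \<in> poly_in {}" "f \<noteq> 0" "\<And>w. ?fib \<sigma> h w \<Longrightarrow> f w = 0"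
        using dep[OF w(1), of "{}"] D by auto
      have "f w = 0" using f(3) w(2) x(2) s(2) by simp
      moreover obtain c where "f = (\<lambda>_. c)" using poly_in_empty[OF f(1)] by blast
      ultimately show False using f(2) by (auto simp: fun_eq_iff)
    qed
    ultimately show "let D = int K * int d * (2 * int N - (int K + 1) * int d) in
       (D \<ge> 0 \<longrightarrow> feasible_set K d N h \<noteq> {} \<and> has_dim K d N (feasible_set K d N h) (nat D)) \<and>
       (D < 0 \<longrightarrow> feasible_set K d N h = {})" unfolding Let_def D_def[symmetric] by blast
  qed
qed

end
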